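(* Let $X$ be a smooth manifold of dimension $n$, let $M\to X$ be the bundle of pseudo-Riemannian metrics of a fixed signature, let $p\ge 1$, $x\in X$, and for $m\ge 1$ let $\mathrm{Div}_x^m\subset \otimes^p T_xX\otimes S^mN^2$ be the vector space defined in the context. If $m\geq n/2$, then $\mathrm{Div}_x^m=0$. As a consequence, any divergence-free, natural tensor $T\colon J^2M\to\otimes^pTX$ is polynomial (in the second derivatives of the metric), of degree less than or equal to $(n-1)/2$.
   Context: $X$ is a smooth manifold of dimension $n$; $M\to X$ is the bundle of pseudo-Riemannian metrics of a fixed signature; $J^kM$ is the bundle of $k$-jets of sections of $M$. A second-order $p$-tensor is a smooth morphism of bundles $T\colon J^2M\to\otimes^pTX$ (over the identity of $X$); for a metric $g$, $T(g)$ is the contravariant tensor field $x\mapsto T(j^2_xg)$. It is natural if $T(\tau\cdot j^2_xg)=\tau_*T(j^2_xg)$ for every diffeomorphism $\tau\colon U\to V$ between open sets of $X$ and every metric $g$ (of the fixed signature) near $x\in U$, where $\tau\cdot j^2_xg:=j^2_{\tau(x)}(\tau_*g)$. Divergence: $(\mathrm{div}\,T)(g)^{j_1\ldots j_{p-1}}=\nabla_kT(g)^{j_1\ldots j_{p-1}k}$, with $\nabla$ the Levi-Civita connection of $g$. $T$ is divergence-free if $(\mathrm{div}\,T)(g)=0$ for every metric $g$ (of the fixed signature, on any open set). Polynomial: the fibre $\mathbb{A}_{j^1_xg}$ of $J^2_xM\to J^1_xM$ over $j^1_xg$ is an affine space modelled on $S^2T_x^*X\otimes S^2T_x^*X$ (in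 a chart, with affine coordinates the second derivatives $g_{ab,cd}$). $T$ is polynomial (in the second derivatives of the metric) of degree $<m$ if its restriction to every fibre, $T_|\colon\mathbb{A}_{j^1_xg}\to\otimes^pT_xX$, is a polynomial map of degree $<m$. Contravariant normal tensors: $N^2\subset S^2(T_xX)\otimes S^2(T_xX)$ is the kernel of the symmetrization in the last $3$ indices. For $m\ge1$, $\mathrm{Div}_x^m\subset\otimes^pT_xX\otimes S^mN^2$ is the subspace of tensors whose components satisfy $0=\sum_{(j_p\,c_1\,d_1)}T^{j_1\ldots j_p;\,a_1b_1c_1d_1\,\ldots\,a_mb_mc_md_m}$, the sum being over the cyclic permutations of the three indices $j_p,c_1,d_1$; that is, $T^{j_1\ldots j_p;\,a_1b_1c_1d_1\ldots}+T^{j_1\ldots d_1;\,a_1b_1j_pc_1\ldots}+T^{j_1\ldots c_1;\,a_1b_1d_1j_p\ldots}=0$. *)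

theory Defs
  imports "HOL-Analysis.Analysis" "HOL-Library.Multiset"
begin

section \<open>Smooth maps between Euclidean spaces\<close>

fun Ck_on :: "nat \<Rightarrow> 'a::euclidean_space set \<Rightarrow> ('a \<Rightarrow> 'b::real_normed_vector) \<Rightarrow> bool" where
  "Ck_on 0 S f \<longleftrightarrow> continuous_on S f"
| "Ck_on (Suc k) S f \<longleftrightarrow>
     f differentiable_on S \<and> (\<forall>v. Ck_on k S (\<lambda>x. frechet_derivative f (at x) v))"

text \<open>On an arbitrary set \<open>S\<close>, smoothness means that there are local smooth extensions.  This is the
  usual notion when \<open>S\<close> is open or an embedded submanifold; the latter case is needed for jet
  coordinates, which are constrained by symmetries.\<close>

definition smooth_on :: "'a::euclidean_space set \<Rightarrow> ('a \<Rightarrow> 'b::real_normed_vector) \<Rightarrow> bool" where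
  "smooth_on S f \<longleftrightarrow>
     (\<forall>x\<in>S. \<exists>U h. open U \<and> x \<in> U \<and> (\<forall>k. Ck_on k U h) \<and> (\<forall>y\<in>S \<inter> U. h y = f y))"

definition pd :: "'n::finite \<Rightarrow> (real^'n \<Rightarrow> 'b::real_normed_vector) \<Rightarrow> real^'n \<Rightarrow> 'b" where
  "pd k f y = frechet_derivative f (at y) (axis k 1)"

fun pds :: "'n::finite list \<Rightarrow> (real^'n \<Rightarrow> 'b::real_normed_vector) \<Rightarrow> real^'n \<Rightarrow> 'b" where
  "pds [] f = f"
| "pds (k # ks) f = pd k (pds ks f)"


section \<open>Manifolds\<close>

text \<open>The manifold is the whole type \<open>'x\<close>, its dimension is \<open>CARD('n)\<close>.  A chart is a domain together
  with a coordinate map; values of the coordinate map outside the domain are irrelevant.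
  The atlas need not be maximal.\<close>

type_synonym ('x, 'n) chart = "'x set \<times> ('x \<Rightarrow> real^'n)"

abbreviation cinv :: "('x, 'n) chart \<Rightarrow> (real^'n) \<Rightarrow> 'x" where
  "cinv c \<equiv> inv_into (fst c) (snd c)"

definition smooth_atlas :: "('x::topological_space, 'n::finite) chart set \<Rightarrow> bool" where
  "smooth_atlas A \<longleftrightarrow>
     (\<Union>c\<in>A. fst c) = UNIV \<and>
     (\<forall>c\<in>A. open (fst c) \<and> open (snd c ` fst c) \<and>
        homeomorphism (fst c) (snd c ` fst c) (snd c) (cinv c)) \<and>
     (\<forall>c\<in>A. \<forall>d\<in>A. smooth_on (snd c ` (fst c \<inter> fst d)) (snd d \<circ> cinv c))"

definition charts_at :: "('x, 'n::finite) chart set \<Rightarrow> 'x \<Rightarrow> ('x, 'n) chart set" where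
  "charts_at A x = {c \<in> A. x \<in> fst c}"

definition some_chart :: "('x, 'n::finite) chart set \<Rightarrow> 'x \<Rightarrow> ('x, 'n) chart" where
  "some_chart A x = (SOME c. c \<in> charts_at A x)"

definition smooth_map_on ::
    "('x::topological_space, 'n::finite) chart set \<Rightarrow> 'x set \<Rightarrow> ('x \<Rightarrow> 'x) \<Rightarrow> bool" where
  "smooth_map_on A U f \<longleftrightarrow> continuous_on U f \<and>
     (\<forall>c\<in>A. \<forall>d\<in>A. smooth_on (snd c ` {x \<in> U \<inter> fst c. f x \<in> fst d}) (snd d \<circ> f \<circ> cinv c))"

definition diffeo ::
    "('x::topological_space, 'n::finite) chart set \<Rightarrow> 'x set \<Rightarrow> 'x set \<Rightarrow> ('x \<Rightarrow> 'x) \<Rightarrow> bool" where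
  "diffeo A U V f \<longleftrightarrow> open U \<and> open V \<and> bij_betw f U V \<and>
     smooth_map_on A U f \<and> smooth_map_on A V (inv_into U f)"

text \<open>Jacobian matrix at \<open>x\<close> of \<open>f\<close>, read in \<open>c\<close> around \<open>x\<close> and \<open>d\<close> around \<open>f x\<close>; the row index belongs
  to the target chart \<open>d\<close>.\<close>

definition jac :: "('x, 'n::finite) chart \<Rightarrow> ('x, 'n) chart \<Rightarrow> ('x \<Rightarrow> 'x) \<Rightarrow> 'x \<Rightarrow> real^'n^'n" where
  "jac c d f x = jacobian (snd d \<circ> f \<circ> cinv c) (at (snd c x))"


section \<open>Contravariant tensors at a point\<close>

text \<open>A contravariant \<open>p\<close>-tensor at \<open>x\<close> is the family of its components \<open>t c [j1, \<dots>, jp]\<close> in the charts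
  \<open>c\<close> around \<open>x\<close>, subject to the transformation law.  By convention the components are \<open>0\<close> for charts
  not around \<open>x\<close> and for index lists of length other than \<open>p\<close>, so that equality of tensors is
  equality of functions.\<close>

type_synonym ('x, 'n) tensor = "('x, 'n) chart \<Rightarrow> 'n list \<Rightarrow> real"

definition transform :: "real^'n^'n \<Rightarrow> ('n::finite list \<Rightarrow> real) \<Rightarrow> 'n list \<Rightarrow> real" where
  "transform M t J =
     (\<Sum>I | length I = length J. (\<Prod>a<length J. M $ (J ! a) $ (I ! a)) * t I)"

definition tensors_at :: "('x, 'n::finite) chart set \<Rightarrow> nat \<Rightarrow> 'x \<Rightarrow> ('x, 'n) tensor set" where
  "tensors_at A p x =
     {t. (\<forall>c J. c \<notin> charts_at A x \<or> length J \<noteq> p \<longrightarrow> t c J = 0) \<and>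
         (\<forall>c\<in>charts_at A x. \<forall>d\<in>charts_at A x. t d = transform (jac c d id x) (t c))}"

definition push_tensor ::
    "('x, 'n::finite) chart set \<Rightarrow> ('x \<Rightarrow> 'x) \<Rightarrow> 'x \<Rightarrow> ('x, 'n) tensor \<Rightarrow> ('x, 'n) tensor" where
  "push_tensor A \<tau> x t =
     (\<lambda>d. if d \<in> charts_at A (\<tau> x)
          then transform (jac (some_chart A x) d \<tau> x) (t (some_chart A x))
          else (\<lambda>J. 0))"

text \<open>For subspaces \<open>V\<close> of the \<open>p\<close>-tensors and \<open>W\<close> of the tensors of some other order, the subspace
  \<open>V \<otimes> W\<close> of finite sums of decomposable tensors \<open>v \<otimes> w\<close>.\<close>

definition tensor_product ::
    "nat \<Rightarrow> ('x, 'n) tensor set \<Rightarrow> ('x, 'n) tensor set \<Rightarrow> ('x, 'n) tensor set" where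
  "tensor_product p V W =
     {(\<lambda>c K. \<Sum>i<N. v i c (take p K) * w i c (drop p K)) | (N::nat) v w.
        \<forall>i<N. v i \<in> V \<and> w i \<in> W}"

definition normal2 :: "('x, 'n::finite) chart set \<Rightarrow> 'x \<Rightarrow> ('x, 'n) tensor set" where
  "normal2 A x =
     {t \<in> tensors_at A 4 x. \<forall>\<phi>\<in>charts_at A x. \<forall>a b c d.
        t \<phi> [a,b,c,d] = t \<phi> [b,a,c,d] \<and> t \<phi> [a,b,c,d] = t \<phi> [a,b,d,c] \<and>
        t \<phi> [a,b,c,d] + t \<phi> [a,c,d,b] + t \<phi> [a,d,b,c]
          + t \<phi> [a,b,d,c] + t \<phi> [a,c,b,d] + t \<phi> [a,d,c,b] = 0}"

fun normal2_power :: "('x, 'n::finite) chart set \<Rightarrow> nat \<Rightarrow> 'x \<Rightarrow> ('x, 'n) tensor set" where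
  "normal2_power A 0 x = tensors_at A 0 x"
| "normal2_power A (Suc m) x = tensor_product 4 (normal2 A x) (normal2_power A m x)"

text \<open>\<open>S\<^sup>m N\<^sup>2\<close> as the tensors in the \<open>m\<close>-th tensor power of \<open>N\<^sup>2\<close> that are invariant under permutations
  of the \<open>m\<close> blocks of four indices.\<close>

definition normal2_sym :: "('x, 'n::finite) chart set \<Rightarrow> nat \<Rightarrow> 'x \<Rightarrow> ('x, 'n) tensor set" where
  "normal2_sym A m x =
     {t \<in> normal2_power A m x. \<forall>c\<in>charts_at A x. \<forall>Bs Bs'.
        (\<forall>B\<in>set Bs. length B = 4) \<and> mset Bs = mset Bs' \<longrightarrow> t c (concat Bs) = t c (concat Bs')}"

definition Div :: "('x, 'n::finite) chart set \<Rightarrow> nat \<Rightarrow> nat \<Rightarrow> 'x \<Rightarrow> ('x, 'n) tensor set" where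
  "Div A p m x =
     {t \<in> tensor_product p (tensors_at A p x) (normal2_sym A m x).
        \<forall>\<phi>\<in>charts_at A x. \<forall>J j a b c d R. length J = p - 1 \<longrightarrow>
          t \<phi> (J @ [j] @ [a,b,c,d] @ R) + t \<phi> (J @ [d] @ [a,b,j,c] @ R)
            + t \<phi> (J @ [c] @ [a,b,d,j] @ R) = 0}"


section \<open>Metrics and their jets\<close>

text \<open>Signature \<open>(q, r)\<close>: \<open>q\<close> plus signs and \<open>r\<close> minus signs.\<close>

definition has_signature :: "nat \<Rightarrow> nat \<Rightarrow> real^'n^'n \<Rightarrow> bool" where
  "has_signature q r G \<longleftrightarrow> transpose G = G \<and> q + r = CARD('n) \<and>
     (\<exists>P N. subspace P \<and> subspace N \<and> dim P = q \<and> dim N = r \<and>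
        (\<forall>v\<in>P. v \<noteq> 0 \<longrightarrow> v \<bullet> (G *v v) > 0) \<and> (\<forall>v\<in>N. v \<noteq> 0 \<longrightarrow> v \<bullet> (G *v v) < 0))"

text \<open>A metric is given at each point by its matrices of components in the charts around that point.
  It is a total function, of which only the values near the relevant points matter.\<close>

type_synonym ('x, 'n) metric = "'x \<Rightarrow> ('x, 'n) chart \<Rightarrow> real^'n^'n"

definition metric_on ::
    "('x::topological_space, 'n::finite) chart set \<Rightarrow> nat \<Rightarrow> nat \<Rightarrow> 'x set \<Rightarrow> ('x, 'n) metric \<Rightarrow> bool" where
  "metric_on A q r U g \<longleftrightarrow> open U \<and>
     (\<forall>x\<in>U. \<forall>c\<in>charts_at A x. has_signature q r (g x c)) \<and>
     (\<forall>x\<in>U. \<forall>c\<in>charts_at A x. \<forall>d\<in>charts_at A x.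
        g x c = transpose (jac c d id x) ** g x d ** jac c d id x) \<and>
     (\<forall>c\<in>A. smooth_on (snd c ` (U \<inter> fst c)) (\<lambda>y. g (cinv c y) c))"

definition metrics_near ::
    "('x::topological_space, 'n::finite) chart set \<Rightarrow> nat \<Rightarrow> nat \<Rightarrow> 'x \<Rightarrow> ('x, 'n) metric set" where
  "metrics_near A q r x = {g. \<exists>U. x \<in> U \<and> metric_on A q r U g}"

definition push_metric ::
    "('x, 'n::finite) chart set \<Rightarrow> ('x \<Rightarrow> 'x) \<Rightarrow> 'x set \<Rightarrow> ('x, 'n) metric \<Rightarrow> ('x, 'n) metric" where
  "push_metric A \<tau> U g =
     (\<lambda>y d. let x = inv_into U \<tau> y; c = some_chart A x; M = jac d c (inv_into U \<tau>) y
            in transpose M ** g x c ** M)"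

definition local_rep :: "('x, 'n) metric \<Rightarrow> ('x, 'n::finite) chart \<Rightarrow> real^'n \<Rightarrow> real^'n^'n" where
  "local_rep g c y = g (cinv c y) c"

text \<open>The \<open>k\<close>-jet at \<open>x\<close> of \<open>g\<close>, as an equivalence class of metrics of signature \<open>(q, r)\<close> near \<open>x\<close>.\<close>

type_synonym ('x, 'n) jet = "'x \<times> ('x, 'n) metric set"

definition jet ::
    "('x::topological_space, 'n::finite) chart set \<Rightarrow> nat \<Rightarrow> nat \<Rightarrow> nat \<Rightarrow> 'x \<Rightarrow> ('x, 'n) metric \<Rightarrow>
     ('x, 'n) jet" where
  "jet A q r k x g =
     (x, {h \<in> metrics_near A q r x. \<forall>c\<in>charts_at A x. \<forall>ks. length ks \<le> k \<longrightarrow>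
            pds ks (local_rep h c) (snd c x) = pds ks (local_rep g c) (snd c x)})"

definition second_derivs :: "('x, 'n) metric \<Rightarrow> ('x, 'n::finite) chart \<Rightarrow> 'x \<Rightarrow> real^'n^'n^'n^'n" where
  "second_derivs g c x = (\<chi> k l. pd k (pd l (local_rep g c)) (snd c x))"

text \<open>Coordinates of \<open>j\<^sup>2\<^sub>x g\<close> in the chart of the jet bundle induced by \<open>c\<close>.\<close>

definition jet2_coords :: "('x, 'n) metric \<Rightarrow> ('x, 'n::finite) chart \<Rightarrow> 'x \<Rightarrow>
    (real^'n) \<times> (real^'n^'n) \<times> (real^'n^'n^'n) \<times> (real^'n^'n^'n^'n)" where
  "jet2_coords g c x =
     (snd c x, g x c, (\<chi> k. pd k (local_rep g c) (snd c x)), second_derivs g c x)"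


section \<open>Second-order tensors\<close>

definition second_order_tensor ::
    "('x::topological_space, 'n::finite) chart set \<Rightarrow> nat \<Rightarrow> nat \<Rightarrow> nat \<Rightarrow>
     (('x, 'n) jet \<Rightarrow> ('x, 'n) tensor) \<Rightarrow> bool" where
  "second_order_tensor A q r p T \<longleftrightarrow>
     (\<forall>x. \<forall>g\<in>metrics_near A q r x. T (jet A q r 2 x g) \<in> tensors_at A p x) \<and>
     (\<forall>c\<in>A. \<forall>J. \<exists>F :: _ \<Rightarrow> real.
        smooth_on {jet2_coords g c x | x g. x \<in> fst c \<and> g \<in> metrics_near A q r x} F \<and>
        (\<forall>x\<in>fst c. \<forall>g\<in>metrics_near A q r x. T (jet A q r 2 x g) c J = F (jet2_coords g c x)))"

definition natural_tensor ::
    "('x::topological_space, 'n::finite) chart set \<Rightarrow> nat \<Rightarrow> nat \<Rightarrow>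
     (('x, 'n) jet \<Rightarrow> ('x, 'n) tensor) \<Rightarrow> bool" where
  "natural_tensor A q r T \<longleftrightarrow>
     (\<forall>\<tau> U V. diffeo A U V \<tau> \<longrightarrow>
        (\<forall>x\<in>U. \<forall>g\<in>metrics_near A q r x.
           T (jet A q r 2 (\<tau> x) (push_metric A \<tau> U g)) = push_tensor A \<tau> x (T (jet A q r 2 x g))))"

text \<open>Christoffel symbols \<open>\<Gamma>\<^sup>i\<^sub>k\<^sub>l\<close> of the Levi-Civita connection of the local metric \<open>G\<close>.\<close>

definition christoffel ::
    "(real^'n \<Rightarrow> real^'n^'n) \<Rightarrow> real^'n \<Rightarrow> 'n::finite \<Rightarrow> 'n \<Rightarrow> 'n \<Rightarrow> real" where
  "christoffel G y i k l =
     1/2 * (\<Sum>m\<in>UNIV. matrix_inv (G y) $ i $ m *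
       (pd k G y $ m $ l + pd l G y $ m $ k - pd m G y $ k $ l))"

text \<open>Components \<open>\<nabla>\<^sub>k t\<^sup>J\<close> of the covariant derivative of a contravariant tensor field.\<close>

definition cov_deriv ::
    "(real^'n \<Rightarrow> real^'n^'n) \<Rightarrow> ('n::finite list \<Rightarrow> real^'n \<Rightarrow> real) \<Rightarrow> 'n \<Rightarrow> 'n list \<Rightarrow> real^'n \<Rightarrow> real"
  where
  "cov_deriv G t k J y =
     pd k (t J) y + (\<Sum>a<length J. \<Sum>l\<in>UNIV. christoffel G y (J ! a) k l * t (J[a := l]) y)"

definition div_comp ::
    "('x::topological_space, 'n::finite) chart set \<Rightarrow> nat \<Rightarrow> nat \<Rightarrow>
     (('x, 'n) jet \<Rightarrow> ('x, 'n) tensor) \<Rightarrow> ('x, 'n) metric \<Rightarrow> ('x, 'n) chart \<Rightarrow> 'n list \<Rightarrow> 'x \<Rightarrow> real"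
  where
  "div_comp A q r T g c J x =
     (\<Sum>k\<in>UNIV. cov_deriv (local_rep g c) (\<lambda>I y. T (jet A q r 2 (cinv c y) g) c I) k (J @ [k])
        (snd c x))"

definition divergence_free ::
    "('x::topological_space, 'n::finite) chart set \<Rightarrow> nat \<Rightarrow> nat \<Rightarrow> nat \<Rightarrow>
     (('x, 'n) jet \<Rightarrow> ('x, 'n) tensor) \<Rightarrow> bool" where
  "divergence_free A q r p T \<longleftrightarrow>
     (\<forall>U g. metric_on A q r U g \<longrightarrow>
        (\<forall>x\<in>U. \<forall>c\<in>charts_at A x. \<forall>J. length J = p - 1 \<longrightarrow> div_comp A q r T g c J x = 0))"

definition poly_deg_less :: "nat \<Rightarrow> (('i::finite \<Rightarrow> real) \<Rightarrow> real) \<Rightarrow> bool" where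
  "poly_deg_less m P \<longleftrightarrow>
     (\<exists>coef. \<forall>v. P v = (\<Sum>\<alpha> | sum \<alpha> UNIV < m. coef \<alpha> * (\<Prod>i\<in>UNIV. v i ^ \<alpha> i)))"

text \<open>On each fibre of \<open>J\<^sup>2 M \<rightarrow> J\<^sup>1 M\<close>, here the one over the 1-jet of \<open>g\<close> at \<open>x\<close>, the components are
  polynomials in the second derivatives of the metric.\<close>

definition polynomial_tensor_deg_less ::
    "('x::topological_space, 'n::finite) chart set \<Rightarrow> nat \<Rightarrow> nat \<Rightarrow> nat \<Rightarrow>
     (('x, 'n) jet \<Rightarrow> ('x, 'n) tensor) \<Rightarrow> bool" where
  "polynomial_tensor_deg_less A q r m T \<longleftrightarrow>
     (\<forall>x. \<forall>g\<in>metrics_near A q r x. \<forall>c\<in>charts_at A x. \<forall>J. \<exists>P. poly_deg_less m P \<and>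
        (\<forall>h\<in>metrics_near A q r x. jet A q r 1 x h = jet A q r 1 x g \<longrightarrow>
           T (jet A q r 2 x h) c J = P (\<lambda>(a, b, k, l). second_derivs h c x $ k $ l $ a $ b)))"

end

theory Submission
  imports Defs
begin

text \<open>Contract the \<open>i\<close>-th block of a tensor in \<open>Div\<^sup>m\<close> with \<open>u\<^sub>i \<otimes> u\<^sub>i \<otimes> w\<^sub>i \<otimes> w\<^sub>i\<close>, leaving only the index \<open>j\<^sub>p\<close>.
  The cyclic identity, together with the pair symmetry of \<open>N\<^sup>2\<close>, says that the resulting covector vanishes on
  all the \<open>2m\<close> vectors \<open>u\<^sub>i, w\<^sub>i\<close>.  If \<open>2m \<ge> n\<close> these span for a generic choice, so the covector is zero,
  hence zero for every choice by continuity, and the tensor is zero by polarization.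

  Along a fibre of \<open>J\<^sup>2M \<rightarrow> J\<^sup>1M\<close> the same argument works with finite differences instead of derivatives.
  Metrics with the same 2-jet and different third derivatives show that a divergence-free \<open>T\<close> satisfies
  \<open>l \<bullet> T (H + s ll \<otimes> \<alpha>) = l \<bullet> T H\<close>; diffeomorphisms with trivial 2-jet show that a natural \<open>T\<close> satisfies
  \<open>T (H + ll \<otimes> (vl + lv)) = T H\<close>, so that \<open>ll \<otimes> uu\<close> may be replaced by \<open>uu \<otimes> ll\<close>.  Therefore every
  \<open>m\<close>-fold difference of \<open>T\<close> along increments \<open>l\<^sub>il\<^sub>i \<otimes> u\<^sub>iu\<^sub>i\<close> is annihilated by all \<open>l\<^sub>i, u\<^sub>i\<close> and vanishes when
  \<open>2m \<ge> n\<close>, and a smooth function whose \<open>m\<close>-fold differences vanish is a polynomial of degree less than \<open>m\<close>.\<close>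

section \<open>Calculus of smooth maps\<close>

text \<open>Finite differences are used because both symmetries of the tensor integrate to exact
  invariances under translations of the fibre; only first derivatives of the tensor are then needed
  to obtain them. In the divergence, third derivatives of the metric enter only through the first
  derivatives of \<open>T\<close>, everything else being determined by the 2-jet; a cubic
  perturbation of the metric isolates this part. On the other side, the directions
  \<open>quad (outer l l) (outer v l + outer l v)\<close> span the annihilator of N^2 in the
  symmetric arrays, which is why the pair symmetry of N^2 has a counterpart along the fibre. The
  diffeomorphisms are shears whose inverses lie in the same family and are therefore explicit, at
  the price of a condition \<open>l \<bullet> w \<noteq> 0\<close> that is removed afterwards by
  splitting \<open>w\<close>. One obstacle shapes the formal side: jet coordinates fill a set that
  need not be open, since second derivatives are symmetric. Hence the restriction of
  \<open>T\<close> to a fibre is composed with the projection \<open>sym4\<close>, and its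
  derivatives are computed through local smooth extensions.\<close>

lemma Ck_on_SucD:
  assumes "Ck_on (Suc k) S f" "open S" "x \<in> S"
  shows "(f has_derivative frechet_derivative f (at x)) (at x)"
  using assms differentiable_on_eq_differentiable_at[of S f] frechet_derivative_works[of f "at x"] by simp

lemma Ck_on_cong:
  "\<lbrakk>open S; \<And>x. x \<in> S \<Longrightarrow> f x = g x; Ck_on k S f\<rbrakk> \<Longrightarrow> Ck_on k S g"
proof (induction k arbitrary: f g)
  case 0
  then show ?case by (simp cong: continuous_on_cong)
next
  case (Suc k)
  have g: "(g has_derivative frechet_derivative f (at x)) (at x)" if "x \<in> S" for x
    using has_derivative_transform_within_open[OF Ck_on_SucD[OF Suc.prems(3,1) that] \<open>open S\<close> that]
      Suc.prems(2) by blast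
  then have "g differentiable_on S"
    using Suc.prems(1) differentiable_on_eq_differentiable_at differentiableI by blast
  moreover have "Ck_on k S (\<lambda>x. frechet_derivative g (at x) v)" for v
    by (rule Suc.IH[OF Suc.prems(1), of "\<lambda>x. frechet_derivative f (at x) v"])
      (use Suc.prems(3) frechet_derivative_at[OF g] in auto)
  ultimately show ?case by simp
qed

text \<open>Any known derivative may be supplied, so smoothness proofs need not evaluate
  \<open>frechet_derivative\<close>.\<close>

lemma Ck_on_SucI:
  assumes "open S" "\<And>x. x \<in> S \<Longrightarrow> (f has_derivative f' x) (at x)"
    and "\<And>v. Ck_on k S (\<lambda>x. f' x v)"
  shows "Ck_on (Suc k) S f"
proof -
  have "f differentiable_on S"
    using assms(1,2) differentiable_on_eq_differentiable_at differentiableI by blast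
  moreover have "Ck_on k S (\<lambda>x. frechet_derivative f (at x) v)" for v
    by (rule Ck_on_cong[OF assms(1) _ assms(3)[of v]])
      (simp add: frechet_derivative_at[OF assms(2), symmetric])
  ultimately show ?thesis by simp
qed

lemma Ck_on_subset: "Ck_on k S f \<Longrightarrow> T \<subseteq> S \<Longrightarrow> Ck_on k T f"
proof (induction k arbitrary: f)
  case 0
  then show ?case using continuous_on_subset by auto
next
  case (Suc k)
  then show ?case using differentiable_on_subset by auto
qed

lemma Ck_on_SucD_le: "open S \<Longrightarrow> Ck_on (Suc k) S f \<Longrightarrow> Ck_on k S f"
proof (induction k arbitrary: f)
  case 0
  then show ?case by (simp add: differentiable_imp_continuous_on)
next
  case (Suc k)
  show ?case
    using Suc.prems Suc.IH[OF Suc.prems(1)] unfolding Ck_on.simps(2) by blast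
qed

lemma Ck_on_local:
  assumes "\<And>x. x \<in> S \<Longrightarrow> \<exists>U. open U \<and> x \<in> U \<and> Ck_on k U f"
  shows "Ck_on k S f"
  using assms
proof (induction k arbitrary: f)
  case 0
  have "continuous (at x within S) f" if "x \<in> S" for x
    using 0[OF that] continuous_on_eq_continuous_at continuous_at_imp_continuous_at_within
    by (metis Ck_on.simps(1))
  then show ?case by (simp add: continuous_on_eq_continuous_within)
next
  case (Suc k)
  have "f differentiable_on S"
    unfolding differentiable_on_def
    using Suc.prems differentiable_on_eq_differentiable_at differentiable_at_withinI
    by (metis Ck_on.simps(2))
  moreover have "Ck_on k S (\<lambda>x. frechet_derivative f (at x) v)" for v
  proof (rule Suc.IH)
    fix x assume "x \<in> S"
    then obtain U where "open U" "x \<in> U" "Ck_on (Suc k) U f"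
      using Suc.prems by blast
    then show "\<exists>U. open U \<and> x \<in> U \<and> Ck_on k U (\<lambda>x. frechet_derivative f (at x) v)"
      by auto
  qed
  ultimately show ?case by simp
qed

lemma Ck_on_const: "Ck_on k S (\<lambda>x. c)"
  by (induction k arbitrary: c) auto

lemma Ck_on_bounded_linear_compose:
  assumes "bounded_linear L" "open S"
  shows "Ck_on k S f \<Longrightarrow> Ck_on k S (\<lambda>x. L (f x))"
proof (induction k arbitrary: f)
  case 0
  then show ?case using bounded_linear.continuous_on[OF assms(1)] by auto
next
  case (Suc k)
  show ?case
  proof (rule Ck_on_SucI[OF \<open>open S\<close>])
    show "((\<lambda>x. L (f x)) has_derivative (\<lambda>v. L (frechet_derivative f (at x) v))) (at x)"
      if "x \<in> S" for x
      using bounded_linear.has_derivative[OF assms(1) Ck_on_SucD[OF Suc.prems assms(2) that]] .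
    show "Ck_on k S (\<lambda>x. L (frechet_derivative f (at x) v))" for v
      by (rule Suc.IH) (use Suc.prems in simp)
  qed
qed

lemma Ck_on_add:
  assumes "open S"
  shows "Ck_on k S f \<Longrightarrow> Ck_on k S g \<Longrightarrow> Ck_on k S (\<lambda>x. f x + g x)"
proof (induction k arbitrary: f g)
  case 0
  then show ?case by (auto intro: continuous_on_add)
next
  case (Suc k)
  show ?case
  proof (rule Ck_on_SucI[OF \<open>open S\<close>])
    show "((\<lambda>x. f x + g x) has_derivative
        (\<lambda>v. frechet_derivative f (at x) v + frechet_derivative g (at x) v)) (at x)"
      if "x \<in> S" for x
      by (intro has_derivative_add Ck_on_SucD[OF Suc.prems(1) assms that] Ck_on_SucD[OF Suc.prems(2) assms that])
    show "Ck_on k S (\<lambda>x. frechet_derivative f (at x) v + frechet_derivative g (at x) v)" for v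
      by (rule Suc.IH) (use Suc.prems in simp_all)
  qed
qed

text \<open>The product rule leaves one factor undifferentiated; that factor is of class
  \<open>k\<close> by \<open>Ck_on_SucD_le\<close>. Scalar, scaled-vector and matrix products are
  all instances.\<close>

lemma Ck_on_bounded_bilinear:
  assumes "bounded_bilinear bop" "open S"
  shows "Ck_on k S f \<Longrightarrow> Ck_on k S g \<Longrightarrow> Ck_on k S (\<lambda>x. bop (f x) (g x))"
proof (induction k arbitrary: f g)
  case 0
  then show ?case using bounded_bilinear.continuous_on[OF assms(1)] by auto
next
  case (Suc k)
  show ?case
  proof (rule Ck_on_SucI[OF \<open>open S\<close>])
    show "((\<lambda>x. bop (f x) (g x)) has_derivative
        (\<lambda>v. bop (f x) (frechet_derivative g (at x) v) + bop (frechet_derivative f (at x) v) (g x))) (at x)"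
      if "x \<in> S" for x
      using bounded_bilinear.FDERIV[OF assms(1) Ck_on_SucD[OF Suc.prems(1) assms(2) that]
        Ck_on_SucD[OF Suc.prems(2) assms(2) that]] .
    show "Ck_on k S (\<lambda>x. bop (f x) (frechet_derivative g (at x) v)
        + bop (frechet_derivative f (at x) v) (g x))" for v
      using Suc.prems Ck_on_SucD_le[OF assms(2) Suc.prems(1)] Ck_on_SucD_le[OF assms(2) Suc.prems(2)]
      by (intro Ck_on_add[OF assms(2)] Suc.IH) simp_all
  qed
qed

text \<open>On open sets this agrees with \<open>smooth_on\<close> (see
  \<open>smooth_on_open\<close>), but there are no local extensions to carry along.\<close>

definition Cinf :: "'a::euclidean_space set \<Rightarrow> ('a \<Rightarrow> 'b::real_normed_vector) \<Rightarrow> bool" where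
  "Cinf S f \<longleftrightarrow> (\<forall>k. Ck_on k S f)"

lemma Cinf_cong: "\<lbrakk>open S; \<And>x. x \<in> S \<Longrightarrow> f x = g x; Cinf S f\<rbrakk> \<Longrightarrow> Cinf S g"
  unfolding Cinf_def using Ck_on_cong by metis

lemma Cinf_subset: "Cinf S f \<Longrightarrow> T \<subseteq> S \<Longrightarrow> Cinf T f"
  unfolding Cinf_def using Ck_on_subset by metis

lemma Cinf_has_derivative:
  "Cinf S f \<Longrightarrow> open S \<Longrightarrow> x \<in> S \<Longrightarrow> (f has_derivative frechet_derivative f (at x)) (at x)"
  unfolding Cinf_def using Ck_on_SucD by metis

lemma Cinf_differentiable: "Cinf S f \<Longrightarrow> open S \<Longrightarrow> x \<in> S \<Longrightarrow> f differentiable (at x)"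
  using Cinf_has_derivative differentiableI by blast

lemma Cinf_continuous_on: "Cinf S f \<Longrightarrow> continuous_on S f"
  unfolding Cinf_def using Ck_on.simps(1) by metis

lemma Cinf_frechet: "Cinf S f \<Longrightarrow> Cinf S (\<lambda>x. frechet_derivative f (at x) v)"
  unfolding Cinf_def using Ck_on.simps(2) by metis

lemma Cinf_const: "Cinf S (\<lambda>x. c)"
  unfolding Cinf_def using Ck_on_const by blast

lemma Cinf_bounded_linear_compose:
  "bounded_linear L \<Longrightarrow> open S \<Longrightarrow> Cinf S f \<Longrightarrow> Cinf S (\<lambda>x. L (f x))"
  unfolding Cinf_def using Ck_on_bounded_linear_compose by blast

lemma Cinf_id: "open S \<Longrightarrow> Cinf S (\<lambda>x. x)"
proof -
  assume S: "open S"
  have "Ck_on k S (\<lambda>x. x)" for k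
  proof (cases k)
    case (Suc m)
    then show ?thesis
      using Ck_on_SucI[OF S, of "\<lambda>x. x" "\<lambda>x v. v"] Ck_on_const has_derivative_ident by blast
  qed auto
  then show ?thesis by (simp add: Cinf_def)
qed

lemma Cinf_linear: "bounded_linear L \<Longrightarrow> open S \<Longrightarrow> Cinf S L"
  using Cinf_bounded_linear_compose[OF _ _ Cinf_id] by blast

lemma Cinf_add: "open S \<Longrightarrow> Cinf S f \<Longrightarrow> Cinf S g \<Longrightarrow> Cinf S (\<lambda>x. f x + g x)"
  unfolding Cinf_def using Ck_on_add by blast

lemma Cinf_bilinear:
  "bounded_bilinear bop \<Longrightarrow> open S \<Longrightarrow> Cinf S f \<Longrightarrow> Cinf S g \<Longrightarrow> Cinf S (\<lambda>x. bop (f x) (g x))"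
  unfolding Cinf_def using Ck_on_bounded_bilinear by blast

lemmas Cinf_scaleR = Cinf_bilinear[OF bounded_bilinear_scaleR]
  and Cinf_mult = Cinf_bilinear[OF bounded_bilinear_mult]
  and Cinf_minus = Cinf_bounded_linear_compose[OF bounded_linear_minus[OF bounded_linear_ident]]
  and Cinf_vec_nth = Cinf_bounded_linear_compose[OF bounded_linear_vec_nth]

lemma Cinf_diff: "open S \<Longrightarrow> Cinf S f \<Longrightarrow> Cinf S g \<Longrightarrow> Cinf S (\<lambda>x. f x - g x)"
  using Cinf_add[of S f "\<lambda>x. - g x"] Cinf_minus by auto

lemma Cinf_sum:
  "open S \<Longrightarrow> (\<And>i. i \<in> I \<Longrightarrow> Cinf S (f i)) \<Longrightarrow> Cinf S (\<lambda>x. \<Sum>i\<in>I. f i x)"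
  by (induction I rule: infinite_finite_induct) (auto intro: Cinf_const Cinf_add)

lemma Cinf_power: "open S \<Longrightarrow> Cinf S f \<Longrightarrow> Cinf S (\<lambda>x. f x ^ n :: real)"
  by (induction n) (auto intro: Cinf_const Cinf_mult)

lemma Cinf_vecI:
  fixes f :: "'a::euclidean_space \<Rightarrow> ('b::euclidean_space)^'n::finite"
  assumes "open S" "\<And>i. Cinf S (\<lambda>x. f x $ i)"
  shows "Cinf S f"
proof -
  have lin: "bounded_linear (axis i :: 'b \<Rightarrow> 'b^'n)" for i
    by (rule linear_conv_bounded_linear[THEN iffD1], rule linearI) (auto simp: vec_eq_iff axis_def)
  have "f = (\<lambda>x. \<Sum>i\<in>UNIV. axis i (f x $ i))"
    by (auto simp: vec_eq_iff axis_def if_distrib sum.delta cong: if_cong)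
  moreover have "Cinf S (\<lambda>x. \<Sum>i\<in>UNIV. axis i (f x $ i))"
    by (intro Cinf_sum assms(1) Cinf_bounded_linear_compose[OF lin] assms)
  ultimately show ?thesis by simp
qed

text \<open>In the chain rule the direction fed to the derivative of \<open>f\<close> moves with the
  point, while \<open>Ck_on\<close> speaks of fixed directions. Expanding in \<open>Basis\<close>
  separates moving coefficients from fixed directions.\<close>

lemma Ck_on_compose:
  fixes f :: "'b::euclidean_space \<Rightarrow> 'c::real_normed_vector" and g :: "'a::euclidean_space \<Rightarrow> 'b"
  assumes "open S" "open T" "g ` S \<subseteq> T"
  shows "Ck_on k T f \<Longrightarrow> Ck_on k S g \<Longrightarrow> Ck_on k S (\<lambda>x. f (g x))"
proof (induction k arbitrary: f)
  case 0
  then show ?case using assms(3) continuous_on_compose2 by auto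
next
  case (Suc k)
  let ?f = "\<lambda>y. frechet_derivative f (at y)" and ?g = "\<lambda>x. frechet_derivative g (at x)"
  show ?case
  proof (rule Ck_on_SucI[OF \<open>open S\<close>])
    show "((\<lambda>x. f (g x)) has_derivative (\<lambda>v. \<Sum>b\<in>Basis. (?g x v \<bullet> b) *\<^sub>R ?f (g x) b)) (at x)"
      if "x \<in> S" for x
    proof -
      have f: "(f has_derivative ?f (g x)) (at (g x))"
        using Ck_on_SucD[OF Suc.prems(1) assms(2)] that assms(3) by blast
      have d: "((\<lambda>x. f (g x)) has_derivative (\<lambda>v. ?f (g x) (?g x v))) (at x)"
        using has_derivative_compose[OF Ck_on_SucD[OF Suc.prems(2) assms(1) that] f] .
      have eq: "?f (g x) w = (\<Sum>b\<in>Basis. (w \<bullet> b) *\<^sub>R ?f (g x) b)" for w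
      proof -
        interpret bounded_linear "?f (g x)" using has_derivative_bounded_linear[OF f] .
        have "?f (g x) (\<Sum>b\<in>Basis. (w \<bullet> b) *\<^sub>R b) = (\<Sum>b\<in>Basis. (w \<bullet> b) *\<^sub>R ?f (g x) b)"
          by (simp only: sum scaleR)
        then show ?thesis by (simp only: euclidean_representation)
      qed
      show ?thesis
        by (rule has_derivative_eq_rhs[OF d]) (rule ext, rule eq)
    qed
    have g: "Ck_on k S (\<lambda>x. ?g x v)" for v using Suc.prems(2) by simp
    have "Ck_on k T (\<lambda>x. ?f x b)" for b using Suc.prems(1) by simp
    then have f: "Ck_on k S (\<lambda>x. ?f (g x) b)" for b
      using Suc.IH Ck_on_SucD_le[OF assms(1) Suc.prems(2)] by blast
    show "Ck_on k S (\<lambda>x. \<Sum>b\<in>Basis. (?g x v \<bullet> b) *\<^sub>R ?f (g x) b)" for v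
    proof -
      have "Ck_on k S (\<lambda>x. \<Sum>b\<in>B. (?g x v \<bullet> b) *\<^sub>R ?f (g x) b)" for B :: "'b set"
      proof (induction B rule: infinite_finite_induct)
        case (insert b B)
        have "Ck_on k S (\<lambda>x. (?g x v \<bullet> b) *\<^sub>R ?f (g x) b)"
          by (rule Ck_on_bounded_bilinear[OF bounded_bilinear_scaleR assms(1) _ f])
            (rule Ck_on_bounded_linear_compose[OF bounded_linear_inner_left assms(1) g])
        then show ?case
          using Ck_on_add[OF assms(1) _ insert.IH] insert.hyps by simp
      qed (simp_all only: sum.infinite sum.empty Ck_on_const not_False_eq_True)
      then show ?thesis .
    qed
  qed
qed

lemma Cinf_compose:
  assumes "open S" "open T" "g ` S \<subseteq> T" "Cinf T f" "Cinf S g"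
  shows "Cinf S (\<lambda>x. f (g x))"
  using assms Ck_on_compose unfolding Cinf_def by blast

lemma smooth_on_open: "open S \<Longrightarrow> smooth_on S f \<longleftrightarrow> Cinf S f"
proof
  assume S: "open S" and f: "smooth_on S f"
  have "Ck_on k S f" for k
  proof (rule Ck_on_local)
    fix x assume "x \<in> S"
    then obtain U h where U: "open U" "x \<in> U" "\<forall>k. Ck_on k U h" "\<forall>y\<in>S \<inter> U. h y = f y"
      using f unfolding smooth_on_def by blast
    have "Ck_on k (S \<inter> U) f"
      by (rule Ck_on_cong[of _ h]) (use U S Ck_on_subset[of k U h "S \<inter> U"] in auto)
    then show "\<exists>U. open U \<and> x \<in> U \<and> Ck_on k U f"
      using S U(1,2) \<open>x \<in> S\<close> by blast
  qed
  then show "Cinf S f" by (simp add: Cinf_def)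
next
  assume "open S" "Cinf S f"
  then show "smooth_on S f" unfolding smooth_on_def Cinf_def by blast
qed

section \<open>Smoothness of matrix-valued maps\<close>

lemma bounded_bilinear_matrix_mult:
  "bounded_bilinear ((**) :: real^'n::finite^'m::finite \<Rightarrow> real^'p::finite^'n \<Rightarrow> _)"
  unfolding bilinear_conv_bounded_bilinear[symmetric] bilinear_def
  by (auto intro!: linearI simp: vec_eq_iff matrix_matrix_mult_def sum.distrib algebra_simps sum_distrib_left)

lemma bounded_linear_transpose: "bounded_linear (transpose :: real^'n::finite^'m::finite \<Rightarrow> _)"
  by (rule linear_conv_bounded_linear[THEN iffD1], rule linearI) (auto simp: vec_eq_iff transpose_def)

lemmas Cinf_matrix_mult = Cinf_bilinear[OF bounded_bilinear_matrix_mult]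
  and Cinf_transpose = Cinf_bounded_linear_compose[OF bounded_linear_transpose]

lemma Cinf_jacobian:
  fixes f :: "real^'n::finite \<Rightarrow> real^'m::finite"
  assumes "open S" "Cinf S f"
  shows "Cinf S (\<lambda>x. jacobian f (at x))"
  by (intro Cinf_vecI assms(1))
    (simp add: jacobian_def matrix_def Cinf_vec_nth[OF assms(1) Cinf_frechet[OF assms(2)]])

section \<open>Partial derivatives and vanishing order\<close>

lemma Cinf_pd: "Cinf S f \<Longrightarrow> Cinf S (pd k f)"
  unfolding pd_def[abs_def] by (rule Cinf_frechet)

lemma pd_eq: "(f has_derivative f') (at y) \<Longrightarrow> pd k f y = f' (axis k 1)"
  unfolding pd_def using frechet_derivative_at by metis

lemma pd_cong:
  "\<lbrakk>f differentiable (at y); open S; y \<in> S; \<And>x. x \<in> S \<Longrightarrow> f x = g x\<rbrakk> \<Longrightarrow> pd k f y = pd k g y"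
  unfolding pd_def by (metis frechet_derivative_transform_within_open)

lemma pd_const [simp]: "pd k (\<lambda>x. c) y = 0"
  by (simp add: pd_def)

lemma pd_linear:
  assumes "bounded_linear L" "f differentiable (at y)"
  shows "pd k (\<lambda>x. L (f x)) y = L (pd k f y)"
  using pd_eq[OF bounded_linear.has_derivative[OF assms(1)]] assms(2)
  by (metis frechet_derivative_works pd_def)

lemma pd_add:
  assumes "f differentiable (at y)" "g differentiable (at y)"
  shows "pd k (\<lambda>x. f x + g x) y = pd k f y + pd k g y"
  using pd_eq[OF has_derivative_add[OF assms[unfolded frechet_derivative_works]]]
  by (simp add: pd_def)

lemma pd_diff:
  assumes "f differentiable (at y)" "g differentiable (at y)"
  shows "pd k (\<lambda>x. f x - g x) y = pd k f y - pd k g y"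
  using pd_eq[OF has_derivative_diff[OF assms[unfolded frechet_derivative_works]]]
  by (simp add: pd_def)

lemma pd_bilinear:
  assumes "bounded_bilinear bop" "f differentiable (at y)" "g differentiable (at y)"
  shows "pd k (\<lambda>x. bop (f x) (g x)) y = bop (f y) (pd k g y) + bop (pd k f y) (g y)"
  using pd_eq[OF bounded_bilinear.FDERIV[OF assms(1) assms(2,3)[unfolded frechet_derivative_works]]]
  by (simp add: pd_def)

lemma has_derivative_sum_pd:
  assumes "f differentiable (at (y :: real^'n::finite))"
  shows "(f has_derivative (\<lambda>v. \<Sum>j\<in>UNIV. v $ j *\<^sub>R pd j f y)) (at y)"
proof -
  let ?D = "frechet_derivative f (at y)"
  have D: "(f has_derivative ?D) (at y)" using assms frechet_derivative_works by blast
  have eq: "?D v = (\<Sum>j\<in>UNIV. v $ j *\<^sub>R pd j f y)" for v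
  proof -
    have "?D v = ?D (\<Sum>j\<in>UNIV. v $ j *\<^sub>R axis j 1)"
      by (simp only: basis_expansion flip: scalar_mult_eq_scaleR)
    also have "\<dots> = (\<Sum>j\<in>UNIV. v $ j *\<^sub>R pd j f y)"
      unfolding pd_def linear_sum[OF has_derivative_linear[OF D]]
      by (intro sum.cong refl linear_scale[OF has_derivative_linear[OF D]])
    finally show ?thesis .
  qed
  show ?thesis by (rule has_derivative_eq_rhs[OF D]) (rule ext, rule eq)
qed

lemma pd_compose:
  fixes f :: "real^'n::finite \<Rightarrow> 'b::real_normed_vector"
  assumes "\<phi> differentiable (at y)" "f differentiable (at (\<phi> y))"
  shows "pd i (\<lambda>x. f (\<phi> x)) y = (\<Sum>j\<in>UNIV. pd i \<phi> y $ j *\<^sub>R pd j f (\<phi> y))"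
  using pd_eq[OF has_derivative_compose[OF assms(1)[unfolded frechet_derivative_works]
        has_derivative_sum_pd[OF assms(2)]]]
  by (simp add: pd_def)

text \<open>Orders start at \<open>0\<close>: \<open>van k y f\<close> concerns the derivatives of order strictly less than \<open>k\<close>.\<close>

fun van :: "nat \<Rightarrow> real^'n::finite \<Rightarrow> (real^'n \<Rightarrow> 'b::real_normed_vector) \<Rightarrow> bool" where
  "van 0 y f \<longleftrightarrow> True"
| "van (Suc k) y f \<longleftrightarrow> f y = 0 \<and> (\<forall>i. van k y (pd i f))"

lemma van_SucD: "van (Suc k) y f \<Longrightarrow> van k y f"
  by (induction k arbitrary: f) auto

lemma van_mono: "van l y f \<Longrightarrow> k \<le> l \<Longrightarrow> van k y f"
  by (induction l) (auto simp: le_Suc_eq dest: van_SucD simp del: van.simps(2))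

lemma van_cong:
  "\<lbrakk>open S; y \<in> S; Cinf S f; \<And>x. x \<in> S \<Longrightarrow> f x = g x; van k y f\<rbrakk> \<Longrightarrow> van k y g"
proof (induction k arbitrary: f g)
  case (Suc k)
  have "van k y (pd i g)" for i
  proof (rule Suc.IH[OF Suc.prems(1,2) Cinf_pd[OF Suc.prems(3)]])
    show "pd i f x = pd i g x" if "x \<in> S" for x
      by (rule pd_cong[OF Cinf_differentiable[OF Suc.prems(3,1) that] Suc.prems(1) that Suc.prems(4)])
    show "van k y (pd i f)" using Suc.prems(5) by simp
  qed
  then show ?case using Suc.prems by auto
qed auto

lemma van_add:
  "\<lbrakk>open S; y \<in> S; Cinf S f; Cinf S g; van k y f; van k y g\<rbrakk> \<Longrightarrow> van k y (\<lambda>x. f x + g x)"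
proof (induction k arbitrary: f g)
  case (Suc k)
  have "van k y (pd i (\<lambda>x. f x + g x))" for i
  proof (rule van_cong[OF Suc.prems(1,2), of "\<lambda>x. pd i f x + pd i g x"])
    show "van k y (\<lambda>x. pd i f x + pd i g x)"
      by (rule Suc.IH) (use Suc.prems Cinf_pd in auto)
    show "pd i f x + pd i g x = pd i (\<lambda>x. f x + g x) x" if "x \<in> S" for x
      using pd_add[OF Cinf_differentiable Cinf_differentiable] Suc.prems that by metis
  qed (use Suc.prems Cinf_pd Cinf_add in blast)
  then show ?case using Suc.prems by auto
qed auto

lemma van_linear:
  assumes "bounded_linear L"
  shows "\<lbrakk>open S; y \<in> S; Cinf S f; van k y f\<rbrakk> \<Longrightarrow> van k y (\<lambda>x. L (f x))"
proof (induction k arbitrary: f)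
  case (Suc k)
  have "van k y (pd i (\<lambda>x. L (f x)))" for i
  proof (rule van_cong[OF Suc.prems(1,2), of "\<lambda>x. L (pd i f x)"])
    show "van k y (\<lambda>x. L (pd i f x))"
      by (rule Suc.IH) (use Suc.prems Cinf_pd in auto)
    show "L (pd i f x) = pd i (\<lambda>x. L (f x)) x" if "x \<in> S" for x
      using pd_linear[OF assms Cinf_differentiable] Suc.prems that by metis
  qed (use Suc.prems Cinf_pd Cinf_bounded_linear_compose[OF assms] in blast)
  then show ?case using Suc.prems linear_0[OF bounded_linear.linear[OF assms]] by auto
qed auto

text \<open>Orders of vanishing add under products, since the product rule lowers one of them by one
  in each term. If the order to be lowered is already 0 it stays 0, and the other order is weakened
  by one instead.\<close>

lemma van_bilinear:
  assumes "bounded_bilinear bop"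
  shows "\<lbrakk>open S; y \<in> S; Cinf S f; Cinf S g; van a y f; van b y g\<rbrakk>
    \<Longrightarrow> van (a + b) y (\<lambda>x. bop (f x) (g x))"
proof (induction "a + b" arbitrary: a b f g)
  case (Suc n)
  interpret bounded_bilinear bop by (rule assms)
  have "van n y (pd i (\<lambda>x. bop (f x) (g x)))" for i
  proof (rule van_cong[OF Suc.prems(1,2), of "\<lambda>x. bop (f x) (pd i g x) + bop (pd i f x) (g x)"])
    have "van n y (\<lambda>x. bop (f x) (pd i g x))"
    proof (cases b)
      case 0
      then have "van (a - 1 + 0) y (\<lambda>x. bop (f x) (pd i g x))"
        using Suc by (intro Suc.hyps(1)) (auto intro: Cinf_pd van_mono)
      moreover have "a - 1 + 0 = n" using 0 Suc.hyps(2) by simp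
      ultimately show ?thesis by (simp only:)
    next
      case (Suc b')
      then have "van (a + b') y (\<lambda>x. bop (f x) (pd i g x))"
        using Suc.hyps(2) Suc.prems by (intro Suc.hyps(1)) (auto intro: Cinf_pd)
      then show ?thesis using Suc Suc.hyps(2) by simp
    qed
    moreover have "van n y (\<lambda>x. bop (pd i f x) (g x))"
    proof (cases a)
      case 0
      then have "van (0 + (b - 1)) y (\<lambda>x. bop (pd i f x) (g x))"
        using Suc by (intro Suc.hyps(1)) (auto intro: Cinf_pd van_mono)
      moreover have "0 + (b - 1) = n" using 0 Suc.hyps(2) by simp
      ultimately show ?thesis by (simp only:)
    next
      case (Suc a')
      then have "van (a' + b) y (\<lambda>x. bop (pd i f x) (g x))"
        using Suc.hyps(2) Suc.prems by (intro Suc.hyps(1)) (auto intro: Cinf_pd)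
      then show ?thesis using Suc Suc.hyps(2) by simp
    qed
    ultimately show "van n y (\<lambda>x. bop (f x) (pd i g x) + bop (pd i f x) (g x))"
      using Suc.prems by (intro van_add[of S]) (auto intro: Cinf_pd Cinf_bilinear[OF assms])
    show "bop (f x) (pd i g x) + bop (pd i f x) (g x) = pd i (\<lambda>x. bop (f x) (g x)) x"
      if "x \<in> S" for x
      using pd_bilinear[OF assms Cinf_differentiable Cinf_differentiable] Suc.prems that by metis
    show "Cinf S (\<lambda>x. bop (f x) (pd i g x) + bop (pd i f x) (g x))"
      using Suc.prems by (intro Cinf_add Cinf_bilinear[OF assms] Cinf_pd) auto
  qed
  moreover have "bop (f y) (g y) = 0"
    using Suc.hyps(2) Suc.prems(5,6) zero_left zero_right by (cases a; cases b) auto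
  ultimately show ?case using Suc.hyps(2)[symmetric] by simp
qed auto

lemma van_zero: "van k y (\<lambda>x. 0)"
proof (induction k)
  case (Suc k)
  have "pd i (\<lambda>x. 0 :: 'b) = (\<lambda>x. 0)" for i :: 'a by (simp add: fun_eq_iff)
  then show ?case using Suc by simp
qed simp

lemma van_sum:
  assumes "open S" "y \<in> S"
  shows "(\<And>i. i \<in> I \<Longrightarrow> Cinf S (f i) \<and> van k y (f i)) \<Longrightarrow> van k y (\<lambda>x. \<Sum>i\<in>I. f i x)"
proof (induction I rule: infinite_finite_induct)
  case (insert i I)
  then show ?case by (simp add: van_add[OF assms] Cinf_sum[OF assms(1)])
qed (simp_all add: van_zero)

lemma van_diff:
  "\<lbrakk>open S; y \<in> S; Cinf S f; Cinf S g; van k y f; van k y g\<rbrakk> \<Longrightarrow> van k y (\<lambda>x. f x - g x)"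
  using van_add[of S y f "\<lambda>x. - g x" k] Cinf_minus[of S g]
    van_linear[OF bounded_linear_minus[OF bounded_linear_ident], of S y g k] by simp

text \<open>By the chain rule a partial derivative of the composite is a combination of the
  functions \<open>pd j f\<close> composed with \<open>\<phi>\<close>, with smooth coefficients;
  coefficients of order 0 do no harm.\<close>

lemma van_compose:
  fixes f :: "real^'n::finite \<Rightarrow> 'b::real_normed_vector"
  assumes "open S" "y \<in> S" "open T" "\<phi> ` S \<subseteq> T" "Cinf S \<phi>"
  shows "\<lbrakk>Cinf T f; van k (\<phi> y) f\<rbrakk> \<Longrightarrow> van k y (\<lambda>x. f (\<phi> x))"
proof (induction k arbitrary: f)
  case (Suc k)
  have c: "Cinf S (\<lambda>x. pd i \<phi> x $ j)" "Cinf S (\<lambda>x. pd j f (\<phi> x))" for i j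
    using Cinf_vec_nth[OF assms(1) Cinf_pd[OF assms(5)]]
      Cinf_compose[OF assms(1,3,4) Cinf_pd[OF Suc.prems(1)] assms(5)] by auto
  have "van k y (pd i (\<lambda>x. f (\<phi> x)))" for i
  proof (rule van_cong[OF assms(1,2), of "\<lambda>x. \<Sum>j\<in>UNIV. pd i \<phi> x $ j *\<^sub>R pd j f (\<phi> x)"])
    show "van k y (\<lambda>x. \<Sum>j\<in>UNIV. pd i \<phi> x $ j *\<^sub>R pd j f (\<phi> x))"
    proof (intro van_sum[OF assms(1,2)] conjI)
      show "Cinf S (\<lambda>x. pd i \<phi> x $ j *\<^sub>R pd j f (\<phi> x))" for j
        using c by (intro Cinf_scaleR assms(1))
      have "van k y (\<lambda>x. pd j f (\<phi> x))" for j
        using Suc.prems Cinf_pd by (intro Suc.IH) auto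
      then show "van k y (\<lambda>x. pd i \<phi> x $ j *\<^sub>R pd j f (\<phi> x))" for j
        using van_bilinear[OF bounded_bilinear_scaleR assms(1,2) c, of 0] by simp
    qed
    show "Cinf S (\<lambda>x. \<Sum>j\<in>UNIV. pd i \<phi> x $ j *\<^sub>R pd j f (\<phi> x))"
      using c by (intro Cinf_scaleR Cinf_sum assms(1))
    show "(\<Sum>j\<in>UNIV. pd i \<phi> x $ j *\<^sub>R pd j f (\<phi> x)) = pd i (\<lambda>x. f (\<phi> x)) x" if "x \<in> S" for x
      using that assms Suc.prems(1)
      by (intro pd_compose[symmetric] Cinf_differentiable[of S] Cinf_differentiable[of T]) auto
  qed
  then show ?case using Suc.prems by auto
qed auto

text \<open>The derivative of the difference splits into a sum with factors
  \<open>pd i (\<lambda>x. \<phi> x - x)\<close>, whose order is known, and the same kind of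
  difference for \<open>pd i f\<close>, which the induction covers. A map with trivial jet therefore
  does not change the jet of a function composed with it.\<close>

lemma van_compose_near_id:
  fixes f :: "real^'n::finite \<Rightarrow> 'b::real_normed_vector" and \<phi> :: "real^'n \<Rightarrow> real^'n"
  assumes "open S" "y \<in> S" "open T" "\<phi> ` S \<subseteq> T" "S \<subseteq> T" "Cinf S \<phi>"
  shows "\<lbrakk>Cinf T f; van k y (\<lambda>x. \<phi> x - x)\<rbrakk> \<Longrightarrow> van k y (\<lambda>x. f (\<phi> x) - f x)"
proof (induction k arbitrary: f)
  case (Suc k)
  have id: "Cinf S (\<lambda>x. x)" "Cinf S (\<lambda>x. \<phi> x - x)"
    using assms Cinf_id Cinf_diff by blast+
  have f: "Cinf S f" "Cinf S (\<lambda>x. f (\<phi> x))"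
    using Suc.prems(1) Cinf_subset assms(5) Cinf_compose[OF assms(1,3,4) _ assms(6)] by auto
  have c: "Cinf S (\<lambda>x. pd i (\<lambda>x. \<phi> x - x) x $ j)" "Cinf S (\<lambda>x. pd j f (\<phi> x))" "Cinf S (pd j f)" for i j
    using Cinf_vec_nth[OF assms(1) Cinf_pd[OF id(2)]]
      Cinf_compose[OF assms(1,3,4) Cinf_pd[OF Suc.prems(1)] assms(6)] Cinf_pd[OF f(1)] by auto
  have "van k y (pd i (\<lambda>x. f (\<phi> x) - f x))" for i
  proof (rule van_cong[OF assms(1,2), of "\<lambda>x. (\<Sum>j\<in>UNIV. pd i (\<lambda>x. \<phi> x - x) x $ j *\<^sub>R pd j f (\<phi> x))
      + (pd i f (\<phi> x) - pd i f x)"])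
    have "van k y (\<lambda>x. \<Sum>j\<in>UNIV. pd i (\<lambda>x. \<phi> x - x) x $ j *\<^sub>R pd j f (\<phi> x))"
    proof (intro van_sum[OF assms(1,2)] conjI)
      show "Cinf S (\<lambda>x. pd i (\<lambda>x. \<phi> x - x) x $ j *\<^sub>R pd j f (\<phi> x))" for j
        using c by (intro Cinf_scaleR assms(1))
      have "van k y (\<lambda>x. pd i (\<lambda>x. \<phi> x - x) x $ j)" for j
        using Suc.prems(2) van_linear[OF bounded_linear_vec_nth assms(1,2) Cinf_pd[OF id(2)]] by simp
      then show "van k y (\<lambda>x. pd i (\<lambda>x. \<phi> x - x) x $ j *\<^sub>R pd j f (\<phi> x))" for j
        using van_bilinear[OF bounded_bilinear_scaleR assms(1,2) c(1,2), of k _ _ 0] by simp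
    qed
    moreover have "van k y (\<lambda>x. pd i f (\<phi> x) - pd i f x)"
      using Cinf_pd[OF Suc.prems(1)] van_SucD[OF Suc.prems(2)] by (rule Suc.IH)
    ultimately show "van k y (\<lambda>x. (\<Sum>j\<in>UNIV. pd i (\<lambda>x. \<phi> x - x) x $ j *\<^sub>R pd j f (\<phi> x))
      + (pd i f (\<phi> x) - pd i f x))"
      using c by (intro van_add[OF assms(1,2)] Cinf_sum Cinf_diff Cinf_scaleR assms(1))
    show "Cinf S (\<lambda>x. (\<Sum>j\<in>UNIV. pd i (\<lambda>x. \<phi> x - x) x $ j *\<^sub>R pd j f (\<phi> x))
      + (pd i f (\<phi> x) - pd i f x))"
      using c by (intro Cinf_add Cinf_sum Cinf_diff Cinf_scaleR assms(1))
    show "(\<Sum>j\<in>UNIV. pd i (\<lambda>x. \<phi> x - x) x $ j *\<^sub>R pd j f (\<phi> x)) + (pd i f (\<phi> x) - pd i f x)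
        = pd i (\<lambda>x. f (\<phi> x) - f x) x" if x: "x \<in> S" for x
    proof -
      have d: "pd i (\<lambda>x. \<phi> x - x) x = pd i \<phi> x - axis i 1"
        by (subst pd_diff[OF Cinf_differentiable[OF assms(6,1) x] differentiable_ident])
          (simp add: pd_eq[OF has_derivative_ident])
      have "pd i (\<lambda>x. f (\<phi> x) - f x) x = pd i (\<lambda>x. f (\<phi> x)) x - pd i f x"
        using pd_diff[OF f(2,1)[THEN Cinf_differentiable, OF assms(1) x]] .
      also have "pd i (\<lambda>x. f (\<phi> x)) x = (\<Sum>j\<in>UNIV. pd i \<phi> x $ j *\<^sub>R pd j f (\<phi> x))"
        using x assms Suc.prems(1)
        by (intro pd_compose Cinf_differentiable[of S] Cinf_differentiable[of T]) auto
      also have "\<dots> = (\<Sum>j\<in>UNIV. pd i (\<lambda>x. \<phi> x - x) x $ j *\<^sub>R pd j f (\<phi> x)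
             + (if j = i then pd j f (\<phi> x) else 0))"
        unfolding d by (intro sum.cong) (auto simp: axis_def algebra_simps)
      also have "\<dots> = (\<Sum>j\<in>UNIV. pd i (\<lambda>x. \<phi> x - x) x $ j *\<^sub>R pd j f (\<phi> x)) + pd i f (\<phi> x)"
        by (simp add: sum.distrib)
      finally show ?thesis by simp
    qed
  qed
  moreover have "\<phi> y = y" using Suc.prems(2) by simp
  ultimately show ?case by simp
qed auto

lemma pds_append: "pds (ks @ [i]) f = pds ks (pd i f)"
  by (induction ks) auto

text \<open>\<open>van\<close> peels off the innermost derivative and \<open>pds\<close> the
  outermost one, hence the detour through \<open>pds_append\<close>.\<close>

lemma van_iff_pds: "van (Suc k) y f \<longleftrightarrow> (\<forall>ks. length ks \<le> k \<longrightarrow> pds ks f y = 0)"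
proof (induction k arbitrary: f)
  case 0
  show ?case by simp
next
  case (Suc k)
  show ?case (is "_ \<longleftrightarrow> ?R")
  proof
    assume "van (Suc (Suc k)) y f"
    then have f: "f y = 0" "\<And>i ks. length ks \<le> k \<Longrightarrow> pds ks (pd i f) y = 0"
      using Suc.IH by (auto simp del: van.simps simp: van.simps(2)[of "Suc k"])
    then show ?R
      by (metis Suc_le_mono length_append_singleton pds.simps(1) pds_append rev_exhaust)
  next
    assume R: ?R
    have "length ks \<le> k \<Longrightarrow> pds ks (pd i f) y = 0" for ks i
      using R[rule_format, of "ks @ [i]"] by (simp add: pds_append)
    moreover have "f y = 0" using R[rule_format, of "[]"] by simp
    ultimately show "van (Suc (Suc k)) y f"
      using Suc.IH by (simp del: van.simps add: van.simps(2)[of "Suc k"])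
  qed
qed

lemma Cinf_pds: "Cinf S f \<Longrightarrow> Cinf S (pds ks f)"
  by (induction ks) (auto intro: Cinf_pd)

lemma pds_cong:
  "\<lbrakk>open S; y \<in> S; Cinf S f; \<And>x. x \<in> S \<Longrightarrow> f x = g x\<rbrakk> \<Longrightarrow> pds ks f y = pds ks g y"
proof (induction ks arbitrary: y)
  case (Cons k ks)
  then show ?case
    using pd_cong[OF Cinf_differentiable[OF Cinf_pds[OF Cons.prems(3), of ks] Cons.prems(1,2)] Cons.prems(1,2)]
    by simp
qed auto

lemma pds_diff:
  "\<lbrakk>open S; y \<in> S; Cinf S f; Cinf S g\<rbrakk> \<Longrightarrow> pds ks (\<lambda>x. f x - g x) y = pds ks f y - pds ks g y"
proof (induction ks arbitrary: y)
  case (Cons k ks)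
  have "pds (k # ks) (\<lambda>x. f x - g x) y = pd k (\<lambda>x. pds ks f x - pds ks g x) y"
    using pd_cong[OF Cinf_differentiable[OF Cinf_pds[OF Cinf_diff[OF Cons.prems(1,3,4)]] Cons.prems(1,2)]
        Cons.prems(1,2), of ks "\<lambda>x. pds ks f x - pds ks g x"] Cons by simp
  also have "\<dots> = pds (k # ks) f y - pds (k # ks) g y"
    by (simp add: pd_diff[OF Cinf_differentiable[OF Cinf_pds[OF Cons.prems(3)] Cons.prems(1,2)]
        Cinf_differentiable[OF Cinf_pds[OF Cons.prems(4)] Cons.prems(1,2)]])
  finally show ?case .
qed auto

lemma van_diff_iff_pds:
  assumes "open S" "y \<in> S" "Cinf S f" "Cinf S g"
  shows "van (Suc k) y (\<lambda>x. f x - g x) \<longleftrightarrow> (\<forall>ks. length ks \<le> k \<longrightarrow> pds ks f y = pds ks g y)"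
  by (simp add: van_iff_pds pds_diff[OF assms] del: van.simps)

section \<open>Symmetry of mixed partial derivatives\<close>

lemma has_derivative_along_axis:
  fixes g :: "real^'n::finite \<Rightarrow> real"
  assumes "Cinf S g" "open S" "z + s *\<^sub>R axis i 1 \<in> S"
  shows "((\<lambda>s. g (z + s *\<^sub>R axis i 1)) has_real_derivative pd i g (z + s *\<^sub>R axis i 1)) (at s)"
proof -
  note g = Cinf_has_derivative[OF assms]
  have "((\<lambda>s. z + s *\<^sub>R axis i 1) has_derivative (\<lambda>s. s *\<^sub>R axis i 1)) (at s)"
    by (auto intro!: derivative_eq_intros)
  from has_derivative_compose[OF this g] show ?thesis
    unfolding has_field_derivative_def pd_def
    by (rule has_derivative_eq_rhs) (simp add: fun_eq_iff linear_scale[OF has_derivative_linear[OF g]])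
qed

text \<open>Two applications of the mean value theorem: to \<open>f (?p s h) - f (?p s 0)\<close> as
  a function of \<open>s\<close>, then to \<open>pd i f\<close> as a function of
  \<open>t\<close>.\<close>

lemma second_difference_eq_pd_pd:
  fixes f :: "real^'n::finite \<Rightarrow> real"
  assumes "open S" "Cinf S f" "0 < h"
    and S: "\<And>s t. \<lbrakk>0 \<le> s; s \<le> h; 0 \<le> t; t \<le> h\<rbrakk> \<Longrightarrow> y + s *\<^sub>R axis i 1 + t *\<^sub>R axis j 1 \<in> S"
  obtains s t where "0 < s" "s < h" "0 < t" "t < h"
    "f (y + h *\<^sub>R axis i 1 + h *\<^sub>R axis j 1) - f (y + h *\<^sub>R axis i 1) - f (y + h *\<^sub>R axis j 1) + f y
      = h * h * pd j (pd i f) (y + s *\<^sub>R axis i 1 + t *\<^sub>R axis j 1)"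
proof -
  let ?p = "\<lambda>s t. y + s *\<^sub>R axis i 1 + t *\<^sub>R axis j 1"
  have di: "((\<lambda>s. f (?p s t)) has_real_derivative pd i f (?p s t)) (at s)"
    if "0 \<le> s" "s \<le> h" "0 \<le> t" "t \<le> h" for s t
    using has_derivative_along_axis[OF assms(2,1), of "y + t *\<^sub>R axis j 1" s i] S[OF that] by (simp add: ac_simps)
  have dj: "((\<lambda>t. pd i f (?p s t)) has_real_derivative pd j (pd i f) (?p s t)) (at t)"
    if "0 \<le> s" "s \<le> h" "0 \<le> t" "t \<le> h" for s t
    by (rule has_derivative_along_axis[OF Cinf_pd[OF assms(2)] assms(1) S[OF that]])
  have "\<exists>s>0. s < h \<and> (f (?p h h) - f (?p h 0)) - (f (?p 0 h) - f (?p 0 0))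
      = (h - 0) * (pd i f (?p s h) - pd i f (?p s 0))"
    by (rule MVT2[OF assms(3)]) (intro DERIV_diff di, use assms(3) in auto)
  then obtain s where s: "0 < s" "s < h"
    "(f (?p h h) - f (?p h 0)) - (f (?p 0 h) - f (?p 0 0)) = (h - 0) * (pd i f (?p s h) - pd i f (?p s 0))"
    by blast
  have "\<exists>t>0. t < h \<and> pd i f (?p s h) - pd i f (?p s 0) = (h - 0) * pd j (pd i f) (?p s t)"
    by (rule MVT2[OF assms(3)]) (intro dj, use assms(3) s(1,2) in auto)
  then show ?thesis
    using that[OF s(1,2)] s(3) by (auto simp: algebra_simps)
qed

text \<open>One second difference, computed in both orders, makes the two mixed derivatives agree at
  two points close to \<open>y\<close>; continuity then excludes a gap at \<open>y\<close>
  itself.\<close>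

lemma pd_commute_real:
  fixes f :: "real^'n::finite \<Rightarrow> real"
  assumes "open S" "Cinf S f" "y \<in> S"
  shows "pd i (pd j f) y = pd j (pd i f) y"
proof (rule ccontr)
  let ?p = "\<lambda>s t. y + s *\<^sub>R axis i 1 + t *\<^sub>R axis j 1"
  let ?e = "dist (pd i (pd j f) y) (pd j (pd i f) y) / 2"
  assume "\<not> ?thesis"
  then have e: "?e > 0" by simp
  have c: "isCont (pd i (pd j f)) y" "isCont (pd j (pd i f)) y"
    using Cinf_continuous_on[OF Cinf_pd[OF Cinf_pd[OF assms(2)]]] assms(3)
    unfolding continuous_on_eq_continuous_at[OF assms(1)] by blast+
  obtain d1 where d1: "d1 > 0" "\<And>z. dist z y < d1 \<Longrightarrow> dist (pd i (pd j f) z) (pd i (pd j f) y) < ?e"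
    using c(1) e unfolding continuous_at_eps_delta by metis
  obtain d2 where d2: "d2 > 0" "\<And>z. dist z y < d2 \<Longrightarrow> dist (pd j (pd i f) z) (pd j (pd i f) y) < ?e"
    using c(2) e unfolding continuous_at_eps_delta by metis
  obtain d3 where d3: "d3 > 0" "ball y d3 \<subseteq> S"
    using assms(1,3) openE by blast
  \<comment> \<open>Points of the square with side \<open>h\<close> have distance at most
    \<open>2 * h\<close> from \<open>y\<close>, so a third of the smallest radius keeps them inside
    all three balls.\<close>
  define h where "h = min d1 (min d2 d3) / 3"
  have h: "h > 0" "2 * h < d1" "2 * h < d2" "2 * h < d3"
    using d1(1) d2(1) d3(1) by (auto simp: h_def)
  have n: "dist (?p s t) y \<le> 2 * h" "dist (y + t *\<^sub>R axis j 1 + s *\<^sub>R axis i 1) y \<le> 2 * h"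
    if "0 \<le> s" "s \<le> h" "0 \<le> t" "t \<le> h" for s t
  proof -
    have "norm (s *\<^sub>R axis i 1 + t *\<^sub>R axis j 1 :: real^'n) \<le> \<bar>s\<bar> * 1 + \<bar>t\<bar> * 1"
      by (rule norm_triangle_le) (simp add: norm_axis_1)
    then show "dist (?p s t) y \<le> 2 * h" "dist (y + t *\<^sub>R axis j 1 + s *\<^sub>R axis i 1) y \<le> 2 * h"
      using that by (auto simp: dist_norm algebra_simps)
  qed
  have S: "?p s t \<in> S" "y + t *\<^sub>R axis j 1 + s *\<^sub>R axis i 1 \<in> S"
    if "0 \<le> s" "s \<le> h" "0 \<le> t" "t \<le> h" for s t
    using n[OF that] h(4) d3(2) by (auto simp: subset_iff dist_commute)
  obtain s t where st: "0 < s" "s < h" "0 < t" "t < h"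
    "f (?p h h) - f (y + h *\<^sub>R axis i 1) - f (y + h *\<^sub>R axis j 1) + f y = h * h * pd j (pd i f) (?p s t)"
    by (rule second_difference_eq_pd_pd[OF assms(1,2) h(1), of y i j]) (use S(1) in blast)+
  obtain s' t' where st': "0 < s'" "s' < h" "0 < t'" "t' < h"
    "f (y + h *\<^sub>R axis j 1 + h *\<^sub>R axis i 1) - f (y + h *\<^sub>R axis j 1) - f (y + h *\<^sub>R axis i 1) + f y
      = h * h * pd i (pd j f) (y + s' *\<^sub>R axis j 1 + t' *\<^sub>R axis i 1)"
    by (rule second_difference_eq_pd_pd[OF assms(1,2) h(1), of y j i]) (use S(2) in blast)+
  have eq: "pd j (pd i f) (?p s t) = pd i (pd j f) (y + s' *\<^sub>R axis j 1 + t' *\<^sub>R axis i 1)"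
    using st(5) st'(5) h(1) by (simp add: algebra_simps)
  have "dist (?p s t) y < d2" and "dist (y + s' *\<^sub>R axis j 1 + t' *\<^sub>R axis i 1) y < d1"
    using n(1)[of s t] n(2)[of t' s'] st st' h by auto
  note d2(2)[OF this(1)] d1(2)[OF this(2)]
  then have "dist (pd j (pd i f) (?p s t)) (pd j (pd i f) y) < ?e"
    "dist (pd j (pd i f) (?p s t)) (pd i (pd j f) y) < ?e"
    unfolding eq by simp_all
  then show False
    using dist_triangle2[of "pd i (pd j f) y" "pd j (pd i f) y" "pd j (pd i f) (?p s t)"]
    by (simp add: dist_commute)
qed

section \<open>Covectors annihilated by many vectors\<close>

text \<open>The determinant is a polynomial in \<open>t\<close>. It is not the zero polynomial: if
  \<open>t\<close> exceeds a norm bound of \<open>U\<close>, the matrix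
  \<open>U + t *\<^sub>R mat 1\<close> has trivial kernel.\<close>

lemma finite_det_add_scaled_id_zero:
  fixes U :: "real^'n::finite^'n"
  shows "finite {t. det (U + t *\<^sub>R mat 1) = 0}"
proof -
  define p where "p = det (\<chi> i j. [:U$i$j, if i = j then 1 else 0:])"
  have p: "poly p t = det (U + t *\<^sub>R mat 1)" for t
  proof -
    have *: "poly (of_int (sign q)) t = of_int (sign q)" for q :: "'n \<Rightarrow> 'n"
      by (simp add: sign_def)
    show ?thesis
      unfolding p_def det_def poly_sum poly_mult poly_prod *
      by (intro sum.cong prod.cong arg_cong2[of _ _ _ _ "(*)"] refl) (auto simp: mat_def)
  qed
  have "p \<noteq> 0"
  proof
    assume "p = 0"
    obtain B where B: "B > 0" "\<And>v. norm (U *v v) \<le> B * norm v"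
      using linear_bounded_pos[OF matrix_vector_mul_linear[of U]] by metis
    have "det (U + (B + 1) *\<^sub>R mat 1) = 0" using p[of "B + 1"] \<open>p = 0\<close> by simp
    then have "\<not> (\<exists>M. M ** (U + (B + 1) *\<^sub>R mat 1) = mat 1)"
      using invertible_det_nz invertible_left_inverse by metis
    then obtain v where v: "(U + (B + 1) *\<^sub>R mat 1) *v v = 0" "v \<noteq> 0"
      using matrix_left_invertible_ker by metis
    have "U *v v + (B + 1) *\<^sub>R v = 0"
      using v(1) by (simp add: matrix_vector_mult_add_rdistrib flip: scaleR_matrix_vector_assoc)
    then have "U *v v = - ((B + 1) *\<^sub>R v)" by (simp add: eq_neg_iff_add_eq_0)
    then have "(B + 1) * norm v \<le> B * norm v" using B(1) B(2)[of v] by simp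
    then show False using v(2) by (simp add: algebra_simps)
  qed
  then show ?thesis using poly_roots_finite[of p] p by simp
qed

text \<open>\<open>\<omega>\<close> may depend on the family in any nonlinear way, and continuity is
  asked only along lines. This generality serves both the contractions of a tensor and the finite
  differences along a fibre.\<close>

lemma annihilated_by_many_vectors:
  fixes \<omega> :: "(nat \<Rightarrow> real^'n::finite) \<Rightarrow> real^'n"
  assumes "CARD('n) \<le> N"
    and ann: "\<And>us i. i < N \<Longrightarrow> us i \<bullet> \<omega> us = 0"
    and cont: "\<And>us w. isCont (\<lambda>t. \<omega> (\<lambda>i. us i + t *\<^sub>R w i)) 0"
  shows "\<omega> us = 0"
proof -
  obtain e :: "'n \<Rightarrow> nat" where e: "bij_betw e UNIV {0..<CARD('n)}"
    using ex_bij_betw_finite_nat[of "UNIV :: 'n set"] by auto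
  then have inj: "inj e" and lt: "e a < N" for a
    using assms(1) by (auto simp: bij_betw_def) (metis atLeastLessThan_iff order_less_le_trans rangeI)
  define U where "U = (\<chi> a. us (e a))"
  \<comment> \<open>The perturbation moves \<open>CARD('n)\<close> of the vectors towards the
    standard basis and leaves the others alone; the moved ones are the rows of
    \<open>U + t *\<^sub>R mat 1\<close>, which is invertible for all but finitely many
    \<open>t\<close>.\<close>
  define w :: "nat \<Rightarrow> real^'n" where "w i = (if i \<in> range e then axis (inv e i) 1 else 0)" for i
  have zero: "\<omega> (\<lambda>i. us i + t *\<^sub>R w i) = 0" if t: "det (U + t *\<^sub>R mat 1) \<noteq> 0" for t
  proof -
    let ?us = "\<lambda>i. us i + t *\<^sub>R w i"
    have row: "(U + t *\<^sub>R mat 1) $ a = ?us (e a)" for a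
      by (simp add: U_def w_def inv_f_f[OF inj] vec_eq_iff mat_def axis_def)
    have "(U + t *\<^sub>R mat 1) *v \<omega> ?us = 0"
      using ann[OF lt, of ?us]
      by (simp add: vec_eq_iff matrix_vector_mul_component row del: vector_add_component vector_scaleR_component)
    then show ?thesis
      using t invertible_det_nz invertible_left_inverse matrix_left_invertible_ker by metis
  qed
  have "\<forall>\<^sub>F t in at 0. \<omega> (\<lambda>i. us i + t *\<^sub>R w i) = 0"
  proof -
    have "\<forall>\<^sub>F t in at 0. t \<notin> {t. det (U + t *\<^sub>R mat 1) = 0}"
      using islimpt_finite[OF finite_det_add_scaled_id_zero[of U], of 0]
      unfolding islimpt_iff_eventually by simp
    then show ?thesis by eventually_elim (use zero in simp)
  qed
  then have "((\<lambda>t. \<omega> (\<lambda>i. us i + t *\<^sub>R w i)) \<longlongrightarrow> 0) (at 0)"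
    by (simp add: tendsto_eventually)
  then show ?thesis
    using cont[of us w] tendsto_unique[OF at_neq_bot] unfolding isCont_def by fastforce
qed


section \<open>Polynomials and finite differences\<close>

lemma finite_exponents: "finite {\<alpha> :: 'i::finite \<Rightarrow> nat. sum \<alpha> UNIV < m}"
proof (rule finite_subset)
  show "{\<alpha> :: 'i \<Rightarrow> nat. sum \<alpha> UNIV < m} \<subseteq> PiE UNIV (\<lambda>_. {..<m})"
  proof
    fix \<alpha> :: "'i \<Rightarrow> nat" assume "\<alpha> \<in> {\<alpha>. sum \<alpha> UNIV < m}"
    moreover have "\<alpha> i \<le> sum \<alpha> UNIV" for i by (rule member_le_sum) auto
    ultimately show "\<alpha> \<in> PiE UNIV (\<lambda>_. {..<m})" by (auto intro: order_le_less_trans)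
  qed
qed (auto intro: finite_PiE)

lemma poly_deg_less_monomial:
  assumes "sum \<beta> UNIV < m"
  shows "poly_deg_less m (\<lambda>v :: 'i::finite \<Rightarrow> real. c * (\<Prod>i\<in>UNIV. v i ^ \<beta> i))"
proof -
  have "(\<Sum>\<alpha> | sum \<alpha> UNIV < m. (if \<alpha> = \<beta> then c else 0) * (\<Prod>i\<in>UNIV. v i ^ \<alpha> i))
    = (\<Sum>\<alpha> | sum \<alpha> UNIV < m. if \<alpha> = \<beta> then c * (\<Prod>i\<in>UNIV. v i ^ \<beta> i) else 0)" for v :: "'i \<Rightarrow> real"
    by (intro sum.cong) auto
  then show ?thesis
    unfolding poly_deg_less_def using assms
    by (intro exI[of _ "\<lambda>\<alpha>. if \<alpha> = \<beta> then c else 0"]) (simp add: finite_exponents)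
qed

lemma poly_deg_less_zero: "poly_deg_less m (\<lambda>v. 0)"
  unfolding poly_deg_less_def by (intro exI[of _ "\<lambda>_. 0"]) simp

lemma poly_deg_less_add:
  assumes "poly_deg_less m P" "poly_deg_less m Q"
  shows "poly_deg_less m (\<lambda>v. P v + Q v)"
proof -
  obtain a b where "P = (\<lambda>v. \<Sum>\<alpha> | sum \<alpha> UNIV < m. a \<alpha> * (\<Prod>i\<in>UNIV. v i ^ \<alpha> i))"
    "Q = (\<lambda>v. \<Sum>\<alpha> | sum \<alpha> UNIV < m. b \<alpha> * (\<Prod>i\<in>UNIV. v i ^ \<alpha> i))"
    using assms unfolding poly_deg_less_def by blast
  then show ?thesis
    unfolding poly_deg_less_def
    by (intro exI[of _ "\<lambda>\<alpha>. a \<alpha> + b \<alpha>"]) (simp add: sum.distrib algebra_simps)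
qed

lemma poly_deg_less_sum:
  "(\<And>i. i \<in> I \<Longrightarrow> poly_deg_less m (P i)) \<Longrightarrow> poly_deg_less m (\<lambda>v. \<Sum>i\<in>I. P i v)"
  by (induction I rule: infinite_finite_induct) (auto simp: poly_deg_less_zero intro: poly_deg_less_add)

section \<open>Iterated finite differences\<close>

fun difs :: "'a::ab_group_add list \<Rightarrow> ('a \<Rightarrow> 'b::ab_group_add) \<Rightarrow> 'a \<Rightarrow> 'b" where
  "difs [] f x = f x"
| "difs (\<theta> # \<theta>s) f x = difs \<theta>s f (x + \<theta>) - difs \<theta>s f x"

lemma difs_Nil: "difs [] f = f"
  by (simp add: fun_eq_iff)

lemma Cinf_translate: "Cinf UNIV f \<Longrightarrow> Cinf UNIV (\<lambda>x. f (x + c))"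
  by (rule Cinf_compose[of UNIV UNIV "\<lambda>x. x + c"])
    (simp_all add: Cinf_add Cinf_id Cinf_const)

lemma Cinf_difs: "Cinf UNIV f \<Longrightarrow> Cinf UNIV (difs \<theta>s f)"
proof (induction \<theta>s)
  case Nil
  then show ?case by simp
next
  case (Cons \<theta> \<theta>s)
  then have "Cinf UNIV (\<lambda>x. difs \<theta>s f (x + \<theta>) - difs \<theta>s f x)"
    by (intro Cinf_diff Cinf_translate) auto
  then show ?case by simp
qed

lemma difs_pd: "Cinf UNIV f \<Longrightarrow> difs \<theta>s (pd i f) x = pd i (difs \<theta>s f) x"
proof (induction \<theta>s arbitrary: x)
  case (Cons \<theta> \<theta>s)
  let ?f = "difs \<theta>s f"
  have d: "?f differentiable (at y)" "(\<lambda>x. ?f (x + \<theta>)) differentiable (at y)" for y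
    using Cinf_differentiable[OF Cinf_difs[OF Cons.prems] open_UNIV UNIV_I]
      Cinf_differentiable[OF Cinf_translate[OF Cinf_difs[OF Cons.prems]] open_UNIV UNIV_I] by blast+
  have "((\<lambda>x. ?f (x + \<theta>)) has_derivative (\<lambda>v. frechet_derivative ?f (at (x + \<theta>)) v)) (at x)"
    by (rule has_derivative_compose[OF _ d(1)[unfolded frechet_derivative_works]])
      (auto intro!: derivative_eq_intros)
  then have "pd i (\<lambda>x. ?f (x + \<theta>)) x = pd i ?f (x + \<theta>)"
    unfolding pd_def[of i ?f] by (rule pd_eq)
  then have "pd i (\<lambda>x. ?f (x + \<theta>) - ?f x) x = pd i ?f (x + \<theta>) - pd i ?f x"
    using pd_diff[OF d(2,1)] by simp
  then show ?case using Cons by simp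
qed (simp add: difs_Nil)

lemma has_derivative_along_ray:
  assumes "Cinf UNIV (g :: real^'i::finite \<Rightarrow> real)"
  shows "((\<lambda>t. g (t *\<^sub>R v)) has_real_derivative (\<Sum>i\<in>UNIV. v $ i * pd i g (t *\<^sub>R v))) (at t)"
proof -
  have "((\<lambda>t. t *\<^sub>R v) has_derivative (\<lambda>t. t *\<^sub>R v)) (at t)"
    by (auto intro!: derivative_eq_intros)
  from has_derivative_compose[OF this has_derivative_sum_pd[OF Cinf_differentiable[OF assms]]]
  show ?thesis
    unfolding has_field_derivative_def
    by (rule has_derivative_eq_rhs) (auto simp: sum_distrib_left fun_eq_iff algebra_simps)
qed

text \<open>By induction every partial derivative of \<open>g\<close> is a polynomial of degree less
  by one; integration along rays from the origin then recovers \<open>g\<close>.\<close>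

lemma poly_deg_less_if_difs_zero:
  "\<lbrakk>Cinf UNIV (g :: real^'i::finite \<Rightarrow> real); \<And>\<theta>s x. length \<theta>s = m \<Longrightarrow> difs \<theta>s g x = 0\<rbrakk>
    \<Longrightarrow> poly_deg_less m (\<lambda>w. g (\<chi> i. w i))"
proof (induction m arbitrary: g)
  case 0
  have "g x = 0" for x using 0(2)[of "[]"] by simp
  then show ?case by (simp add: poly_deg_less_zero)
next
  case (Suc m)
  let ?A = "{\<alpha> :: 'i \<Rightarrow> nat. sum \<alpha> UNIV < m}"
  have "poly_deg_less m (\<lambda>w. pd i g (\<chi> i. w i))" for i
  proof (rule Suc.IH[OF Cinf_pd[OF Suc.prems(1)]])
    fix \<theta>s :: "(real^'i) list" and x
    assume l: "length \<theta>s = m"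
    \<comment> \<open>The first of the \<open>Suc m\<close> increments is arbitrary, so the
      \<open>m\<close>-fold difference is constant and its partial derivatives vanish.\<close>
    have "difs \<theta>s g (0 + h) = difs \<theta>s g 0" for h
      using Suc.prems(2)[of "h # \<theta>s" 0] l by simp
    then have "difs \<theta>s g = (\<lambda>_. difs \<theta>s g 0)" by (simp add: fun_eq_iff)
    then show "difs \<theta>s (pd i g) x = 0"
      unfolding difs_pd[OF Suc.prems(1)] by (metis pd_const)
  qed
  then have "\<forall>i. \<exists>c. \<forall>w. pd i g (\<chi> i. w i) = (\<Sum>\<alpha>\<in>?A. c \<alpha> * (\<Prod>j\<in>UNIV. w j ^ \<alpha> j))"
    unfolding poly_deg_less_def by blast
  then obtain c where c: "\<And>i w. pd i g (\<chi> i. w i) = (\<Sum>\<alpha>\<in>?A. c i \<alpha> * (\<Prod>j\<in>UNIV. w j ^ \<alpha> j))"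
    by metis
  \<comment> \<open>The denominator comes from integrating \<open>t ^ sum \<alpha> UNIV\<close> over
    the unit interval, which yields the value of \<open>g\<close> at the end of the ray.\<close>
  let ?q = "\<lambda>i \<alpha>. c i \<alpha> / real (Suc (sum \<alpha> UNIV))"
  have g: "g v = g 0 + (\<Sum>i\<in>UNIV. \<Sum>\<alpha>\<in>?A. ?q i \<alpha> * (v $ i * (\<Prod>j\<in>UNIV. v $ j ^ \<alpha> j)))" for v
  proof -
    let ?\<phi> = "\<lambda>t. g (t *\<^sub>R v)
      - (\<Sum>i\<in>UNIV. \<Sum>\<alpha>\<in>?A. ?q i \<alpha> * (v $ i * (\<Prod>j\<in>UNIV. v $ j ^ \<alpha> j)) * t ^ Suc (sum \<alpha> UNIV))"
    have pd: "pd i g (t *\<^sub>R v) = (\<Sum>\<alpha>\<in>?A. c i \<alpha> * (\<Prod>j\<in>UNIV. v $ j ^ \<alpha> j) * t ^ sum \<alpha> UNIV)" for i t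
    proof -
      have "pd i g (t *\<^sub>R v) = pd i g (\<chi> j. t * v $ j)"
        by (rule arg_cong[of _ _ "pd i g"]) (simp add: vec_eq_iff)
      then show ?thesis
        unfolding c by (simp add: power_mult_distrib prod.distrib power_sum algebra_simps)
    qed
    have "(?\<phi> has_real_derivative 0) (at t)" for t
    proof -
      have pow: "((\<lambda>t. t ^ Suc k) has_real_derivative real (Suc k) * t ^ k) (at t)" for k
        using DERIV_pow[of "Suc k" t] by simp
      have "(?\<phi> has_real_derivative (\<Sum>i\<in>UNIV. v $ i * pd i g (t *\<^sub>R v))
        - (\<Sum>i\<in>UNIV. \<Sum>\<alpha>\<in>?A. ?q i \<alpha> * (v $ i * (\<Prod>j\<in>UNIV. v $ j ^ \<alpha> j))
            * (real (Suc (sum \<alpha> UNIV)) * t ^ sum \<alpha> UNIV))) (at t)"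
        by (intro DERIV_diff has_derivative_along_ray[OF Suc.prems(1)] DERIV_sum DERIV_cmult pow)
      moreover have "(\<Sum>i\<in>UNIV. v $ i * pd i g (t *\<^sub>R v))
        = (\<Sum>i\<in>UNIV. \<Sum>\<alpha>\<in>?A. ?q i \<alpha> * (v $ i * (\<Prod>j\<in>UNIV. v $ j ^ \<alpha> j))
            * (real (Suc (sum \<alpha> UNIV)) * t ^ sum \<alpha> UNIV))"
        unfolding pd sum_distrib_left
        by (intro sum.cong refl) (simp add: field_simps del: of_nat_Suc)
      ultimately show ?thesis by simp
    qed
    then have "?\<phi> 1 = ?\<phi> 0" using DERIV_isconst_all by blast
    then show ?thesis by simp
  qed
  have mono: "w i * (\<Prod>j\<in>UNIV. w j ^ \<alpha> j) = (\<Prod>j\<in>UNIV. w j ^ (\<alpha>(i := Suc (\<alpha> i))) j)"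
    "sum (\<alpha>(i := Suc (\<alpha> i))) UNIV = Suc (sum \<alpha> UNIV)" for w :: "'i \<Rightarrow> real" and \<alpha> i
  proof -
    have e: "(\<alpha>(i := Suc (\<alpha> i))) j = \<alpha> j + (if j = i then 1 else 0)" for j by simp
    have "(\<Prod>j\<in>UNIV. w j ^ (if j = i then 1 else 0)) = (\<Prod>j\<in>UNIV. if j = i then w j else 1)"
      by (intro prod.cong) auto
    then show "w i * (\<Prod>j\<in>UNIV. w j ^ \<alpha> j) = (\<Prod>j\<in>UNIV. w j ^ (\<alpha>(i := Suc (\<alpha> i))) j)"
      unfolding e power_add prod.distrib by simp
    show "sum (\<alpha>(i := Suc (\<alpha> i))) UNIV = Suc (sum \<alpha> UNIV)"
      unfolding e sum.distrib by simp
  qed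
  have "poly_deg_less (Suc m) (\<lambda>w. g 0 * (\<Prod>j\<in>UNIV. w j ^ (0::nat))
    + (\<Sum>i\<in>UNIV. \<Sum>\<alpha>\<in>?A. ?q i \<alpha> * (w i * (\<Prod>j\<in>UNIV. w j ^ \<alpha> j))))"
    unfolding mono(1)
    by (intro poly_deg_less_add poly_deg_less_sum poly_deg_less_monomial) (simp_all only: mono(2), auto)
  then show ?case by (subst g) simp
qed

lemma difs_annihilated_aux:
  fixes f :: "'a::ab_group_add \<Rightarrow> 'b::real_inner"
  assumes "\<And>x. u \<bullet> f (x + \<theta>) = u \<bullet> f x"
  shows "u \<bullet> difs \<theta>s f (x + \<theta>) = u \<bullet> difs \<theta>s f x"
proof (induction \<theta>s arbitrary: x)
  case (Cons \<theta>' \<theta>s)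
  show ?case
    using Cons[of "x + \<theta>'"] Cons[of x] by (simp add: inner_diff_right ac_simps)
qed (use assms in simp)

text \<open>Invariance of \<open>u \<bullet> f\<close> under translation by \<open>\<theta>\<close>
  is inherited by all differences of \<open>f\<close>, so the difference taken along
  \<open>\<theta>\<close> itself has no component along \<open>u\<close>.\<close>

lemma difs_annihilated:
  fixes f :: "'a::ab_group_add \<Rightarrow> 'b::real_inner"
  assumes "\<And>x. u \<bullet> f (x + \<theta>) = u \<bullet> f x"
  shows "\<theta> \<in> set \<theta>s \<Longrightarrow> u \<bullet> difs \<theta>s f x = 0"
proof (induction \<theta>s arbitrary: x)
  case (Cons \<theta>' \<theta>s)
  show ?case
    using Cons difs_annihilated_aux[of u f \<theta>, OF assms]
    by (cases "\<theta> = \<theta>'") (auto simp: inner_diff_right)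
qed simp

lemma continuous_on_difs:
  assumes "continuous_on UNIV f" "\<And>\<theta>. \<theta> \<in> set \<theta>s \<Longrightarrow> continuous_on UNIV \<theta>" "continuous_on UNIV x"
  shows "continuous_on UNIV (\<lambda>t. difs (map (\<lambda>\<theta>. \<theta> t) \<theta>s) (f :: 'a::real_normed_vector \<Rightarrow> 'b::real_normed_vector) (x t))"
  using assms(2,3)
proof (induction \<theta>s arbitrary: x)
  case Nil
  then show ?case using continuous_on_compose2[OF assms(1)] by auto
next
  case (Cons \<theta> \<theta>s)
  then show ?case by (auto intro!: continuous_on_diff continuous_on_add)
qed

text \<open>Differences commute, so the outermost one can be absorbed into the function; this feeds
  the induction on the number of increments.\<close>

lemma difs_dif: "difs \<theta>s (difs [\<theta>] f) x = difs (\<theta> # \<theta>s) f x"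
proof (induction \<theta>s arbitrary: x)
  case (Cons \<eta> \<theta>s)
  have "difs (\<eta> # \<theta>s) (difs [\<theta>] f) x = difs \<theta>s (difs [\<theta>] f) (x + \<eta>) - difs \<theta>s (difs [\<theta>] f) x"
    by (rule difs.simps(2))
  also have "\<dots> = difs (\<theta> # \<eta> # \<theta>s) f x" unfolding Cons by (simp add: ac_simps)
  finally show ?case .
qed simp

text \<open>A difference is neither additive nor homogeneous in its increment. But the difference
  along \<open>a + b\<close> at \<open>x\<close> is the one along \<open>a\<close> at
  \<open>x + b\<close> plus the one along \<open>b\<close> at \<open>x\<close>, and vanishing is
  assumed at every point and for all multiples of elements of \<open>B\<close>.\<close>

lemma difs_zero_span:
  fixes f :: "'a::real_vector \<Rightarrow> 'b::ab_group_add"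
  assumes "\<And>\<theta>s x. \<lbrakk>length \<theta>s = m; \<And>\<theta>. \<theta> \<in> set \<theta>s \<Longrightarrow> \<exists>c. \<exists>b\<in>B. \<theta> = c *\<^sub>R b\<rbrakk> \<Longrightarrow> difs \<theta>s f x = 0"
    and "length \<theta>s = m" "set \<theta>s \<subseteq> span B"
  shows "difs \<theta>s f x = 0"
  using assms
proof (induction m arbitrary: f \<theta>s x)
  case 0
  then show ?case by simp
next
  case (Suc m)
  obtain \<theta> \<theta>s' where \<theta>s: "\<theta>s = \<theta> # \<theta>s'" "length \<theta>s' = m" "\<theta> \<in> span B" "set \<theta>s' \<subseteq> span B"
    using Suc.prems(2,3) by (cases \<theta>s) auto
  have base: "difs ((c *\<^sub>R b) # \<theta>s') f x = 0" if "b \<in> B" for c b x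
  proof -
    have "difs \<theta>s' (difs [c *\<^sub>R b] f) x = 0"
    proof (rule Suc.IH[OF _ \<theta>s(2,4)])
      fix \<eta>s x
      assume \<eta>s: "length \<eta>s = m" "\<And>\<theta>. \<theta> \<in> set \<eta>s \<Longrightarrow> \<exists>c. \<exists>b\<in>B. \<theta> = c *\<^sub>R b"
      show "difs \<eta>s (difs [c *\<^sub>R b] f) x = 0"
        unfolding difs_dif
      proof (rule Suc.prems(1))
        show "\<exists>c. \<exists>b\<in>B. \<theta> = c *\<^sub>R b" if "\<theta> \<in> set (c *\<^sub>R b # \<eta>s)" for \<theta>
          using that \<eta>s(2) \<open>b \<in> B\<close> by (cases "\<theta> = c *\<^sub>R b") auto
      qed (simp add: \<eta>s(1))
    qed
    then show ?thesis by (simp only: difs_dif)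
  qed
  have "\<forall>x. difs (\<theta> # \<theta>s') f x = 0"
    using \<theta>s(3)
  proof (induction rule: span_induct_alt)
    case (step c b \<eta>)
    show ?case
    proof
      fix x
      have "difs ((c *\<^sub>R b + \<eta>) # \<theta>s') f x = difs ((c *\<^sub>R b) # \<theta>s') f (x + \<eta>) + difs (\<eta> # \<theta>s') f x"
        by (simp add: ac_simps)
      then show "difs ((c *\<^sub>R b + \<eta>) # \<theta>s') f x = 0" using base step by simp
    qed
  qed simp
  then show ?case using \<theta>s(1) by simp
qed

section \<open>Polynomiality from the symmetries of the derivative\<close>

definition outer :: "real^'n::finite \<Rightarrow> real^'n \<Rightarrow> real^'n^'n" where
  "outer u v = (\<chi> a b. u $ a * v $ b)"

text \<open>The derivative indices come first and the metric indices last, as in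
  \<open>second_derivs\<close>.\<close>

definition quad :: "real^'n::finite^'n \<Rightarrow> real^'n^'n \<Rightarrow> real^'n^'n^'n^'n" where
  "quad \<beta> \<alpha> = (\<chi> k l a b. \<beta> $ k $ l * \<alpha> $ a $ b)"

text \<open>The projection onto the arrays symmetric in each of the two index pairs, where the
  second derivatives of a metric lie. Composition with it extends functions from that subspace to
  all arrays.\<close>

definition sym4 :: "real^'n::finite^'n^'n^'n \<Rightarrow> real^'n^'n^'n^'n" where
  "sym4 H = (\<chi> k l a b. (H$k$l$a$b + H$l$k$a$b + H$k$l$b$a + H$l$k$b$a) / 4)"

lemma outer_nth [simp]: "outer u v $ a $ b = u $ a * v $ b"
  by (simp add: outer_def)

lemma quad_nth [simp]: "quad \<beta> \<alpha> $ k $ l $ a $ b = \<beta> $ k $ l * \<alpha> $ a $ b"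
  by (simp add: quad_def)

lemma sym4_nth [simp]: "sym4 H $ k $ l $ a $ b = (H$k$l$a$b + H$l$k$a$b + H$k$l$b$a + H$l$k$b$a) / 4"
  by (simp add: sym4_def)

lemma bounded_linear_sym4: "bounded_linear (sym4 :: real^'n::finite^'n^'n^'n \<Rightarrow> _)"
  by (rule linear_conv_bounded_linear[THEN iffD1], rule linearI)
    (simp_all add: vec_eq_iff field_simps)

lemma sym4_add: "sym4 (H + H') = sym4 H + sym4 H'" and sym4_scaleR: "sym4 (s *\<^sub>R H) = s *\<^sub>R sym4 H"
  by (simp_all add: vec_eq_iff field_simps)

lemma sym4_idem [simp]: "sym4 (sym4 H) = sym4 H"
  by (simp add: vec_eq_iff field_simps)

lemma quad_diff: "quad (\<beta> - \<beta>') \<alpha> = quad \<beta> \<alpha> - quad \<beta>' \<alpha>" "quad \<beta> (\<alpha> - \<alpha>') = quad \<beta> \<alpha> - quad \<beta> \<alpha>'"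
  by (simp_all add: vec_eq_iff algebra_simps)

lemma outer_polarize: "outer u v + outer v u = outer (u + v) (u + v) - outer u u - outer v v"
  by (simp add: vec_eq_iff algebra_simps)

text \<open>Symmetrizing the expansion of \<open>H\<close> in the standard basis produces products
  of symmetrized outer products, and each symmetrized outer product polarizes into squares.\<close>

lemma sym4_in_span:
  fixes H :: "real^'n::finite^'n^'n^'n"
  shows "sym4 H \<in> span {quad (outer u u) (outer v v) | u v. True}" (is "_ \<in> span ?B")
proof -
  let ?e = "\<lambda>k. axis k 1 :: real^'n"
  let ?q = "\<lambda>k l a b. quad (outer (?e k) (?e l) + outer (?e l) (?e k)) (outer (?e a) (?e b) + outer (?e b) (?e a))"
  define d :: "'n \<Rightarrow> 'n \<Rightarrow> real" where "d k i = (if k = i then 1 else 0)" for k i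
  have e: "?e k $ i = d k i" for k i by (auto simp: axis_def d_def)
  have S: "(\<Sum>k\<in>UNIV. \<Sum>l\<in>UNIV. \<Sum>a\<in>UNIV. \<Sum>b\<in>UNIV. X k l a b * (d k i * d l j * d a p * d b q)) = X i j p q"
    for X and i j p q
  proof -
    have D: "(\<Sum>b\<in>UNIV. Y b * (z * d b q)) = Y q * z" "(\<Sum>b\<in>UNIV. Y b * d b q) = Y q" for Y z q
    proof -
      have "(\<Sum>b\<in>UNIV. Y b * (z * d b q)) = (\<Sum>b\<in>UNIV. if b = q then Y b * z else 0)"
        "(\<Sum>b\<in>UNIV. Y b * d b q) = (\<Sum>b\<in>UNIV. if b = q then Y b else 0)"
        by (intro sum.cong; simp add: d_def)+
      then show "(\<Sum>b\<in>UNIV. Y b * (z * d b q)) = Y q * z" "(\<Sum>b\<in>UNIV. Y b * d b q) = Y q"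
        by simp_all
    qed
    show ?thesis unfolding D ..
  qed
  have "sym4 H = (\<Sum>k\<in>UNIV. \<Sum>l\<in>UNIV. \<Sum>a\<in>UNIV. \<Sum>b\<in>UNIV. (H$k$l$a$b / 4) *\<^sub>R ?q k l a b)" (is "_ = ?R")
  proof -
    have "?R $ i $ j $ p $ q = sym4 H $ i $ j $ p $ q" for i j p q
    proof -
      let ?X = "\<lambda>k l a b. H$k$l$a$b / 4"
      have "?R $ i $ j $ p $ q = (\<Sum>k\<in>UNIV. \<Sum>l\<in>UNIV. \<Sum>a\<in>UNIV. \<Sum>b\<in>UNIV.
          ?X k l a b * (d k i * d l j * d a p * d b q) + ?X k l a b * (d k j * d l i * d a p * d b q)
          + ?X k l a b * (d k i * d l j * d a q * d b p) + ?X k l a b * (d k j * d l i * d a q * d b p))"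
        by (simp add: e algebra_simps)
      also have "\<dots> = sym4 H $ i $ j $ p $ q"
        unfolding sum.distrib S by simp
      finally show ?thesis .
    qed
    then show ?thesis by (simp add: vec_eq_iff)
  qed
  moreover have "?q k l a b \<in> span ?B" for k l a b
  proof -
    have B: "quad (outer u u) (outer v v) \<in> span ?B" for u v by (rule span_base) auto
    show ?thesis unfolding outer_polarize quad_diff by (intro span_diff B)
  qed
  ultimately show ?thesis by (auto intro!: span_sum span_scale)
qed

text \<open>The part of \<open>r (l + t *\<^sub>R u) u\<close> that is linear in \<open>t\<close> is \<open>c l u = quad (outer l u + outer u l) (outer u l + outer l u)
  + 2 *\<^sub>R quad (outer l l) (outer u u)\<close>; the first summand cancels in \<open>c l u - c u l\<close>.\<close>

lemma quad_outer_swap_eq: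
  defines "r \<equiv> \<lambda>w v. quad (outer w w) (outer v w + outer w v)"
  shows "s *\<^sub>R quad (outer l l) (outer u u) = s *\<^sub>R quad (outer u u) (outer l l)
    + r (l + u) ((s/4) *\<^sub>R u) + r (l - u) ((-s/4) *\<^sub>R u) + r u ((-s/2) *\<^sub>R u)
    + r (u + l) ((-s/4) *\<^sub>R l) + r (u - l) ((s/4) *\<^sub>R l) + r l ((s/2) *\<^sub>R l)"
  unfolding r_def by (simp add: vec_eq_iff field_simps)

text \<open>The values of \<open>f\<close> are meant as the components of a tensor along its last
  index, the other indices being fixed. Its \<open>m\<close>-fold difference is the
  \<open>\<omega>\<close> of \<open>annihilated_by_many_vectors\<close>.\<close>

lemma polynomial_if_derivative_symmetries:
  fixes f :: "real^'n::finite^'n^'n^'n \<Rightarrow> real^'n"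
  assumes smooth: "Cinf UNIV f" and sym: "\<And>H. f (sym4 H) = f H"
    and div: "\<And>H l u s. l \<bullet> f (H + s *\<^sub>R quad (outer l l) (outer u u)) = l \<bullet> f H"
    and nat: "\<And>H l v. f (H + quad (outer l l) (outer v l + outer l v)) = f H"
    and m: "CARD('n) \<le> 2 * m"
  shows "\<exists>P. poly_deg_less m P \<and> (\<forall>H. f H $ j = P (\<lambda>(a, b, k, l). H $ k $ l $ a $ b))"
proof -
  \<comment> \<open>The six correction terms of \<open>quad_outer_swap_eq\<close> are translations
    that \<open>nat\<close> ignores, so the two factors of the increment can trade places before
    \<open>div\<close> is applied.\<close>
  have div': "u \<bullet> f (H + s *\<^sub>R quad (outer l l) (outer u u)) = u \<bullet> f H" for H l u s
  proof -
    have "f (H + s *\<^sub>R quad (outer l l) (outer u u)) = f (H + s *\<^sub>R quad (outer u u) (outer l l))"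
      unfolding quad_outer_swap_eq[of s l u] by (simp only: nat add.assoc[symmetric])
    then show ?thesis by (simp only: div)
  qed
  let ?B = "{quad (outer u u) (outer v v) | u v. True}"
  have base: "difs \<theta>s f H = 0"
    if \<theta>s: "length \<theta>s = m" "\<And>\<theta>. \<theta> \<in> set \<theta>s \<Longrightarrow> \<exists>c. \<exists>b\<in>?B. \<theta> = c *\<^sub>R b" for \<theta>s H
  proof -
    have "\<forall>i<m. \<exists>c u v. \<theta>s ! i = c *\<^sub>R quad (outer u u) (outer v v)"
      using \<theta>s nth_mem by fastforce
    then obtain c u v where cuv: "\<And>i. i < m \<Longrightarrow> \<theta>s ! i = c i *\<^sub>R quad (outer (u i) (u i)) (outer (v i) (v i))"
      by metis
    \<comment> \<open>Slots \<open>2*i\<close> and \<open>2*i+1\<close> of one family hold the two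
      vectors of the \<open>i\<close>-th increment, so \<open>m\<close> increments depend on
      \<open>2 * m\<close> vectors. The scalars \<open>c i\<close> stay fixed.\<close>
    define \<theta> where "\<theta> us i = c i *\<^sub>R quad (outer (us (2*i)) (us (2*i))) (outer (us (2*i+1)) (us (2*i+1)))"
      for us :: "nat \<Rightarrow> real^'n" and i
    let ?\<omega> = "\<lambda>us. difs (map (\<theta> us) [0..<m]) f H"
    have "?\<omega> us = 0" for us
    proof (rule annihilated_by_many_vectors[where \<omega> = ?\<omega>, OF m])
      show "us i \<bullet> ?\<omega> us = 0" if "i < 2 * m" for us i
      proof (rule difs_annihilated)
        show "\<theta> us (i div 2) \<in> set (map (\<theta> us) [0..<m])" using that by auto
        show "us i \<bullet> f (x + \<theta> us (i div 2)) = us i \<bullet> f x" for x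
        proof (cases "even i")
          case True
          then have "2 * (i div 2) = i" by simp
          then show ?thesis unfolding \<theta>_def by (simp only: div)
        next
          case False
          then have "2 * (i div 2) + 1 = i" by simp
          then show ?thesis unfolding \<theta>_def by (simp only: div')
        qed
      qed
      show "isCont (\<lambda>t. ?\<omega> (\<lambda>i. us i + t *\<^sub>R w i)) 0" for us w
      proof -
        have c: "continuous_on UNIV (\<lambda>t. \<theta> (\<lambda>i. us i + t *\<^sub>R w i) i)" for i
          unfolding \<theta>_def quad_def outer_def by (intro continuous_intros)
        have "continuous_on UNIV (\<lambda>t. difs (map (\<lambda>\<theta>. \<theta> t)
            (map (\<lambda>i t. \<theta> (\<lambda>i. us i + t *\<^sub>R w i) i) [0..<m])) f ((\<lambda>_. H) t))"
          by (rule continuous_on_difs) (use Cinf_continuous_on[OF smooth] c in auto)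
        then show ?thesis by (simp add: continuous_on_eq_continuous_at o_def)
      qed
    qed
    moreover have "map (\<theta> (\<lambda>i. if even i then u (i div 2) else v (i div 2))) [0..<m] = \<theta>s"
      by (rule nth_equalityI) (use \<theta>s(1) cuv in \<open>auto simp: \<theta>_def\<close>)
    ultimately show ?thesis by metis
  qed
  \<comment> \<open>Since \<open>f\<close> factors through \<open>sym4\<close>, an arbitrary
    increment acts like its symmetrization, which lies in the span of the increments already
    treated.\<close>
  have sym': "f (H + \<theta>) = f (H + sym4 \<theta>)" for H \<theta>
    using sym[of "H + \<theta>"] sym[of "H + sym4 \<theta>"]
    by (simp add: sym4_add)
  have tr: "difs \<theta>s f (H + \<theta>) = difs \<theta>s f (H + sym4 \<theta>)" for \<theta>s H \<theta>
  proof (induction \<theta>s arbitrary: H)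
    case Nil
    show ?case unfolding difs.simps(1) by (rule sym')
  next
    case (Cons \<eta> \<theta>s)
    show ?case using Cons[of "H + \<eta>"] Cons[of H] by (simp add: ac_simps)
  qed
  have "difs \<theta>s f H = difs (map sym4 \<theta>s) f H" for \<theta>s H
  proof (induction \<theta>s arbitrary: H)
    case (Cons \<theta> \<theta>s)
    show ?case using tr[of \<theta>s H \<theta>] Cons by simp
  qed simp
  then have zero: "difs \<theta>s f H = 0" if "length \<theta>s = m" for \<theta>s H
    using difs_zero_span[of m ?B f "map sym4 \<theta>s", OF base] that sym4_in_span by auto
  \<comment> \<open>Polynomial variables are indexed by quadruples with the metric indices first;
    \<open>L\<close> reshapes them into an array with the derivative indices first.\<close>
  define L :: "real^('n \<times> 'n \<times> 'n \<times> 'n) \<Rightarrow> real^'n^'n^'n^'n"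
    where "L v = (\<chi> k l a b. v $ (a, b, k, l))" for v
  have L: "bounded_linear L"
    by (rule linear_conv_bounded_linear[THEN iffD1], rule linearI) (simp_all add: vec_eq_iff L_def)
  let ?g = "\<lambda>v. f (L v) $ j"
  have difs_g: "difs \<theta>s ?g v = difs (map L \<theta>s) f (L v) $ j" for \<theta>s v
    by (induction \<theta>s arbitrary: v) (simp_all add: linear_add[OF bounded_linear.linear[OF L]])
  have "poly_deg_less m (\<lambda>w. ?g (\<chi> i. w i))"
  proof (rule poly_deg_less_if_difs_zero)
    show "Cinf UNIV ?g"
      using Cinf_vec_nth[OF open_UNIV Cinf_compose[OF open_UNIV open_UNIV _ smooth Cinf_linear[OF L open_UNIV]]]
      by simp
    show "difs \<theta>s ?g x = 0" if "length \<theta>s = m" for \<theta>s x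
      unfolding difs_g using zero[of "map L \<theta>s"] that by simp
  qed
  moreover have "f H $ j = ?g (\<chi> i. (\<lambda>(a, b, k, l). H $ k $ l $ a $ b) i)" for H
  proof -
    have "L (\<chi> i. (\<lambda>(a, b, k, l). H $ k $ l $ a $ b) i) = H" by (simp add: vec_eq_iff L_def)
    then show ?thesis by simp
  qed
  ultimately show ?thesis by blast
qed

section \<open>Contracting blocks of indices\<close>

definition blk :: "'n \<times> 'n \<times> 'n \<times> 'n \<Rightarrow> 'n list" where
  "blk = (\<lambda>(a, b, c, d). [a, b, c, d])"

definition coef :: "real^'n::finite \<Rightarrow> real^'n \<Rightarrow> 'n \<times> 'n \<times> 'n \<times> 'n \<Rightarrow> real" where
  "coef u w = (\<lambda>(a, b, c, d). u $ a * u $ b * w $ c * w $ d)"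

definition contr :: "real^'n::finite \<Rightarrow> real^'n \<Rightarrow> ('n list \<Rightarrow> 'b::real_vector) \<Rightarrow> 'n list \<Rightarrow> 'b" where
  "contr u w F R = (\<Sum>q\<in>UNIV. coef u w q *\<^sub>R F (blk q @ R))"

fun contrs :: "((real^'n::finite) \<times> (real^'n)) list \<Rightarrow> ('n list \<Rightarrow> 'b::real_vector) \<Rightarrow> 'b" where
  "contrs [] F = F []"
| "contrs (p # ps) F = contrs ps (contr (fst p) (snd p) F)"

lemma length_blk [simp]: "length (blk q) = 4"
  by (simp add: blk_def split: prod.splits)

lemma sum_quadruples: "(\<Sum>q\<in>UNIV. f q) = (\<Sum>a\<in>UNIV. \<Sum>b\<in>UNIV. \<Sum>c\<in>UNIV. \<Sum>d\<in>UNIV. f (a, b, c, d))"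
  for f :: "'n::finite \<times> 'n \<times> 'n \<times> 'n \<Rightarrow> 'b::comm_monoid_add"
  by (simp add: sum.cartesian_product)

text \<open>The condition is imposed at every block position, \<open>4 dvd length Q\<close> saying
  that \<open>Q\<close> consists of whole blocks, so that it survives the contraction of the first
  block.\<close>

definition block_annihilated :: "('n::finite list \<Rightarrow> real^'n) \<Rightarrow> bool" where
  "block_annihilated F \<longleftrightarrow> (\<forall>Q R u w. 4 dvd length Q \<longrightarrow>
     (\<Sum>q\<in>UNIV. coef u w q * (u \<bullet> F (Q @ blk q @ R))) = 0 \<and>
     (\<Sum>q\<in>UNIV. coef u w q * (w \<bullet> F (Q @ blk q @ R))) = 0)"

definition block_symmetric :: "('n::finite list \<Rightarrow> real^'n) \<Rightarrow> bool" where
  "block_symmetric F \<longleftrightarrow> (\<forall>Q a b c d R. 4 dvd length Q \<longrightarrow>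
     F (Q @ [a,b,c,d] @ R) = F (Q @ [b,a,c,d] @ R) \<and> F (Q @ [a,b,c,d] @ R) = F (Q @ [a,b,d,c] @ R))"

text \<open>Contractions of different blocks commute, so the identity for a later block can be
  applied inside the contraction of the first one.\<close>

lemma block_annihilated_contr:
  assumes "block_annihilated F"
  shows "block_annihilated (contr u w F)"
proof -
  have swap: "(\<Sum>q\<in>UNIV. g q * (x \<bullet> contr u w F (Q @ blk q @ R)))
      = (\<Sum>q'\<in>UNIV. coef u w q' * (\<Sum>q\<in>UNIV. g q * (x \<bullet> F ((blk q' @ Q) @ blk q @ R))))" for g x Q R
    unfolding contr_def inner_sum_right inner_scaleR_right sum_distrib_left
    by (subst sum.swap) (simp add: algebra_simps)
  show ?thesis
    using assms unfolding block_annihilated_def swap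
    by (auto intro!: sum.neutral simp del: append_assoc)
qed

lemma block_symmetric_contr:
  assumes "block_symmetric F"
  shows "block_symmetric (contr u w F)"
proof -
  have E: "F (blk q @ Q @ [a,b,c,d] @ R) = F (blk q @ Q @ [b,a,c,d] @ R)"
    "F (blk q @ Q @ [a,b,c,d] @ R) = F (blk q @ Q @ [a,b,d,c] @ R)"
    if "4 dvd length Q" for q Q a b c d R
    using assms[unfolded block_symmetric_def, rule_format, of "blk q @ Q"] that by (simp_all)
  show ?thesis
    unfolding block_symmetric_def contr_def
    by (intro allI impI conjI sum.cong refl arg_cong[of _ _ "(*\<^sub>R) _"]) (erule E)+
qed

lemma contrs_annihilated_aux:
  "(\<And>R. x \<bullet> F R = 0) \<Longrightarrow> x \<bullet> contrs ps F = 0"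
  by (induction ps arbitrary: F) (simp_all add: contr_def inner_sum_right)

text \<open>Once the block belonging to \<open>p\<close> has been contracted, both of its vectors
  annihilate every remaining component, and further contractions are linear.\<close>

lemma contrs_annihilated:
  fixes F :: "'n::finite list \<Rightarrow> real^'n"
  shows "block_annihilated F \<Longrightarrow> p \<in> set ps \<Longrightarrow> fst p \<bullet> contrs ps F = 0 \<and> snd p \<bullet> contrs ps F = 0"
proof (induction ps arbitrary: F)
  case (Cons p' ps)
  show ?case
  proof (cases "p = p'")
    case True
    have "fst p \<bullet> contr (fst p) (snd p) F R = 0 \<and> snd p \<bullet> contr (fst p) (snd p) F R = 0" for R
      using Cons.prems(1)[unfolded block_annihilated_def, rule_format, of "[]"]
      by (simp add: contr_def inner_sum_right)
    then have "fst p \<bullet> contrs ps (contr (fst p) (snd p) F) = 0"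
      "snd p \<bullet> contrs ps (contr (fst p) (snd p) F) = 0"
      by (auto intro!: contrs_annihilated_aux)
    then show ?thesis using True by simp
  next
    case False
    then show ?thesis using Cons block_annihilated_contr by auto
  qed
qed simp

lemma continuous_on_contrs:
  fixes F :: "real \<Rightarrow> 'n::finite list \<Rightarrow> 'b::real_normed_vector"
  assumes "\<And>p. p \<in> set ps \<Longrightarrow> continuous_on UNIV p" "\<And>K. continuous_on UNIV (\<lambda>t. F t K)"
  shows "continuous_on UNIV (\<lambda>t. contrs (map (\<lambda>p. p t) ps) (F t))"
  using assms
proof (induction ps arbitrary: F)
  case (Cons p ps)
  have "continuous_on UNIV (\<lambda>t. contr (fst (p t)) (snd (p t)) (F t) R)" for R
  proof -
    have "continuous_on UNIV (\<lambda>t. coef (fst (p t)) (snd (p t)) q)" for q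
      unfolding coef_def using Cons.prems(1)[of p]
      by (cases q) (auto intro!: continuous_intros)
    then show ?thesis
      unfolding contr_def using Cons.prems(2) by (intro continuous_intros) auto
  qed
  then show ?case using Cons by simp
qed simp

text \<open>Polarization: the form is evaluated at two standard basis vectors and at their
  sum.\<close>

lemma symmetric_form_zero:
  fixes \<beta> :: "'n::finite \<Rightarrow> 'n \<Rightarrow> real"
  assumes "\<And>u :: real^'n. (\<Sum>a\<in>UNIV. \<Sum>b\<in>UNIV. u $ a * u $ b * \<beta> a b) = 0"
    and "\<And>a b. \<beta> a b = \<beta> b a"
  shows "\<beta> a b = 0"
proof -
  define B where "B u v = (\<Sum>a\<in>UNIV. \<Sum>b\<in>UNIV. u $ a * v $ b * \<beta> a b)" for u v :: "real^'n"
  have ax: "B (axis a 1) (axis b 1) = \<beta> a b" for a b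
  proof -
    have "(\<Sum>i\<in>UNIV. (axis b 1 :: real^'n) $ i * Y i) = Y b" for b and Y :: "'n \<Rightarrow> real"
      by (simp add: axis_def mult_delta_left)
    then show ?thesis unfolding B_def mult.assoc sum_distrib_left[symmetric] by simp
  qed
  have "B (axis a 1 + axis b 1) (axis a 1 + axis b 1)
    = B (axis a 1) (axis a 1) + B (axis a 1) (axis b 1) + B (axis b 1) (axis a 1) + B (axis b 1) (axis b 1)"
    unfolding B_def by (simp add: algebra_simps sum.distrib)
  moreover have "B u u = 0" for u using assms(1) by (simp add: B_def)
  ultimately show ?thesis using assms(2)[of a b] by (simp add: ax)
qed

text \<open>Polarization is applied to the last index pair with \<open>w\<close>, and within it to
  the first index pair with \<open>u\<close>.\<close>

lemma contr_zero:
  fixes F :: "'n::finite list \<Rightarrow> real^'n"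
  assumes "block_symmetric F" "\<And>u w. contr u w F R = 0"
  shows "F ([a,b,c,d] @ R) = 0"
proof -
  have sym: "F ([a,b,c,d] @ R) = F ([b,a,c,d] @ R)" "F ([a,b,c,d] @ R) = F ([a,b,d,c] @ R)" for a b c d
    using assms(1)[unfolded block_symmetric_def, rule_format, of "[]"] by auto
  have "F ([a,b,c,d] @ R) $ j = 0" for j
  proof (rule symmetric_form_zero[of "\<lambda>c d. F ([a,b,c,d] @ R) $ j"])
    fix w :: "real^'n"
    show "(\<Sum>c\<in>UNIV. \<Sum>d\<in>UNIV. w $ c * w $ d * F ([a,b,c,d] @ R) $ j) = 0"
    proof (rule symmetric_form_zero[of "\<lambda>a b. \<Sum>c\<in>UNIV. \<Sum>d\<in>UNIV. w $ c * w $ d * F ([a,b,c,d] @ R) $ j"])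
      fix u :: "real^'n"
      have "(\<Sum>a\<in>UNIV. \<Sum>b\<in>UNIV. u $ a * u $ b * (\<Sum>c\<in>UNIV. \<Sum>d\<in>UNIV. w $ c * w $ d * F ([a,b,c,d] @ R) $ j))
          = contr u w F R $ j"
        by (simp add: contr_def sum_quadruples coef_def blk_def sum_distrib_left mult.assoc)
      then show "(\<Sum>a\<in>UNIV. \<Sum>b\<in>UNIV. u $ a * u $ b * (\<Sum>c\<in>UNIV. \<Sum>d\<in>UNIV. w $ c * w $ d * F ([a,b,c,d] @ R) $ j)) = 0"
        using assms(2) by simp
    qed (simp only: sym(1))
  qed (simp only: sym(2))
  then show ?thesis by (simp add: vec_eq_iff)
qed

lemma contrs_zero:
  fixes F :: "'n::finite list \<Rightarrow> real^'n"
  shows "\<lbrakk>block_symmetric F; \<And>ps. length ps = m \<Longrightarrow> contrs ps F = 0; length K = 4 * m\<rbrakk> \<Longrightarrow> F K = 0"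
proof (induction m arbitrary: F K)
  case 0
  then show ?case using 0(2)[of "[]"] by simp
next
  case (Suc m)
  obtain a b c d R where K: "K = [a,b,c,d] @ R" "length R = 4 * m"
  proof -
    have "length K = Suc (Suc (Suc (Suc (4 * m))))" using Suc.prems(3) by simp
    then show thesis using that by (auto simp: length_Suc_conv)
  qed
  have "contr u w F R = 0" for u w
  proof (rule Suc.IH[OF block_symmetric_contr[OF Suc.prems(1)] _ K(2)])
    show "contrs ps (contr u w F) = 0" if "length ps = m" for ps
      using Suc.prems(2)[of "(u, w) # ps"] that by simp
  qed
  then show ?case unfolding K(1) by (rule contr_zero[OF Suc.prems(1)])
qed

lemma block_annihilated_zero:
  fixes F :: "'n::finite list \<Rightarrow> real^'n"
  assumes "block_annihilated F" "block_symmetric F" "CARD('n) \<le> 2 * m" "length K = 4 * m"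
  shows "F K = 0"
proof (rule contrs_zero[OF assms(2) _ assms(4)])
  fix ps :: "((real^'n) \<times> (real^'n)) list"
  assume ps: "length ps = m"
  let ?\<omega> = "\<lambda>us. contrs (map (\<lambda>i. (us (2*i), us (2*i+1))) [0..<m]) F"
  have "?\<omega> us = 0" for us
  proof (rule annihilated_by_many_vectors[where \<omega> = ?\<omega>, OF assms(3)])
    show "us i \<bullet> ?\<omega> us = 0" if "i < 2 * m" for us i
    proof -
      let ?p = "(us (2 * (i div 2)), us (2 * (i div 2) + 1))"
      have "?p \<in> set (map (\<lambda>i. (us (2*i), us (2*i+1))) [0..<m])" using that by auto
      from contrs_annihilated[OF assms(1) this] show ?thesis
        by (cases "even i") simp_all
    qed
    show "isCont (\<lambda>t. ?\<omega> (\<lambda>i. us i + t *\<^sub>R w i)) 0" for us w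
    proof -
      have "continuous_on UNIV (\<lambda>t. contrs (map (\<lambda>p. p t)
          (map (\<lambda>i t. (us (2*i) + t *\<^sub>R w (2*i), us (2*i+1) + t *\<^sub>R w (2*i+1))) [0..<m])) F)"
        by (rule continuous_on_contrs) (auto intro!: continuous_intros)
      then show ?thesis by (simp add: continuous_on_eq_continuous_at o_def)
    qed
  qed
  \<comment> \<open>This interleaved family reproduces the given list of pairs.\<close>
  then have "?\<omega> (\<lambda>i. if even i then fst (ps ! (i div 2)) else snd (ps ! (i div 2))) = 0" .
  moreover have "map (\<lambda>i. (fst (ps ! i), snd (ps ! i))) [0..<m] = ps"
    by (rule nth_equalityI) (use ps in auto)
  ultimately show "contrs ps F = 0" by simp
qed

section \<open>Vanishing of the spaces Div\<close>

text \<open>The weight \<open>w c * w d * w j\<close> is symmetric, so the three rotations of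
  \<open>X\<close> contribute the same sum; their total is three times that sum.\<close>

lemma cyclic_sum_zero:
  fixes w :: "'n::finite \<Rightarrow> real"
  assumes "\<And>j c d. X j c d + X d j c + X c d j = 0"
  shows "(\<Sum>c\<in>UNIV. \<Sum>d\<in>UNIV. \<Sum>j\<in>UNIV. w c * w d * w j * X j c d) = 0" (is "?S = 0")
proof -
  define f where "f x y z = w x * w y * w z * X x y z" for x y z
  have "?S = (\<Sum>c\<in>UNIV. \<Sum>d\<in>UNIV. \<Sum>j\<in>UNIV. f j c d)"
    by (simp add: f_def mult.commute mult.left_commute)
  also have "\<dots> = (\<Sum>c\<in>UNIV. \<Sum>j\<in>UNIV. \<Sum>d\<in>UNIV. f j c d)"
    by (rule sum.cong[OF refl], rule sum.swap)
  also have "\<dots> = (\<Sum>j\<in>UNIV. \<Sum>c\<in>UNIV. \<Sum>d\<in>UNIV. f j c d)"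
    by (rule sum.swap)
  finally have S: "?S = (\<Sum>x\<in>UNIV. \<Sum>y\<in>UNIV. \<Sum>z\<in>UNIV. f x y z)" .
  have "(\<Sum>c\<in>UNIV. \<Sum>d\<in>UNIV. \<Sum>j\<in>UNIV. w c * w d * w j * X d j c)
      = (\<Sum>c\<in>UNIV. \<Sum>d\<in>UNIV. \<Sum>j\<in>UNIV. f d j c)"
    by (simp add: f_def mult.commute mult.left_commute)
  also have "\<dots> = (\<Sum>d\<in>UNIV. \<Sum>c\<in>UNIV. \<Sum>j\<in>UNIV. f d j c)"
    by (rule sum.swap)
  also have "\<dots> = (\<Sum>d\<in>UNIV. \<Sum>j\<in>UNIV. \<Sum>c\<in>UNIV. f d j c)"
    by (rule sum.cong[OF refl], rule sum.swap)
  finally have "(\<Sum>c\<in>UNIV. \<Sum>d\<in>UNIV. \<Sum>j\<in>UNIV. w c * w d * w j * X d j c) = ?S"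
    unfolding S .
  moreover have "(\<Sum>c\<in>UNIV. \<Sum>d\<in>UNIV. \<Sum>j\<in>UNIV. w c * w d * w j * X c d j) = ?S"
    unfolding S f_def ..
  moreover have "?S + (\<Sum>c\<in>UNIV. \<Sum>d\<in>UNIV. \<Sum>j\<in>UNIV. w c * w d * w j * X d j c)
      + (\<Sum>c\<in>UNIV. \<Sum>d\<in>UNIV. \<Sum>j\<in>UNIV. w c * w d * w j * X c d j)
      = (\<Sum>c\<in>UNIV. \<Sum>d\<in>UNIV. \<Sum>j\<in>UNIV. w c * w d * w j * (X j c d + X d j c + X c d j))"
    by (simp add: sum.distrib algebra_simps)
  ultimately show ?thesis using assms by simp
qed

lemma tensors_at_eq_zero:
  "t \<in> tensors_at A p x \<Longrightarrow> c \<notin> charts_at A x \<or> length J \<noteq> p \<Longrightarrow> t c J = 0"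
  unfolding tensors_at_def by blast

lemma normal2_power_eq_zero:
  "w \<in> normal2_power A m x \<Longrightarrow> c \<notin> charts_at A x \<or> length K \<noteq> 4 * m \<Longrightarrow> w c K = 0"
proof (induction m arbitrary: w K)
  case 0
  then show ?case using tensors_at_eq_zero[of w A 0 x c K] by simp
next
  case (Suc m)
  then obtain N v u where w: "w = (\<lambda>c K. \<Sum>i<(N::nat). v i c (take 4 K) * u i c (drop 4 K))"
    and vu: "\<And>i. i < N \<Longrightarrow> v i \<in> normal2 A x \<and> u i \<in> normal2_power A m x"
    by (auto simp: tensor_product_def)
  have "v i c (take 4 K) * u i c (drop 4 K) = 0" if "i < N" for i
  proof (cases "c \<in> charts_at A x \<and> length (take 4 K) = 4")
    case True
    then have "u i c (drop 4 K) = 0" using Suc.prems(2) vu[OF that] by (intro Suc.IH) auto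
    then show ?thesis by simp
  next
    case False
    then have "v i c (take 4 K) = 0"
      using vu[OF that] by (intro tensors_at_eq_zero[of _ A 4 x]) (auto simp: normal2_def)
    then show ?thesis by simp
  qed
  then show ?case unfolding w by (intro sum.neutral) auto
qed

text \<open>The pair symmetry arises as for curvature tensors. Symmetry in the last two indices
  turns the six-term identity into twice a cyclic one; adding the cyclic identities headed by
  \<open>a\<close> and \<open>b\<close> and subtracting those headed by \<open>c\<close> and
  \<open>d\<close> leaves \<open>2 * (t \<phi> [a,b,c,d] - t \<phi> [c,d,a,b]) = 0\<close>.\<close>

lemma normal2_symmetries:
  assumes "t \<in> normal2 A x" "\<phi> \<in> charts_at A x"
  shows "t \<phi> [a,b,c,d] = t \<phi> [b,a,c,d]" "t \<phi> [a,b,c,d] = t \<phi> [a,b,d,c]"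
    and "t \<phi> [a,b,c,d] = t \<phi> [c,d,a,b]"
proof -
  have s: "t \<phi> [a,b,c,d] = t \<phi> [b,a,c,d]" "t \<phi> [a,b,c,d] = t \<phi> [a,b,d,c]"
    "t \<phi> [a,b,c,d] + t \<phi> [a,c,d,b] + t \<phi> [a,d,b,c]
          + t \<phi> [a,b,d,c] + t \<phi> [a,c,b,d] + t \<phi> [a,d,c,b] = 0" for a b c d
    using conjunct2[OF assms(1)[unfolded normal2_def mem_Collect_eq], rule_format, OF assms(2), of a b c d]
    by blast+
  show "t \<phi> [a,b,c,d] = t \<phi> [b,a,c,d]" "t \<phi> [a,b,c,d] = t \<phi> [a,b,d,c]" by (fact s)+
  have cyc: "t \<phi> [a,b,c,d] + t \<phi> [a,c,b,d] + t \<phi> [a,d,b,c] = 0" for a b c d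
    using s(3)[of a b c d] s(2)[of a b c d] s(2)[of a c b d] s(2)[of a d b c] by linarith
  show "t \<phi> [a,b,c,d] = t \<phi> [c,d,a,b]"
    using cyc[of a b c d] cyc[of b a c d] cyc[of c a b d] cyc[of d a b c]
      s(1)[of b a c d] s(1)[of c a b d] s(1)[of d a b c] s(1)[of c b a d] s(1)[of d b a c] s(1)[of d c a b]
    by linarith
qed

lemma Div_eq_zero:
  fixes A :: "('x, 'n::finite) chart set"
  assumes "p \<ge> 1" "m \<ge> 1" "CARD('n) \<le> 2 * m"
  shows "Div A p m x = {\<lambda>_ _. 0}"
proof
  show "{\<lambda>_ _. 0} \<subseteq> Div A p m x"
    unfolding Div_def tensor_product_def by (auto intro!: exI[of _ "0::nat"])
  show "Div A p m x \<subseteq> {\<lambda>_ _. 0}"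
  proof
    fix t assume t: "t \<in> Div A p m x"
    then obtain N v w where t_eq: "t = (\<lambda>c K. \<Sum>i<(N::nat). v i c (take p K) * w i c (drop p K))"
      and v: "\<And>i. i < N \<Longrightarrow> v i \<in> tensors_at A p x"
      and w: "\<And>i. i < N \<Longrightarrow> w i \<in> normal2_sym A m x"
      by (auto simp: Div_def tensor_product_def)
    have wz: "w i c K = 0" if "i < N" "c \<notin> charts_at A x \<or> length K \<noteq> 4 * m" for i c K
      using normal2_power_eq_zero[of "w i" A m x c K] w[OF that(1)] that(2) by (auto simp: normal2_sym_def)
    have zero: "t c K = 0" if cK: "c \<notin> charts_at A x \<or> length K \<noteq> p + 4 * m" for c K
    proof -
      have "v i c (take p K) * w i c (drop p K) = 0" if i: "i < N" for i
      proof (cases "c \<in> charts_at A x \<and> length (take p K) = p")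
        case True
        then have "length (drop p K) \<noteq> 4 * m" using cK by (auto simp: min_def split: if_splits)
        then show ?thesis using wz[OF i] by simp
      next
        case False
        then have "v i c (take p K) = 0" by (intro tensors_at_eq_zero[OF v[OF i]]) blast
        then show ?thesis by simp
      qed
      then show ?thesis unfolding t_eq by (intro sum.neutral) auto
    qed
    have "t c K = 0" if c: "c \<in> charts_at A x" and K: "length K = p + 4 * m" for c K
    proof -
      \<comment> \<open>The first \<open>p - 1\<close> indices stay fixed; from here on only the
        \<open>p\<close>-th index and the blocks vary.\<close>
      define J j where "J = take (p - 1) K" and "j = K ! (p - 1)"
      have K_eq: "K = J @ [j] @ drop p K"
        using K assms(1) id_take_nth_drop[of "p - 1" K] unfolding J_def j_def by simp
      have J: "length J = p - 1" using K by (simp add: J_def)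
      have tJ: "t c (J @ [j] @ L) = (\<Sum>i<N. v i c (J @ [j]) * w i c L)" for j L
        using J assms(1) unfolding t_eq by simp
      \<comment> \<open>Symmetry of the power of N^2 brings a whole block to the front. The
        divisibility conditions ensure that both remainders split into blocks.\<close>
      have perm: "t c (J @ [j] @ Q @ B @ R) = t c (J @ [j] @ B @ Q @ R)"
        if QR: "4 dvd length Q" "length B = 4" "4 dvd length R" for Q B R and j :: 'n
      proof -
        have blocks: "\<exists>Qs. Q = concat Qs \<and> (\<forall>B\<in>set Qs. length B = 4)" if "4 dvd length Q" for Q :: "'n list"
        proof -
          obtain k where "length Q = 4 * k" using \<open>4 dvd length Q\<close> by blast
          then show ?thesis
          proof (induction k arbitrary: Q)
            case 0
            then show ?case by (intro exI[of _ "[]"]) simp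
          next
            case (Suc k)
            then have "length (drop 4 Q) = 4 * k" by simp
            from Suc.IH[OF this] obtain Qs where Qs: "drop 4 Q = concat Qs" "\<forall>B\<in>set Qs. length B = 4"
              by blast
            have "Q = concat (take 4 Q # Qs)" using append_take_drop_id[of 4 Q] Qs(1) by simp
            moreover have "\<forall>B\<in>set (take 4 Q # Qs). length B = 4" using Qs(2) Suc.prems by simp
            ultimately show ?case by blast
          qed
        qed
        obtain Qs Rs where Q: "Q = concat Qs" "\<forall>B\<in>set Qs. length B = 4"
          and R: "R = concat Rs" "\<forall>B\<in>set Rs. length B = 4"
          using blocks[OF QR(1)] blocks[OF QR(3)] by blast
        have "w i c (concat (Qs @ [B] @ Rs)) = w i c (concat ([B] @ Qs @ Rs))" if "i < N" for i
        proof -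
          have "\<forall>B'\<in>set (Qs @ [B] @ Rs). length B' = 4" "mset (Qs @ [B] @ Rs) = mset ([B] @ Qs @ Rs)"
            using Q R \<open>length B = 4\<close> by auto
          then show ?thesis
            using w[OF that] c unfolding normal2_sym_def by blast
        qed
        then show ?thesis unfolding tJ Q(1) R(1) by simp
      qed
      \<comment> \<open>\<open>normal2_power\<close> exhibits only its first factor as an element of
        N^2, so the symmetries are read off in the first block; \<open>perm\<close> carries them to
        the others.\<close>
      have sym: "t c (J @ [j] @ [a,b,c',d] @ R) = t c (J @ [j] @ [b,a,c',d] @ R)"
        "t c (J @ [j] @ [a,b,c',d] @ R) = t c (J @ [j] @ [a,b,d,c'] @ R)"
        "t c (J @ [j] @ [a,b,c',d] @ R) = t c (J @ [j] @ [c',d,a,b] @ R)" for j a b c' d R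
      proof -
        obtain m' where m': "m = Suc m'" using assms(2) by (cases m) auto
        have W: "w i c ([a,b,c',d] @ R) = w i c ([b,a,c',d] @ R)
            \<and> w i c ([a,b,c',d] @ R) = w i c ([a,b,d,c'] @ R)
            \<and> w i c ([a,b,c',d] @ R) = w i c ([c',d,a,b] @ R)" if "i < N" for i
        proof -
          have "w i \<in> tensor_product 4 (normal2 A x) (normal2_power A m' x)"
            using w[OF that] by (simp add: normal2_sym_def m')
          then obtain N' v' u' where w_eq: "w i = (\<lambda>c K. \<Sum>i<(N'::nat). v' i c (take 4 K) * u' i c (drop 4 K))"
            and v': "\<And>i. i < N' \<Longrightarrow> v' i \<in> normal2 A x"
            by (auto simp: tensor_product_def)
          show ?thesis
            unfolding w_eq using normal2_symmetries[OF v' c]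
            by (intro conjI sum.cong) (auto simp: numeral_eq_Suc)
        qed
        show "t c (J @ [j] @ [a,b,c',d] @ R) = t c (J @ [j] @ [b,a,c',d] @ R)"
          "t c (J @ [j] @ [a,b,c',d] @ R) = t c (J @ [j] @ [a,b,d,c'] @ R)"
          "t c (J @ [j] @ [a,b,c',d] @ R) = t c (J @ [j] @ [c',d,a,b] @ R)"
          unfolding tJ by (rule sum.cong[OF refl], use W in \<open>metis lessThan_iff\<close>)+
      qed
      have cyc: "t c (J @ [j] @ [a,b,c',d] @ R) + t c (J @ [d] @ [a,b,j,c'] @ R)
            + t c (J @ [c'] @ [a,b,d,j] @ R) = 0" for j a b c' d R
        using t c J unfolding Div_def by blast
      define F where "F L = (\<chi> j. t c (J @ [j] @ L))" for L
      have F_nth: "F L $ j = t c (J @ [j] @ L)" for L j by (simp add: F_def)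
      \<comment> \<open>The block properties quantify over remainders \<open>R\<close> of every
        length; where no decomposition into \<open>m\<close> blocks exists, the zero convention for
        components settles them.\<close>
      have F_zero: "F L = 0" if "length L \<noteq> 4 * m" for L
        using zero[of c] J assms(1) that by (simp add: vec_eq_iff F_nth)
      have F_perm: "F (Q @ B @ R) = F (B @ Q @ R)" if "4 dvd length Q" "length B = 4" for Q B R
      proof (cases "4 dvd length R")
        case True
        then show ?thesis using perm that by (simp add: vec_eq_iff F_nth)
      next
        case False
        have "length Q + 4 + length R \<noteq> 4 * m" using False that(1) by presburger
        then have "length (Q @ B @ R) \<noteq> 4 * m" "length (B @ Q @ R) \<noteq> 4 * m"
          using that(2) by simp_all
        from F_zero[OF this(1)] F_zero[OF this(2)] show ?thesis by (simp only:)
      qed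
      have "block_symmetric F"
        unfolding block_symmetric_def
      proof (intro allI impI conjI)
        fix Q R :: "'n list" and a b c' d assume Q: "4 dvd length Q"
        show "F (Q @ [a,b,c',d] @ R) = F (Q @ [b,a,c',d] @ R)"
          using F_perm[OF Q, of "[a,b,c',d]" R] F_perm[OF Q, of "[b,a,c',d]" R] sym(1)
          by (simp add: vec_eq_iff F_nth)
        show "F (Q @ [a,b,c',d] @ R) = F (Q @ [a,b,d,c'] @ R)"
          using F_perm[OF Q, of "[a,b,c',d]" R] F_perm[OF Q, of "[a,b,d,c']" R] sym(2)
          by (simp add: vec_eq_iff F_nth)
      qed
      moreover have "block_annihilated F"
        unfolding block_annihilated_def
      proof (intro allI impI)
        fix Q R :: "'n list" and u y :: "real^'n" assume Q: "4 dvd length Q"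
        let ?X = "\<lambda>j a b c' d. t c (J @ [j] @ [a,b,c',d] @ Q @ R)"
        \<comment> \<open>Contracting \<open>c'\<close>, \<open>d\<close> and the free index with
          the same vector \<open>y\<close> turns the cyclic identity of \<open>Div\<close> into a
          vanishing sum.\<close>
        have second: "(\<Sum>q\<in>UNIV. coef u y q * (y \<bullet> F (blk q @ Q @ R))) = 0" for u y :: "real^'n"
        proof -
          have "(\<Sum>q\<in>UNIV. coef u y q * (y \<bullet> F (blk q @ Q @ R)))
            = (\<Sum>a\<in>UNIV. \<Sum>b\<in>UNIV. u$a * u$b * (\<Sum>c'\<in>UNIV. \<Sum>d\<in>UNIV. \<Sum>j\<in>UNIV. y$c' * y$d * y$j * ?X j a b c' d))"
            unfolding sum_quadruples inner_vec_def F_nth coef_def blk_def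
            by (simp add: sum_distrib_left algebra_simps)
          then show ?thesis
            using cyclic_sum_zero[of "\<lambda>j c' d. ?X j _ _ c' d" "($) y"] cyc by simp
        qed
        \<comment> \<open>Pair symmetry exchanges \<open>u\<close> and \<open>y\<close>, which
          reduces annihilation by \<open>u\<close> to the case just treated.\<close>
        have "(\<Sum>q\<in>UNIV. coef u y q * (u \<bullet> F (blk q @ Q @ R))) = (\<Sum>q\<in>UNIV. coef y u q * (u \<bullet> F (blk q @ Q @ R)))"
          by (rule sum.reindex_bij_witness[of _ "\<lambda>(a, b, c, d). (c, d, a, b)" "\<lambda>(a, b, c, d). (c, d, a, b)"])
            (use sym(3) in \<open>auto simp: coef_def blk_def vec_eq_iff F_nth inner_vec_def\<close>)
        then show "(\<Sum>q\<in>UNIV. coef u y q * (u \<bullet> F (Q @ blk q @ R))) = 0 \<and>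
          (\<Sum>q\<in>UNIV. coef u y q * (y \<bullet> F (Q @ blk q @ R))) = 0"
          unfolding F_perm[OF Q length_blk] by (simp add: second)
      qed
      ultimately have "F (drop p K) = 0"
        using block_annihilated_zero[OF _ _ assms(3)] K by simp
      then show "t c K = 0" using K_eq F_nth[of "drop p K" j] by simp
    qed
    then have "t = (\<lambda>_ _. 0)" using zero by (intro ext) blast
    then show "t \<in> {\<lambda>_ _. 0}" by simp
  qed
qed

section \<open>Signature\<close>

lemma inner_transpose: "x \<bullet> (transpose M *v y) = (M *v x) \<bullet> y"
  for M :: "real^'n::finite^'m::finite"
  by (metis dot_lmul_matrix inner_commute transpose_matrix_vector)

text \<open>The images of the two definite subspaces under the inverse \<open>N\<close> of
  \<open>M\<close> are definite for the transformed matrix and have the same dimensions.\<close>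

lemma has_signature_congruence:
  fixes G M N :: "real^'n::finite^'n"
  assumes "has_signature q r G" "M ** N = mat 1" "N ** M = mat 1"
  shows "has_signature q r (transpose M ** G ** M)"
proof -
  obtain P L where PL: "subspace P" "subspace L" "dim P = q" "dim L = r"
    "\<forall>v\<in>P. v \<noteq> 0 \<longrightarrow> v \<bullet> (G *v v) > 0" "\<forall>v\<in>L. v \<noteq> 0 \<longrightarrow> v \<bullet> (G *v v) < 0"
    and G: "transpose G = G" "q + r = CARD('n)"
    using assms(1) unfolding has_signature_def by blast
  have lin: "linear ((*v) N)" by (rule matrix_vector_mul_linear)
  have MN: "M *v (N *v v) = v" for v using assms(2) by (simp add: matrix_vector_mul_assoc)
  have inj: "inj_on ((*v) N) S" for S using MN by (metis inj_on_inverseI)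
  have val: "(N *v v) \<bullet> ((transpose M ** G ** M) *v (N *v v)) = v \<bullet> (G *v v)" for v
  proof -
    have "(transpose M ** G ** M) *v (N *v v) = transpose M *v (G *v (M *v (N *v v)))"
      by (simp only: matrix_vector_mul_assoc matrix_mul_assoc)
    then show ?thesis by (simp only: inner_transpose MN)
  qed
  have nz: "N *v v \<noteq> 0 \<longleftrightarrow> v \<noteq> 0" for v using MN by (metis matrix_vector_mult_0_right)
  show ?thesis
    unfolding has_signature_def
  proof (intro conjI exI)
    show "transpose (transpose M ** G ** M) = transpose M ** G ** M"
      by (simp add: matrix_transpose_mul G(1) matrix_mul_assoc)
    show "subspace ((*v) N ` P)" "subspace ((*v) N ` L)"
      using linear_subspace_image[OF lin] PL by auto
    show "dim ((*v) N ` P) = q" "dim ((*v) N ` L) = r"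
      using dim_image_eq[OF lin inj] PL by auto
    show "\<forall>v\<in>(*v) N ` P. v \<noteq> 0 \<longrightarrow> v \<bullet> ((transpose M ** G ** M) *v v) > 0"
      "\<forall>v\<in>(*v) N ` L. v \<noteq> 0 \<longrightarrow> v \<bullet> ((transpose M ** G ** M) *v v) < 0"
      using PL(5,6) by (auto simp: val nz)
  qed (rule G(2))
qed

text \<open>The definite subspaces meet in 0, so they span the space by dimension. If
  \<open>x + y\<close> lies in the kernel, then by symmetry of \<open>G\<close> a nonnegative number
  \<open>x \<bullet> (G *v x)\<close> equals a nonpositive number
  \<open>y \<bullet> (G *v y)\<close>, so both vectors are 0.\<close>

lemma has_signature_surj:
  fixes G :: "real^'n::finite^'n"
  assumes "has_signature q r G"
  obtains w where "G *v w = v"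
proof -
  obtain P L where PL: "subspace P" "subspace L" "dim P = q" "dim L = r"
    "\<forall>v\<in>P. v \<noteq> 0 \<longrightarrow> v \<bullet> (G *v v) > 0" "\<forall>v\<in>L. v \<noteq> 0 \<longrightarrow> v \<bullet> (G *v v) < 0"
    and G: "transpose G = G" "q + r = CARD('n)"
    using assms(1) unfolding has_signature_def by blast
  have "P \<inter> L = {0}"
  proof -
    have "x = 0" if "x \<in> P" "x \<in> L" for x using PL(5,6) that less_asym by metis
    then show ?thesis using subspace_0[OF PL(1)] subspace_0[OF PL(2)] by blast
  qed
  then have d0: "dim (P \<inter> L) = 0" by simp
  have "dim {x + y |x y. x \<in> P \<and> y \<in> L} = dim (UNIV :: (real^'n) set)"
    using dim_sums_Int[OF PL(1,2)] PL(3,4) G(2) unfolding d0 by (simp add: dim_UNIV)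
  moreover have "span {x + y |x y. x \<in> P \<and> y \<in> L} = {x + y |x y. x \<in> P \<and> y \<in> L}"
    using subspace_sums[OF PL(1,2)] by (rule span_eq_iff[THEN iffD2])
  moreover have "span {x + y |x y. x \<in> P \<and> y \<in> L} = UNIV"
    using dim_eq_full[of "{x + y |x y. x \<in> P \<and> y \<in> L}"] calculation(1) by (simp add: dim_UNIV)
  ultimately have UN: "{x + y |x y. x \<in> P \<and> y \<in> L} = UNIV" by (simp only:)
  have "v = 0" if "G *v v = 0" for v
  proof -
    obtain x y where v: "v = x + y" "x \<in> P" "y \<in> L" using UN by blast
    have 0: "G *v x = - (G *v y)"
      using that by (simp add: v(1) matrix_vector_right_distrib eq_neg_iff_add_eq_0)
    have sym: "x \<bullet> (G *v y) = y \<bullet> (G *v x)"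
      using inner_transpose[of x G y] by (simp add: G(1) inner_commute)
    have "x \<bullet> (G *v x) = y \<bullet> (G *v y)"
      using sym unfolding 0 by (simp add: inner_commute)
    then have "x = 0 \<and> y = 0"
      using PL(5,6) v(2,3) by (metis inner_zero_left less_asym)
    then show ?thesis by (simp add: v(1))
  qed
  then have "\<exists>B. B ** G = mat 1" using matrix_left_invertible_ker by blast
  then obtain B where "G ** B = mat 1" using matrix_left_right_inverse by blast
  then have "G *v (B *v v) = v" by (simp add: matrix_vector_mul_assoc)
  then show ?thesis using that by blast
qed

text \<open>On the compact unit sphere of \<open>P\<close> the quadratic form has a positive lower
  bound \<open>m\<close>; a perturbation of norm below \<open>m / K\<close> changes it there by less
  than \<open>m\<close>.\<close>

lemma definite_on_subspace_open:
  fixes G0 :: "real^'n::finite^'n"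
  assumes "subspace P" "\<forall>v\<in>P. v \<noteq> 0 \<longrightarrow> v \<bullet> (G0 *v v) > 0"
  obtains e where "e > 0" "\<And>G v. \<lbrakk>norm (G - G0) < e; v \<in> P; v \<noteq> 0\<rbrakk> \<Longrightarrow> v \<bullet> (G *v v) > 0"
proof -
  have bb: "bounded_bilinear ((*v) :: real^'n^'n \<Rightarrow> _)"
    unfolding bilinear_conv_bounded_bilinear[symmetric] bilinear_def
    by (auto intro!: linearI simp: matrix_vector_mult_add_rdistrib matrix_vector_right_distrib
        scaleR_matrix_vector_assoc matrix_vector_mult_scaleR)
  obtain K where K: "K > 0" "\<And>(H :: real^'n^'n) v. norm (H *v v) \<le> norm H * norm v * K"
    using bounded_bilinear.pos_bounded[OF bb] by blast
  have "\<exists>m>0. \<forall>v\<in>P \<inter> sphere 0 1. m \<le> v \<bullet> (G0 *v v)"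
  proof (cases "P \<inter> sphere 0 1 = {}")
    case True
    then show ?thesis by (intro exI[of _ 1]) auto
  next
    case False
    have "compact (P \<inter> sphere 0 1)"
      using closed_subspace[OF assms(1)] by (simp add: closed_Int_compact)
    moreover have "continuous_on (P \<inter> sphere 0 1) (\<lambda>v. v \<bullet> (G0 *v v))"
      by (intro continuous_intros)
    ultimately obtain v0 where "v0 \<in> P \<inter> sphere 0 1" "\<forall>v\<in>P \<inter> sphere 0 1. v0 \<bullet> (G0 *v v0) \<le> v \<bullet> (G0 *v v)"
      using continuous_attains_inf[OF _ False] by blast
    then show ?thesis using assms(2) by (intro exI[of _ "v0 \<bullet> (G0 *v v0)"]) auto
  qed
  then obtain m where m: "m > 0" "\<And>v. v \<in> P \<Longrightarrow> norm v = 1 \<Longrightarrow> m \<le> v \<bullet> (G0 *v v)"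
    by auto
  show ?thesis
  proof (rule that[of "m / K"])
    show "m / K > 0" using m K by simp
    fix G :: "real^'n^'n" and v assume G: "norm (G - G0) < m / K" and v: "v \<in> P" "v \<noteq> 0"
    define w where "w = (1 / norm v) *\<^sub>R v"
    have w: "w \<in> P" "norm w = 1" "v = norm v *\<^sub>R w"
      using v assms(1) by (auto simp: w_def subspace_scale)
    have "\<bar>w \<bullet> ((G - G0) *v w)\<bar> \<le> norm w * norm ((G - G0) *v w)" by (rule Cauchy_Schwarz_ineq2)
    also have "\<dots> \<le> norm (G - G0) * K" using K(2)[of "G - G0" w] w(2) by simp
    also have "\<dots> < m" using G K(1) by (simp add: pos_less_divide_eq)
    finally have "w \<bullet> (G *v w) > 0"
      using m(2)[OF w(1,2)] by (simp add: matrix_vector_mult_diff_rdistrib inner_diff_right)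
    moreover have "v \<bullet> (G *v v) = (norm v)\<^sup>2 * (w \<bullet> (G *v w))"
      by (subst (1 2) w(3)) (simp add: matrix_vector_mult_scaleR power2_eq_square)
    ultimately show "v \<bullet> (G *v v) > 0" using v(2) by simp
  qed
qed

lemma has_signature_open:
  fixes G0 :: "real^'n::finite^'n"
  assumes "has_signature q r G0"
  obtains e where "e > 0" "\<And>G. \<lbrakk>norm (G - G0) < e; transpose G = G\<rbrakk> \<Longrightarrow> has_signature q r G"
proof -
  obtain P L where PL: "subspace P" "subspace L" "dim P = q" "dim L = r"
    "\<forall>v\<in>P. v \<noteq> 0 \<longrightarrow> v \<bullet> (G0 *v v) > 0" "\<forall>v\<in>L. v \<noteq> 0 \<longrightarrow> v \<bullet> (G0 *v v) < 0"
    and G: "transpose G0 = G0" "q + r = CARD('n)"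
    using assms(1) unfolding has_signature_def by blast
  have neg: "(- H) *v v = - (H *v v)" for H :: "real^'n^'n" and v
    using scaleR_matrix_vector_assoc[of "-1" H v] by simp
  obtain e1 where e1: "e1 > 0" "\<And>G v. \<lbrakk>norm (G - G0) < e1; v \<in> P; v \<noteq> 0\<rbrakk> \<Longrightarrow> v \<bullet> (G *v v) > 0"
    using definite_on_subspace_open[OF PL(1,5)] by blast
  have "\<forall>v\<in>L. v \<noteq> 0 \<longrightarrow> v \<bullet> ((- G0) *v v) > 0" using PL(6) by (simp add: neg)
  then obtain e2 where e2: "e2 > 0" "\<And>G v. \<lbrakk>norm (G - (- G0)) < e2; v \<in> L; v \<noteq> 0\<rbrakk> \<Longrightarrow> v \<bullet> (G *v v) > 0"
    using definite_on_subspace_open[OF PL(2)] by blast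
  show ?thesis
  proof (rule that[of "min e1 e2"])
    show "min e1 e2 > 0" using e1 e2 by simp
    fix G assume n: "norm (G - G0) < min e1 e2" and t: "transpose G = G"
    have "norm (- G - (- G0)) < e2" using n norm_minus_commute[of G G0] by simp
    then have "v \<bullet> (G *v v) < 0" if "v \<in> L" "v \<noteq> 0" for v
      using e2(2)[of "- G" v] that by (simp add: neg)
    moreover have "v \<bullet> (G *v v) > 0" if "v \<in> P" "v \<noteq> 0" for v
      using e1(2)[of G v] that n by simp
    ultimately show "has_signature q r G"
      unfolding has_signature_def using t G(2) PL(1-4) by blast
  qed
qed

section \<open>Charts and Jacobians\<close>

lemma jacobian_eqI: "(f has_derivative (\<lambda>h. M *v h)) (at x) \<Longrightarrow> jacobian f (at x) = M"
  for f :: "real^'n::finite \<Rightarrow> real^'m::finite"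
  unfolding jacobian_def using frechet_derivative_at[of f "\<lambda>h. M *v h" x]
  by (metis matrix_of_matrix_vector_mul)

lemma jacobian_compose:
  fixes f :: "real^'n::finite \<Rightarrow> real^'m::finite" and g :: "real^'m \<Rightarrow> real^'k::finite"
  assumes "f differentiable (at x)" "g differentiable (at (f x))"
  shows "jacobian (\<lambda>x. g (f x)) (at x) = jacobian g (at (f x)) ** jacobian f (at x)"
  using has_derivative_compose[OF assms[unfolded jacobian_works]]
  by (intro jacobian_eqI) (simp add: matrix_vector_mul_assoc)

lemma jacobian_cong:
  assumes "f differentiable (at x)" "open S" "x \<in> S" "\<And>y. y \<in> S \<Longrightarrow> f y = g y"
  shows "jacobian f (at x) = jacobian g (at x)"
  unfolding jacobian_def by (subst frechet_derivative_transform_within_open[OF assms]) auto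

lemma jacobian_ident: "jacobian (\<lambda>x. x) (at (x :: real^'n::finite)) = mat 1"
  by (rule jacobian_eqI) (simp add: has_derivative_ident)

locale atlas =
  fixes A :: "('x::topological_space, 'n::finite) chart set"
  assumes smooth_atlas: "smooth_atlas A"
begin

lemma open_dom: "c \<in> A \<Longrightarrow> open (fst c)"
  and open_img: "c \<in> A \<Longrightarrow> open (snd c ` fst c)"
  and chart_homeo: "c \<in> A \<Longrightarrow> homeomorphism (fst c) (snd c ` fst c) (snd c) (cinv c)"
  using smooth_atlas unfolding smooth_atlas_def by auto

lemma cinv_chart: "c \<in> A \<Longrightarrow> x \<in> fst c \<Longrightarrow> cinv c (snd c x) = x"
  using chart_homeo homeomorphism_apply1 by blast

lemma chart_cinv: "y \<in> snd c ` fst c \<Longrightarrow> snd c (cinv c y) = y"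
  by (rule f_inv_into_f)

lemma cinv_in: "y \<in> snd c ` fst c \<Longrightarrow> cinv c y \<in> fst c"
  by (rule inv_into_into)

lemma cinv_image: "c \<in> A \<Longrightarrow> S \<subseteq> fst c \<Longrightarrow> y \<in> snd c ` S \<Longrightarrow> cinv c y \<in> S"
  using cinv_chart by fastforce

lemma continuous_chart: "c \<in> A \<Longrightarrow> continuous_on (fst c) (snd c)"
  and continuous_cinv: "c \<in> A \<Longrightarrow> continuous_on (snd c ` fst c) (cinv c)"
  using chart_homeo homeomorphism_def by blast+

lemma open_chart_image:
  assumes "c \<in> A" "open U"
  shows "open (snd c ` (U \<inter> fst c))"
proof -
  have "openin (top_of_set (fst c)) (U \<inter> fst c)"
    using assms(2) unfolding openin_open by blast
  then have "openin (top_of_set (snd c ` fst c)) (snd c ` (U \<inter> fst c))"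
    using homeomorphism_imp_open_map[OF chart_homeo[OF assms(1)]] by blast
  then show ?thesis using openin_open_trans open_img[OF assms(1)] by blast
qed

lemma open_cinv_image:
  assumes "c \<in> A" "open W" "W \<subseteq> snd c ` fst c"
  shows "open (cinv c ` W)"
proof -
  have "openin (top_of_set (snd c ` fst c)) W"
    using assms by (simp add: open_subset)
  then have "openin (top_of_set (fst c)) (cinv c ` W)"
    using homeomorphism_imp_open_map[OF homeomorphism_symD[OF chart_homeo[OF assms(1)]]] by blast
  then show ?thesis using openin_open_trans open_dom[OF assms(1)] by blast
qed

lemma charts_atD: "c \<in> charts_at A x \<Longrightarrow> c \<in> A" "c \<in> charts_at A x \<Longrightarrow> x \<in> fst c"
  by (auto simp: charts_at_def)

lemma ex_chart: "\<exists>c. c \<in> charts_at A x"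
proof -
  have "x \<in> (\<Union>c\<in>A. fst c)" using smooth_atlas unfolding smooth_atlas_def by auto
  then show ?thesis by (auto simp: charts_at_def)
qed

lemma some_chart: "some_chart A x \<in> charts_at A x"
  unfolding some_chart_def using ex_chart by (rule someI_ex)

lemma Cinf_transition:
  assumes "c \<in> A" "d \<in> A"
  shows "Cinf (snd c ` (fst c \<inter> fst d)) (\<lambda>y. snd d (cinv c y))"
proof -
  have "smooth_on (snd c ` (fst c \<inter> fst d)) (snd d \<circ> cinv c)"
    using smooth_atlas assms unfolding smooth_atlas_def by blast
  moreover have "open (snd c ` (fst c \<inter> fst d))"
    using open_chart_image[OF assms(1) open_dom[OF assms(2)]] by (simp add: Int_commute)
  ultimately show ?thesis using smooth_on_open[of _ "snd d \<circ> cinv c"] by (simp add: comp_def)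
qed

lemma open_overlap: "c \<in> A \<Longrightarrow> d \<in> A \<Longrightarrow> open (snd c ` (fst c \<inter> fst d))"
  using open_chart_image[OF _ open_dom, of c d] by (simp add: Int_commute)

lemma jac_eq: "jac c d f x = jacobian (\<lambda>y. snd d (f (cinv c y))) (at (snd c x))"
  by (simp add: jac_def comp_def)

lemma jac_id_eq: "jac c d id x = jacobian (\<lambda>y. snd d (cinv c y)) (at (snd c x))"
  by (simp add: jac_eq)

lemma transition_differentiable:
  assumes "c \<in> A" "d \<in> A" "x \<in> fst c" "x \<in> fst d"
  shows "(\<lambda>y. snd d (cinv c y)) differentiable (at (snd c x))"
  by (rule Cinf_differentiable[OF Cinf_transition[OF assms(1,2)] open_overlap[OF assms(1,2)]])
    (use assms in auto)

text \<open>Near the point \<open>f\<close> has to stay in the domain of the middle chart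
  \<open>d\<close>, since only there does \<open>cinv d\<close> undo \<open>snd d\<close>.\<close>

lemma jac_compose:
  assumes "c \<in> A" "d \<in> A" "x \<in> fst c" "open S" "snd c x \<in> S"
    and "\<And>y. y \<in> S \<Longrightarrow> f (cinv c y) \<in> fst d"
    and f: "(\<lambda>y. snd d (f (cinv c y))) differentiable (at (snd c x))"
    and g: "(\<lambda>y. snd e (g (cinv d y))) differentiable (at (snd d (f x)))"
  shows "jac c e (g \<circ> f) x = jac d e g (f x) ** jac c d f x"
proof -
  let ?f = "\<lambda>y. snd d (f (cinv c y))" and ?g = "\<lambda>y. snd e (g (cinv d y))"
  have x: "?f (snd c x) = snd d (f x)" by (simp add: cinv_chart assms(1,3))
  then have g': "?g differentiable (at (?f (snd c x)))" using g by simp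
  have "(\<lambda>y. ?g (?f y)) differentiable (at (snd c x))"
    using differentiable_compose[OF g' f] .
  then have "jacobian (\<lambda>y. ?g (?f y)) (at (snd c x)) = jacobian (\<lambda>y. snd e (g (f (cinv c y)))) (at (snd c x))"
    by (rule jacobian_cong[OF _ assms(4,5)]) (simp add: cinv_chart assms(2,6))
  then show ?thesis
    using jacobian_compose[OF f g'] by (simp add: jac_eq x)
qed

lemma jac_cocycle:
  assumes "c \<in> A" "d \<in> A" "e \<in> A" "x \<in> fst c" "x \<in> fst d" "x \<in> fst e"
  shows "jac c e id x = jac d e id x ** jac c d id x"
proof -
  have "jac c e (id \<circ> id) x = jac d e id (id x) ** jac c d id x"
  proof (rule jac_compose[where S = "snd c ` (fst c \<inter> fst d)"])
    show "id (cinv c y) \<in> fst d" if "y \<in> snd c ` (fst c \<inter> fst d)" for y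
      using that cinv_chart[OF assms(1)] by auto
  qed (use assms open_overlap transition_differentiable in auto)
  then show ?thesis by simp
qed

lemma jac_self:
  assumes "c \<in> A" "x \<in> fst c"
  shows "jac c c id x = mat 1"
proof -
  have "jacobian (\<lambda>y. y) (at (snd c x)) = jacobian (\<lambda>y. snd c (cinv c y)) (at (snd c x))"
  proof (rule jacobian_cong[of _ _ "snd c ` fst c"])
    show "y = snd c (cinv c y)" if "y \<in> snd c ` fst c" for y using chart_cinv[OF that] by simp
  qed (use assms open_img in auto)
  then show ?thesis by (simp add: jac_id_eq jacobian_ident)
qed

lemma jac_inverse:
  assumes "c \<in> A" "d \<in> A" "x \<in> fst c" "x \<in> fst d"
  shows "jac c d id x ** jac d c id x = mat 1"
  using jac_cocycle[of d c d x] jac_self[of d x] assms by simp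


section \<open>Metrics and jets in a chart\<close>

text \<open>The passage from a local matrix function to a metric, spread to the other charts by the
  transformation law; all test metrics below arise this way.\<close>

definition chart_metric :: "('x, 'n) chart \<Rightarrow> (real^'n \<Rightarrow> real^'n^'n) \<Rightarrow> ('x, 'n) metric" where
  "chart_metric c G x d = transpose (jac d c id x) ** G (snd c x) ** jac d c id x"

lemma local_rep_chart_metric:
  assumes "c \<in> A" "y \<in> snd c ` fst c"
  shows "local_rep (chart_metric c G) c y = G y"
  using assms by (simp add: local_rep_def chart_metric_def jac_self cinv_in chart_cinv transpose_mat)

lemma metric_on_chart_metric:
  assumes c: "c \<in> A" and W: "open W" "W \<subseteq> snd c ` fst c"
    and G: "Cinf W G" "\<And>y. y \<in> W \<Longrightarrow> has_signature q r (G y)"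
  shows "metric_on A q r (cinv c ` W) (chart_metric c G)"
  unfolding metric_on_def
proof (intro conjI ballI)
  let ?U = "cinv c ` W"
  have U: "x \<in> fst c" "snd c x \<in> W" if xU: "x \<in> ?U" for x
  proof -
    obtain y where "y \<in> W" "x = cinv c y" using xU by blast
    then show "x \<in> fst c" "snd c x \<in> W" using W(2) chart_cinv[of y c] cinv_in[of y c] by auto
  qed
  show oU: "open ?U" by (rule open_cinv_image[OF c W])
  show "has_signature q r (chart_metric c G x d)" if "x \<in> ?U" "d \<in> charts_at A x" for x d
    unfolding chart_metric_def
    by (rule has_signature_congruence[OF G(2), of _ _ "jac c d id x"])
      (use U[OF that(1)] charts_atD[OF that(2)] c jac_inverse in auto)
  show "chart_metric c G x d = transpose (jac d e id x) ** chart_metric c G x e ** jac d e id x"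
    if "x \<in> ?U" "d \<in> charts_at A x" "e \<in> charts_at A x" for x d e
  proof -
    have "jac d c id x = jac e c id x ** jac d e id x"
      using U[OF that(1)] charts_atD[OF that(2)] charts_atD[OF that(3)] c by (intro jac_cocycle) auto
    then show ?thesis
      unfolding chart_metric_def by (simp add: matrix_transpose_mul matrix_mul_assoc)
  qed
  show "smooth_on (snd d ` (?U \<inter> fst d)) (\<lambda>y. chart_metric c G (cinv d y) d)" if d: "d \<in> A" for d
  proof -
    let ?V = "snd d ` (?U \<inter> fst d)" and ?t = "\<lambda>y. snd c (cinv d y)"
    have V: "open ?V" by (rule open_chart_image[OF d oU])
    have "?V \<subseteq> snd d ` (fst d \<inter> fst c)" using U by auto
    then have t: "Cinf ?V ?t" using Cinf_subset[OF Cinf_transition[OF d c]] by blast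
    have "?t ` ?V \<subseteq> W" using U cinv_chart[OF d] by auto
    then have "Cinf ?V (\<lambda>y. G (?t y))" using Cinf_compose[OF V W(1) _ G(1) t] by blast
    then have "Cinf ?V (\<lambda>y. transpose (jacobian ?t (at y)) ** G (?t y) ** jacobian ?t (at y))"
      by (intro Cinf_matrix_mult Cinf_transpose Cinf_jacobian V t)
    then have "Cinf ?V (\<lambda>y. chart_metric c G (cinv d y) d)"
      by (rule Cinf_cong[OF V, rotated]) (auto simp: chart_metric_def jac_id_eq cinv_chart[OF d])
    then show ?thesis using smooth_on_open[OF V] by blast
  qed
qed

lemma Cinf_local_rep:
  "metric_on A q r U g \<Longrightarrow> c \<in> A \<Longrightarrow> Cinf (snd c ` (U \<inter> fst c)) (local_rep g c)"
  using smooth_on_open[OF open_chart_image] unfolding metric_on_def local_rep_def[abs_def] by blast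

lemma local_rep_transform:
  assumes "metric_on A q r U g" "c \<in> A" "d \<in> A" "y \<in> snd d ` (U \<inter> fst c \<inter> fst d)"
  shows "local_rep g d y = transpose (jacobian (\<lambda>y. snd c (cinv d y)) (at y))
    ** local_rep g c (snd c (cinv d y)) ** jacobian (\<lambda>y. snd c (cinv d y)) (at y)"
proof -
  obtain z where z: "z \<in> U" "z \<in> fst c" "z \<in> fst d" "y = snd d z" using assms(4) by auto
  then have "g z d = transpose (jac d c id z) ** g z c ** jac d c id z"
    using assms(1-3) unfolding metric_on_def charts_at_def by blast
  then show ?thesis using z assms(2,3) by (simp add: local_rep_def cinv_chart jac_id_eq)
qed

text \<open>Jets quantify over all charts, but one suffices: in another chart the difference of the
  metrics is composed with the transition map and multiplied by smooth Jacobians on both sides,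
  which does not lower its order of vanishing.\<close>

lemma jet_eqI:
  assumes g: "g \<in> metrics_near A q r x" and h: "h \<in> metrics_near A q r x" and c: "c \<in> charts_at A x"
    and van: "van (Suc k) (snd c x) (\<lambda>y. local_rep g c y - local_rep h c y)"
  shows "jet A q r k x g = jet A q r k x h"
proof -
  obtain U U' where U: "x \<in> U" "metric_on A q r U g" "x \<in> U'" "metric_on A q r U' h"
    using g h unfolding metrics_near_def by blast
  then have oU: "open U" "open U'" unfolding metric_on_def by auto
  note c' = charts_atD[OF c]
  have eq: "pds ks (local_rep g d) (snd d x) = pds ks (local_rep h d) (snd d x)"
    if d: "d \<in> charts_at A x" and ks: "length ks \<le> k" for d ks
  proof -
    note d' = charts_atD[OF d]
    let ?V = "snd d ` (U \<inter> U' \<inter> fst c \<inter> fst d)" and ?t = "\<lambda>y. snd c (cinv d y)"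
    let ?J = "\<lambda>y. jacobian ?t (at y)" and ?W = "snd c ` (U \<inter> U' \<inter> fst c)"
    have V: "open ?V" "snd d x \<in> ?V"
      using open_chart_image[OF d'(1), of "U \<inter> U' \<inter> fst c"] oU open_dom[OF c'(1)] U(1,3) c'(2) d'(2)
      by auto
    have W: "open ?W"
      using open_chart_image[OF c'(1), of "U \<inter> U'"] oU by auto
    have reps: "Cinf ?V (local_rep g d)" "Cinf ?V (local_rep h d)"
      by (rule Cinf_subset[OF Cinf_local_rep[OF U(2) d'(1)]], blast,
          rule Cinf_subset[OF Cinf_local_rep[OF U(4) d'(1)]], blast)
    have W': "Cinf ?W (\<lambda>y. local_rep g c y - local_rep h c y)"
      by (intro Cinf_diff W)
        (rule Cinf_subset[OF Cinf_local_rep[OF U(2) c'(1)]], blast,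
          rule Cinf_subset[OF Cinf_local_rep[OF U(4) c'(1)]], blast)
    have t: "Cinf ?V ?t"
      by (rule Cinf_subset[OF Cinf_transition[OF d'(1) c'(1)]]) auto
    have tW: "?t ` ?V \<subseteq> ?W" using cinv_chart[OF d'(1)] by auto
    have J: "Cinf ?V ?J" "Cinf ?V (\<lambda>y. transpose (?J y))"
      by (intro Cinf_transpose Cinf_jacobian V t)+
    have E: "Cinf ?V (\<lambda>y. local_rep g c (?t y) - local_rep h c (?t y))"
      by (rule Cinf_compose[OF V(1) W tW W' t])
    have "van (Suc k) (?t (snd d x)) (\<lambda>y. local_rep g c y - local_rep h c y)"
      using van cinv_chart[OF d'] by simp
    from van_compose[OF V W tW t W' this]
    have "van (Suc k) (snd d x) (\<lambda>y. local_rep g c (?t y) - local_rep h c (?t y))" .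
    from van_bilinear[OF bounded_bilinear_matrix_mult V J(2) E van.simps(1)[THEN iffD2] this]
    have "van (Suc k) (snd d x) (\<lambda>y. transpose (?J y) ** (local_rep g c (?t y) - local_rep h c (?t y)))"
      by simp
    from van_bilinear[OF bounded_bilinear_matrix_mult V Cinf_matrix_mult[OF V(1) J(2) E] J(1) this
        van.simps(1)[THEN iffD2]]
    have v: "van (Suc k) (snd d x) (\<lambda>y. transpose (?J y) ** (local_rep g c (?t y) - local_rep h c (?t y)) ** ?J y)"
      by simp
    have "van (Suc k) (snd d x) (\<lambda>y. local_rep g d y - local_rep h d y)"
    proof (rule van_cong[OF V _ _ v])
      show "Cinf ?V (\<lambda>y. transpose (?J y) ** (local_rep g c (?t y) - local_rep h c (?t y)) ** ?J y)"
        by (intro Cinf_matrix_mult V(1) J E)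
      show "transpose (?J y) ** (local_rep g c (?t y) - local_rep h c (?t y)) ** ?J y
          = local_rep g d y - local_rep h d y" if "y \<in> ?V" for y
      proof -
        have "y \<in> snd d ` (U \<inter> fst c \<inter> fst d)" "y \<in> snd d ` (U' \<inter> fst c \<inter> fst d)" using that by auto
        note local_rep_transform[OF U(2) c'(1) d'(1) this(1)] local_rep_transform[OF U(4) c'(1) d'(1) this(2)]
        then show ?thesis
          by (simp add: bounded_bilinear.diff_left[OF bounded_bilinear_matrix_mult]
              bounded_bilinear.diff_right[OF bounded_bilinear_matrix_mult])
      qed
    qed
    then show ?thesis using van_diff_iff_pds[OF V reps] ks by blast
  qed
  then show ?thesis unfolding jet_def by auto
qed

text \<open>Only \<open>h\<close> is assumed to be a metric near \<open>x\<close>, so a push-forward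
  can be compared with a chart metric without first being shown to be a metric.\<close>

lemma jet_cong:
  assumes h: "h \<in> metrics_near A q r x" and U: "open U" "x \<in> U"
    and eq: "\<And>y d. y \<in> U \<Longrightarrow> d \<in> charts_at A y \<Longrightarrow> g y d = h y d"
  shows "jet A q r k x g = jet A q r k x h"
proof -
  obtain U' where U': "x \<in> U'" "metric_on A q r U' h" using h unfolding metrics_near_def by blast
  have "pds ks (local_rep h d) (snd d x) = pds ks (local_rep g d) (snd d x)" if d: "d \<in> charts_at A x" for d ks
  proof (rule pds_cong[of "snd d ` ((U \<inter> U') \<inter> fst d)"])
    note d' = charts_atD[OF d]
    show "open (snd d ` ((U \<inter> U') \<inter> fst d))"
      using U U' by (intro open_chart_image[OF d'(1)]) (auto simp: metric_on_def)
    show "snd d x \<in> snd d ` ((U \<inter> U') \<inter> fst d)" using U U' d' by auto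
    show "Cinf (snd d ` ((U \<inter> U') \<inter> fst d)) (local_rep h d)"
      by (rule Cinf_subset[OF Cinf_local_rep[OF U'(2) d'(1)]]) auto
    show "local_rep h d y = local_rep g d y" if "y \<in> snd d ` ((U \<inter> U') \<inter> fst d)" for y
    proof -
      obtain z where z: "z \<in> U" "z \<in> fst d" "y = snd d z" using \<open>y \<in> _\<close> by auto
      then have "d \<in> charts_at A z" using d'(1) by (simp add: charts_at_def)
      then show ?thesis using eq[OF z(1)] z(2,3) cinv_chart[OF d'(1)] by (simp add: local_rep_def)
    qed
  qed
  then show ?thesis unfolding jet_def by auto
qed

lemma jet_eqD:
  assumes "jet A q r k x h = jet A q r k x g" "h \<in> metrics_near A q r x" "c \<in> charts_at A x" "length ks \<le> k"
  shows "pds ks (local_rep h c) (snd c x) = pds ks (local_rep g c) (snd c x)"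
  using assms unfolding jet_def by auto

end

section \<open>The fibre over a 1-jet\<close>

text \<open>The quadratic Taylor polynomial with a prescribed 2-jet at \<open>y0\<close>; its second
  derivatives are \<open>H\<close> when \<open>H\<close> is symmetric in the derivative
  indices.\<close>

definition taylor2 :: "real^'n::finite \<Rightarrow> real^'n^'n \<Rightarrow> real^'n^'n^'n \<Rightarrow> real^'n^'n^'n^'n \<Rightarrow> real^'n \<Rightarrow> real^'n^'n" where
  "taylor2 y0 G0 G1 H y = G0 + (\<Sum>k\<in>UNIV. (y - y0) $ k *\<^sub>R G1 $ k)
     + (1/2) *\<^sub>R (\<Sum>k\<in>UNIV. \<Sum>l\<in>UNIV. ((y - y0) $ k * (y - y0) $ l) *\<^sub>R H $ k $ l)"

lemma Cinf_nth_diff: "Cinf UNIV (\<lambda>y :: real^'n::finite. (y - y0) $ k)"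
  by (intro Cinf_vec_nth Cinf_diff Cinf_id Cinf_const open_UNIV)

lemma Cinf_taylor2: "Cinf UNIV (taylor2 y0 G0 G1 H)"
  unfolding taylor2_def[abs_def]
  by (intro Cinf_add Cinf_sum Cinf_scaleR Cinf_mult Cinf_const Cinf_nth_diff open_UNIV)

lemma taylor2_at [simp]: "taylor2 y0 G0 G1 H y0 = G0"
  by (simp add: taylor2_def)

lemma sum_axis_scaleR: "(\<Sum>l\<in>UNIV. (axis k 1 :: real^'n) $ l *\<^sub>R X l) = X k"
  for X :: "'n::finite \<Rightarrow> 'b::real_vector"
proof -
  have "(\<Sum>l\<in>UNIV. (axis k 1 :: real^'n) $ l *\<^sub>R X l) = (\<Sum>l\<in>UNIV. if l = k then X l else 0)"
    by (intro sum.cong) (auto simp: axis_def)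
  then show ?thesis by simp
qed

lemma has_derivative_nth_diff:
  "((\<lambda>y :: real^'n::finite. (y - y0) $ k) has_derivative (\<lambda>v. v $ k)) (at y)"
  by (rule bounded_linear.has_derivative[OF bounded_linear_vec_nth]) (auto intro!: derivative_eq_intros)

lemma pd_taylor2:
  assumes "\<And>k l. H $ k $ l = H $ l $ k"
  shows "pd k (taylor2 y0 G0 G1 H) = (\<lambda>y. G1 $ k + (\<Sum>l\<in>UNIV. (y - y0) $ l *\<^sub>R H $ k $ l))"
proof
  fix y
  have "(taylor2 y0 G0 G1 H has_derivative (\<lambda>v. (\<Sum>k\<in>UNIV. v $ k *\<^sub>R G1 $ k)
      + (1/2) *\<^sub>R (\<Sum>k\<in>UNIV. \<Sum>l\<in>UNIV. ((y - y0) $ k * v $ l + v $ k * (y - y0) $ l) *\<^sub>R H $ k $ l))) (at y)"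
    unfolding taylor2_def[abs_def]
    by (rule has_derivative_nth_diff derivative_eq_intros refl | simp)+
  from pd_eq[OF this]
  have "pd k (taylor2 y0 G0 G1 H) y = G1 $ k
      + (1/2) *\<^sub>R ((\<Sum>i\<in>UNIV. (y - y0) $ i *\<^sub>R H $ i $ k) + (\<Sum>l\<in>UNIV. (y - y0) $ l *\<^sub>R H $ k $ l))"
  proof -
    have "(\<Sum>i\<in>UNIV. \<Sum>l\<in>UNIV. ((y - y0) $ i * (axis k 1 :: real^'a) $ l + (axis k 1 :: real^'a) $ i * (y - y0) $ l) *\<^sub>R H $ i $ l)
      = (\<Sum>i\<in>UNIV. (y - y0) $ i *\<^sub>R (\<Sum>l\<in>UNIV. (axis k 1 :: real^'a) $ l *\<^sub>R H $ i $ l))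
        + (\<Sum>i\<in>UNIV. (axis k 1 :: real^'a) $ i *\<^sub>R (\<Sum>l\<in>UNIV. (y - y0) $ l *\<^sub>R H $ i $ l))"
      by (simp only: scaleR_add_left sum.distrib scaleR_sum_right scaleR_scaleR)
    then show ?thesis using pd_eq[OF \<open>(taylor2 _ _ _ _ has_derivative _) _\<close>, of k] by (simp only: sum_axis_scaleR)
  qed
  then show "pd k (taylor2 y0 G0 G1 H) y = G1 $ k + (\<Sum>l\<in>UNIV. (y - y0) $ l *\<^sub>R H $ k $ l)"
    by (simp add: assms[of _ k] flip: scaleR_add_left scaleR_2)
qed

lemma pd_pd_taylor2:
  assumes "\<And>k l. H $ k $ l = H $ l $ k"
  shows "pd k (pd l (taylor2 y0 G0 G1 H)) = (\<lambda>y. H $ k $ l)"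
proof
  fix y
  have "((\<lambda>y. G1 $ l + (\<Sum>m\<in>UNIV. (y - y0) $ m *\<^sub>R H $ l $ m)) has_derivative
      (\<lambda>v. \<Sum>m\<in>UNIV. v $ m *\<^sub>R H $ l $ m)) (at y)"
    by (rule has_derivative_nth_diff derivative_eq_intros refl | simp)+
  from pd_eq[OF this] show "pd k (pd l (taylor2 y0 G0 G1 H)) y = H $ k $ l"
    unfolding pd_taylor2[OF assms] by (simp add: sum_axis_scaleR assms[of k])
qed

lemma transpose_eq_iff: "transpose M = M \<longleftrightarrow> (\<forall>i j. M $ i $ j = M $ j $ i)"
  by (auto simp: vec_eq_iff transpose_def)

lemma transpose_taylor2:
  assumes "transpose G0 = G0" "\<And>k. transpose (G1 $ k) = G1 $ k" "\<And>k l. transpose (H $ k $ l) = H $ k $ l"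
  shows "transpose (taylor2 y0 G0 G1 H y) = taylor2 y0 G0 G1 H y"
  unfolding transpose_eq_iff
proof (intro allI)
  fix i j
  have s: "G0 $ i $ j = G0 $ j $ i" "G1 $ k $ i $ j = G1 $ k $ j $ i" "H $ k $ l $ i $ j = H $ k $ l $ j $ i" for k l
    using assms unfolding transpose_eq_iff by blast+
  show "taylor2 y0 G0 G1 H y $ i $ j = taylor2 y0 G0 G1 H y $ j $ i"
    unfolding taylor2_def by (simp add: s)
qed

lemma sym4_eq_iff: "sym4 H = H \<longleftrightarrow> (\<forall>k l. H $ k $ l = H $ l $ k) \<and> (\<forall>k l. transpose (H $ k $ l) = H $ k $ l)"
proof
  assume H: "sym4 H = H"
  have "sym4 H $ k $ l $ a $ b = sym4 H $ l $ k $ a $ b" "sym4 H $ k $ l $ a $ b = sym4 H $ k $ l $ b $ a" for k l a b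
    by simp_all
  then show "(\<forall>k l. H $ k $ l = H $ l $ k) \<and> (\<forall>k l. transpose (H $ k $ l) = H $ k $ l)"
    unfolding H by (simp add: vec_eq_iff transpose_def)
next
  assume "(\<forall>k l. H $ k $ l = H $ l $ k) \<and> (\<forall>k l. transpose (H $ k $ l) = H $ k $ l)"
  then have "H $ k $ l = H $ l $ k" "H $ k $ l $ a $ b = H $ k $ l $ b $ a" for k l a b
    unfolding transpose_eq_iff by blast+
  then have "sym4 H $ k $ l $ a $ b = H $ k $ l $ a $ b" for k l a b
    by (simp only: sym4_nth) simp
  then show "sym4 H = H" by (simp add: vec_eq_iff)
qed

context atlas
begin

text \<open>The signature is known at one point only; \<open>has_signature_open\<close> propagates
  it to a neighbourhood \<open>W\<close>.\<close>

lemma chart_metric_near: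
  assumes c: "c \<in> charts_at A x" and S: "open S" "snd c x \<in> S"
    and G: "Cinf S G" "\<And>y. y \<in> S \<Longrightarrow> transpose (G y) = G y" "has_signature q r (G (snd c x))"
  obtains W where "open W" "snd c x \<in> W" "W \<subseteq> S" "W \<subseteq> snd c ` fst c" "x \<in> cinv c ` W"
    "metric_on A q r (cinv c ` W) (chart_metric c G)"
proof -
  note c' = charts_atD[OF c]
  obtain e where e: "e > 0" "\<And>H. \<lbrakk>norm (H - G (snd c x)) < e; transpose H = H\<rbrakk> \<Longrightarrow> has_signature q r H"
    using has_signature_open[OF G(3)] by blast
  let ?W = "(S \<inter> G -` ball (G (snd c x)) e) \<inter> snd c ` fst c"
  have "open ?W"
    using continuous_open_preimage[OF Cinf_continuous_on[OF G(1)] S(1) open_ball] open_img[OF c'(1)]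
    by blast
  moreover have "snd c x \<in> ?W" using S(2) e(1) c'(2) by simp
  moreover have "metric_on A q r (cinv c ` ?W) (chart_metric c G)"
  proof (rule metric_on_chart_metric[OF c'(1) \<open>open ?W\<close> _ Cinf_subset[OF G(1)]])
    show "has_signature q r (G y)" if "y \<in> ?W" for y
      using that by (intro e(2) G(2)) (auto simp: dist_norm norm_minus_commute)
  qed auto
  moreover have "x \<in> cinv c ` ?W"
    using \<open>snd c x \<in> ?W\<close> cinv_chart[OF c'] by (metis image_eqI)
  ultimately show ?thesis using that[of ?W] by blast
qed

lemma pds_local_rep_chart_metric:
  assumes "c \<in> A" "open W" "W \<subseteq> snd c ` fst c" "Cinf W G" "y \<in> W"
  shows "pds ks (local_rep (chart_metric c G) c) y = pds ks G y"
proof (rule pds_cong[OF assms(2,5,4), symmetric])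
  show "G y = local_rep (chart_metric c G) c y" if "y \<in> W" for y
    using that assms(3) by (intro local_rep_chart_metric[OF assms(1), symmetric]) blast
qed

end

locale fibre = atlas A for A :: "('x::topological_space, 'n::finite) chart set" +
  fixes q r :: nat and c :: "('x, 'n) chart" and x :: 'x and g0 :: "('x, 'n) metric"
  assumes c_at: "c \<in> charts_at A x" and g0_near: "g0 \<in> metrics_near A q r x"
begin

definition y0 where "y0 = snd c x"
definition G0 where "G0 = g0 x c"
definition G1 :: "real^'n^'n^'n" where "G1 = (\<chi> k. pd k (local_rep g0 c) y0)"

lemmas cA = charts_atD(1)[OF c_at] and x_dom = charts_atD(2)[OF c_at]

lemma y0_in: "y0 \<in> snd c ` fst c"
  using x_dom by (simp add: y0_def)

lemma cinv_y0 [simp]: "cinv c y0 = x"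
  using cinv_chart[OF cA x_dom] by (simp add: y0_def)

lemma near_symmetric:
  assumes h: "h \<in> metrics_near A q r x"
  shows "has_signature q r (h x c)" "transpose (pd k (local_rep h c) y0) = pd k (local_rep h c) y0"
    and "sym4 (second_derivs h c x) = second_derivs h c x"
proof -
  obtain U where U: "x \<in> U" "metric_on A q r U h" using h unfolding metrics_near_def by blast
  then show "has_signature q r (h x c)" using c_at unfolding metric_on_def by blast
  let ?V = "snd c ` (U \<inter> fst c)" and ?G = "local_rep h c"
  have V: "open ?V" "y0 \<in> ?V"
    using U open_chart_image[OF cA] x_dom by (auto simp: metric_on_def y0_def)
  have G: "Cinf ?V ?G" by (rule Cinf_local_rep[OF U(2) cA])
  have sym: "transpose (?G y) = ?G y" if yV: "y \<in> ?V" for y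
  proof -
    obtain z where z: "z \<in> U" "z \<in> fst c" "y = snd c z" using yV by blast
    then have "c \<in> charts_at A z" using cA by (simp add: charts_at_def)
    then have "has_signature q r (h z c)" using U(2) z(1) unfolding metric_on_def by blast
    then show ?thesis using z cinv_chart[OF cA] by (simp add: local_rep_def has_signature_def)
  qed
  have tr: "transpose (pd k F y) = pd k F y"
    if F: "Cinf ?V F" "\<And>y. y \<in> ?V \<Longrightarrow> transpose (F y) = F y" and y: "y \<in> ?V" for F :: "real^'n \<Rightarrow> real^'n^'n" and k y
  proof -
    have d: "F differentiable (at y)" by (rule Cinf_differentiable[OF F(1) V(1) y])
    have "pd k F y = pd k (\<lambda>y. transpose (F y)) y"
      by (rule pd_cong[OF d V(1) y]) (simp add: F(2))
    then show ?thesis using pd_linear[OF bounded_linear_transpose d] by simp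
  qed
  show "transpose (pd k ?G y0) = pd k ?G y0" by (rule tr[OF G sym V(2)])
  have "pd k (pd l ?G) y0 = pd l (pd k ?G) y0" for k l
  proof -
    \<comment> \<open>\<open>pd_commute_real\<close> concerns real-valued functions, so the matrix
      is treated entry by entry.\<close>
    have "pd k (pd l ?G) y0 $ a $ b = pd k (pd l (\<lambda>y. ?G y $ a $ b)) y0" for k l a b
    proof -
      have L: "bounded_linear (\<lambda>M :: real^'n^'n. M $ a $ b)"
        using bounded_linear_compose[OF bounded_linear_vec_nth bounded_linear_vec_nth] .
      have "pd k (pd l (\<lambda>y. ?G y $ a $ b)) y0 = pd k (\<lambda>y. pd l ?G y $ a $ b) y0"
        by (rule pd_cong[OF Cinf_differentiable[OF Cinf_pd[OF Cinf_bounded_linear_compose[OF L V(1) G]] V] V])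
          (simp add: pd_linear[OF L Cinf_differentiable[OF G V(1)]])
      also have "\<dots> = pd k (pd l ?G) y0 $ a $ b"
        by (rule pd_linear[OF L Cinf_differentiable[OF Cinf_pd[OF G] V]])
      finally show ?thesis ..
    qed
    moreover have "Cinf ?V (\<lambda>y. ?G y $ a $ b)" for a b
      by (intro Cinf_vec_nth V(1) G)
    ultimately show ?thesis
      using pd_commute_real[OF V(1) _ V(2)] by (simp add: vec_eq_iff)
  qed
  moreover have "transpose (pd k (pd l ?G) y0) = pd k (pd l ?G) y0" for k l
    by (rule tr[OF Cinf_pd[OF G] tr[OF G sym] V(2)])
  ultimately show "sym4 (second_derivs h c x) = second_derivs h c x"
    unfolding sym4_eq_iff by (simp add: second_derivs_def y0_def)
qed

lemma G0_signature: "has_signature q r G0" and G0_sym: "transpose G0 = G0"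
  and G1_sym: "transpose (G1 $ k) = G1 $ k"
  using near_symmetric[OF g0_near] by (auto simp: G0_def G1_def has_signature_def)

text \<open>Near \<open>x\<close>, these metrics realise every symmetric \<open>H\<close> as the
  second derivatives over the fixed 1-jet.\<close>

abbreviation quadm :: "real^'n^'n^'n^'n \<Rightarrow> ('x, 'n) metric" where
  "quadm H \<equiv> chart_metric c (taylor2 y0 G0 G1 H)"

text \<open>The coordinates of actual 2-jets, the set on which a second-order tensor is known to be
  smooth.\<close>

definition JS where "JS = {jet2_coords g c x | x g. x \<in> fst c \<and> g \<in> metrics_near A q r x}"

lemma chart_metric_facts:
  assumes "open S" "y0 \<in> S" "Cinf S G" "\<And>y. y \<in> S \<Longrightarrow> transpose (G y) = G y" "G y0 = G0"
  obtains W where "open W" "y0 \<in> W" "W \<subseteq> S" "W \<subseteq> snd c ` fst c"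
    "metric_on A q r (cinv c ` W) (chart_metric c G)"
    "\<forall>y\<in>W. chart_metric c G \<in> metrics_near A q r (cinv c y)"
    "\<forall>y\<in>W. jet2_coords (chart_metric c G) c (cinv c y)
       = (y, G y, (\<chi> k. pd k G y), (\<chi> k l. pd k (pd l G) y))"
proof -
  have sig: "has_signature q r (G (snd c x))" using G0_signature assms(5) by (simp add: y0_def)
  obtain W where W: "open W" "snd c x \<in> W" "W \<subseteq> S" "W \<subseteq> snd c ` fst c" "x \<in> cinv c ` W"
    "metric_on A q r (cinv c ` W) (chart_metric c G)"
    by (rule chart_metric_near[where G = G and S = S, OF c_at assms(1) assms(2)[unfolded y0_def] assms(3,4) sig])
  have jc: "jet2_coords (chart_metric c G) c (cinv c y) = (y, G y, (\<chi> k. pd k G y), (\<chi> k l. pd k (pd l G) y))"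
    if "y \<in> W" for y
  proof -
    have yS: "y \<in> snd c ` fst c" using that W(4) by blast
    then have "snd c (cinv c y) = y" by (rule chart_cinv)
    moreover have "chart_metric c G (cinv c y) c = G y"
      using local_rep_chart_metric[OF cA yS, of G] by (simp add: local_rep_def)
    moreover have "pd k (local_rep (chart_metric c G) c) y = pd k G y"
      "pd k (pd l (local_rep (chart_metric c G) c)) y = pd k (pd l G) y" for k l
      using pds_local_rep_chart_metric[OF cA W(1,4) Cinf_subset[OF assms(3) W(3)] that, of "[k]"]
        pds_local_rep_chart_metric[OF cA W(1,4) Cinf_subset[OF assms(3) W(3)] that, of "[k, l]"] by auto
    ultimately show ?thesis
      by (simp add: jet2_coords_def second_derivs_def)
  qed
  show ?thesis
  proof (rule that[OF W(1) _ W(3,4,6)])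
    show "y0 \<in> W" using W(2) by (simp add: y0_def)
    show "\<forall>y\<in>W. chart_metric c G \<in> metrics_near A q r (cinv c y)"
      using W(6) unfolding metrics_near_def by blast
  qed (use jc in blast)
qed

lemma quadm_near:
  assumes "sym4 H = H"
  shows "quadm H \<in> metrics_near A q r x" "jet2_coords (quadm H) c x = (y0, G0, G1, H)"
proof -
  have H: "\<And>k l. H $ k $ l = H $ l $ k" "\<And>k l. transpose (H $ k $ l) = H $ k $ l"
    using assms unfolding sym4_eq_iff by auto
  obtain W where "open W" and W: "y0 \<in> W" and "W \<subseteq> UNIV" "W \<subseteq> snd c ` fst c"
    "metric_on A q r (cinv c ` W) (quadm H)"
    and Wq: "\<forall>y\<in>W. quadm H \<in> metrics_near A q r (cinv c y)"
    and Wj: "\<forall>y\<in>W. jet2_coords (quadm H) c (cinv c y) = (y, taylor2 y0 G0 G1 H y,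
       (\<chi> k. pd k (taylor2 y0 G0 G1 H) y), (\<chi> k l. pd k (pd l (taylor2 y0 G0 G1 H)) y))"
    by (rule chart_metric_facts[where G = "taylor2 y0 G0 G1 H", OF open_UNIV UNIV_I Cinf_taylor2 transpose_taylor2[OF G0_sym G1_sym H(2)] taylor2_at])
  show "quadm H \<in> metrics_near A q r x" using bspec[OF Wq W] by simp
  show "jet2_coords (quadm H) c x = (y0, G0, G1, H)"
    using bspec[OF Wj W] unfolding pd_pd_taylor2[OF H(1)]
    by (simp add: pd_taylor2[OF H(1)] vec_eq_iff)
qed

lemma jet2_coords_fibre:
  assumes h: "h \<in> metrics_near A q r x" and jet: "jet A q r 1 x h = jet A q r 1 x g0"
  shows "jet2_coords h c x = (y0, G0, G1, sym4 (second_derivs h c x))"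
proof -
  have "pds ks (local_rep h c) (snd c x) = pds ks (local_rep g0 c) (snd c x)" if "length ks \<le> 1" for ks
    using jet_eqD[OF jet h c_at that] .
  from this[of "[]"] this[of "[_]"] show ?thesis
    unfolding near_symmetric(3)[OF h]
    by (simp add: jet2_coords_def G0_def G1_def y0_def local_rep_def cinv_chart[OF cA x_dom])
qed

end

section \<open>Divergence-free tensors along a fibre\<close>

lemma Cinf_local:
  assumes "\<And>x. x \<in> S \<Longrightarrow> \<exists>U. open U \<and> x \<in> U \<and> Cinf U f"
  shows "Cinf S f"
  unfolding Cinf_def using Ck_on_local[of S _ f] assms unfolding Cinf_def by meson

locale fibre_tensor = fibre A q r c x g0
  for A :: "('x::topological_space, 'n::finite) chart set" and q r c x g0 +
  fixes T :: "('x, 'n) jet \<Rightarrow> ('x, 'n) tensor" and p :: nat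
    and F :: "'n list \<Rightarrow> (real^'n) \<times> (real^'n^'n) \<times> (real^'n^'n^'n) \<times> (real^'n^'n^'n^'n) \<Rightarrow> real"
  assumes F_smooth: "smooth_on JS (F J)"
    and T_eq: "\<lbrakk>x' \<in> fst c; g \<in> metrics_near A q r x'\<rbrakk> \<Longrightarrow> T (jet A q r 2 x' g) c J = F J (jet2_coords g c x')"
begin

text \<open>Symmetrizing the second derivatives makes the restriction of a tensor to the fibre a function on
  a vector space.\<close>

definition emb :: "real^'n^'n^'n^'n \<Rightarrow> (real^'n) \<times> (real^'n^'n) \<times> (real^'n^'n^'n) \<times> (real^'n^'n^'n^'n)" where
  "emb H = (y0, G0, G1, sym4 H)"

definition fT :: "'n list \<Rightarrow> real^'n^'n^'n^'n \<Rightarrow> real" where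
  "fT J H = F J (emb H)"

lemma emb_in_JS: "emb H \<in> JS"
  unfolding JS_def emb_def
  by (rule CollectI, rule exI[of _ x], rule exI[of _ "quadm (sym4 H)"])
    (simp add: quadm_near x_dom)

lemma fT_sym4 [simp]: "fT J (sym4 H) = fT J H"
  by (simp add: fT_def emb_def)

lemma T_fibre:
  assumes "h \<in> metrics_near A q r x" "jet A q r 1 x h = jet A q r 1 x g0"
  shows "T (jet A q r 2 x h) c J = fT J (second_derivs h c x)"
  using T_eq[OF x_dom assms(1)] jet2_coords_fibre[OF assms] by (simp add: fT_def emb_def)

lemma T_quadm: "sym4 H = H \<Longrightarrow> T (jet A q r 2 x (quadm H)) c J = fT J H"
  using T_eq[OF x_dom quadm_near(1)] quadm_near(2) by (simp add: fT_def emb_def)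

lemma local_extension:
  obtains U h where "open U" "emb H \<in> U" "Cinf U h" "\<forall>z\<in>JS \<inter> U. h z = F J z"
  using F_smooth[of J] emb_in_JS[of H] unfolding smooth_on_def Cinf_def by blast

lemma emb_has_derivative: "(emb has_derivative (\<lambda>\<theta>. (0, 0, 0, sym4 \<theta>))) (at H)"
  unfolding emb_def[abs_def]
  by (intro has_derivative_Pair has_derivative_const
      bounded_linear.has_derivative[OF bounded_linear_sym4 has_derivative_ident])

lemma Cinf_emb: "Cinf UNIV emb"
proof -
  have "bounded_linear (\<lambda>H :: real^'n^'n^'n^'n.
      (0 :: real^'n, 0 :: real^'n^'n, 0 :: real^'n^'n^'n, sym4 H))"
    by (intro bounded_linear_Pair bounded_linear_zero bounded_linear_sym4)
  then have "Cinf UNIV (\<lambda>H :: real^'n^'n^'n^'n. (y0, G0, G1, 0) + (0, 0, 0, sym4 H))"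
    by (intro Cinf_add Cinf_const Cinf_linear open_UNIV)
  then show ?thesis by (simp add: emb_def[abs_def])
qed

lemma open_emb_preimage: "open U \<Longrightarrow> open (emb -` U)"
  using Cinf_continuous_on[OF Cinf_emb] continuous_on_open_vimage[OF open_UNIV] by auto

text \<open>\<open>emb\<close> maps into \<open>JS\<close>, so near each \<open>H\<close> the
  function is the composite of \<open>emb\<close> with a local smooth extension of
  \<open>F J\<close>.\<close>

lemma Cinf_fT: "Cinf UNIV (fT J)"
proof (rule Cinf_local)
  fix H
  obtain U h where h: "open U" "emb H \<in> U" "Cinf U h" "\<forall>z\<in>JS \<inter> U. h z = F J z"
    by (rule local_extension)
  have "Cinf (emb -` U) (fT J)"
  proof (rule Cinf_cong[OF open_emb_preimage[OF h(1)]])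
    show "Cinf (emb -` U) (\<lambda>H. h (emb H))"
      by (rule Cinf_compose[OF open_emb_preimage[OF h(1)] h(1) _ h(3) Cinf_subset[OF Cinf_emb]]) auto
    show "h (emb H) = fT J H" if "H \<in> emb -` U" for H
      using that h(4) emb_in_JS by (simp add: fT_def)
  qed
  then show "\<exists>U. open U \<and> H \<in> U \<and> Cinf U (fT J)"
    using open_emb_preimage[OF h(1)] h(2) by blast
qed

lemma fT_derivative:
  assumes h: "open U" "emb H \<in> U" "Cinf U h" "\<forall>z\<in>JS \<inter> U. h z = F J z"
  shows "frechet_derivative (fT J) (at H) \<theta> = frechet_derivative h (at (emb H)) (0, 0, 0, sym4 \<theta>)"
proof -
  have "((\<lambda>H. h (emb H)) has_derivative (\<lambda>\<theta>. frechet_derivative h (at (emb H)) (0, 0, 0, sym4 \<theta>))) (at H)"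
    by (rule has_derivative_compose[OF emb_has_derivative Cinf_has_derivative[OF h(3,1,2)]])
  then have "(fT J has_derivative (\<lambda>\<theta>. frechet_derivative h (at (emb H)) (0, 0, 0, sym4 \<theta>))) (at H)"
    by (rule has_derivative_transform_within_open[OF _ open_emb_preimage[OF h(1)]])
      (use h(2,4) emb_in_JS in \<open>simp_all add: fT_def\<close>)
  from frechet_derivative_at[OF this] show ?thesis by metis
qed

text \<open>The chain rule along the curve of jet coordinates of \<open>g\<close>. The curve stays
  in \<open>JS\<close>, so near \<open>y0\<close> the extension \<open>h\<close> may replace
  \<open>F J\<close>, which has no derivative of its own there.\<close>

lemma pd_tensor:
  assumes h: "open U" "emb H \<in> U" "Cinf U h" "\<forall>z\<in>JS \<inter> U. h z = F J z"
    and W: "open W" "y0 \<in> W" "W \<subseteq> snd c ` fst c"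
    and g: "\<forall>y\<in>W. g \<in> metrics_near A q r (cinv c y)" "\<forall>y\<in>W. jet2_coords g c (cinv c y) = j y"
    and j: "(j has_derivative Dj) (at y0)" "j y0 = emb H"
  shows "pd k (\<lambda>y. T (jet A q r 2 (cinv c y) g) c J) y0 = frechet_derivative h (at (emb H)) (Dj (axis k 1))"
proof (rule pd_eq)
  have eq: "h (j y) = T (jet A q r 2 (cinv c y) g) c J" if "y \<in> W" "j y \<in> U" for y
  proof -
    have in_dom: "cinv c y \<in> fst c" by (rule cinv_in) (use that(1) W(3) in blast)
    note near = bspec[OF g(1) that(1)] and coords = bspec[OF g(2) that(1)]
    have "T (jet A q r 2 (cinv c y) g) c J = F J (j y)"
      using T_eq[OF in_dom near] unfolding coords .
    moreover have "j y \<in> JS"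
      unfolding JS_def coords[symmetric] using in_dom near by blast
    ultimately show ?thesis using h(4) that(2) by simp
  qed
  have "((\<lambda>y. h (j y)) has_derivative (\<lambda>v. frechet_derivative h (at (emb H)) (Dj v))) (at y0)"
    by (rule has_derivative_compose[OF j(1)]) (use Cinf_has_derivative[OF h(3,1,2)] j(2) in simp)
  moreover have "\<forall>\<^sub>F y in at y0. h (j y) = T (jet A q r 2 (cinv c y) g) c J"
  proof -
    have "j \<midarrow>y0\<rightarrow> emb H" using has_derivative_continuous[OF j(1)] j(2) by (simp add: isCont_def)
    then have "\<forall>\<^sub>F y in at y0. j y \<in> U" using h(1,2) by (rule topological_tendstoD)
    moreover have "\<forall>\<^sub>F y in at y0. y \<in> W" using W(1,2) by (simp add: eventually_at_in_open')
    ultimately show ?thesis by eventually_elim (rule eq)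
  qed
  ultimately show "((\<lambda>y. T (jet A q r 2 (cinv c y) g) c J) has_derivative
      (\<lambda>v. frechet_derivative h (at (emb H)) (Dj v))) (at y0)"
    by (rule has_derivative_transform_eventually) (use eq[of y0] W(2) j(2) h(2) in simp_all)
qed

text \<open>Two metrics with the same 2-jet at \<open>x\<close> are compared. The difference of
  their divergences is exactly the asserted sum, and both divergences vanish.\<close>

lemma fT_divergence:
  assumes div: "divergence_free A q r p T" and J: "length J = p - 1" "p \<ge> 1"
    and H: "sym4 H = H" and \<alpha>: "transpose \<alpha> = \<alpha>"
  shows "(\<Sum>k\<in>UNIV. l $ k * frechet_derivative (fT (J @ [k])) (at H) (quad (outer l l) \<alpha>)) = 0"
proof -
  define \<theta> where "\<theta> = quad (outer l l) \<alpha>"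
  define \<beta> :: "real^'n^'n^'n" where "\<beta> = (\<chi> k. l $ k *\<^sub>R \<alpha>)"
  define t where "t y = l \<bullet> (y - y0)" for y
  define G where "G = taylor2 y0 G0 G1 H"
  \<comment> \<open>Each derivative of the cubic term produces a factor \<open>l\<close>, so the
    2-jet at \<open>y0\<close> is unchanged and the third derivatives gain \<open>l\<close> three
    times, tensored with \<open>\<alpha>\<close>.\<close>
  define G' where "G' y = G y + ((t y)^3 / 6) *\<^sub>R \<alpha>" for y
  have H': "\<And>k l. H $ k $ l = H $ l $ k" "\<And>k l. transpose (H $ k $ l) = H $ k $ l"
    using H unfolding sym4_eq_iff by auto
  have \<theta>_sym: "sym4 \<theta> = \<theta>"
    using \<alpha> unfolding \<theta>_def transpose_eq_iff sym4_eq_iff by (simp add: vec_eq_iff mult.commute)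
  have G_inf: "Cinf UNIV G" unfolding G_def by (rule Cinf_taylor2)
  have t': "(t has_derivative (\<lambda>v. l \<bullet> v)) (at y)" for y
    unfolding t_def[abs_def] by (auto intro!: derivative_eq_intros)
  have t_inf: "Cinf UNIV t"
    unfolding t_def[abs_def]
    by (intro Cinf_bounded_linear_compose[OF bounded_linear_inner_right] Cinf_diff Cinf_id Cinf_const open_UNIV)
  have G'_inf: "Cinf UNIV G'"
  proof -
    have "Cinf UNIV (\<lambda>y. G y + ((1/6) * (t y)^3) *\<^sub>R \<alpha>)"
      by (intro Cinf_add Cinf_scaleR Cinf_mult Cinf_power Cinf_const G_inf t_inf open_UNIV)
    then show ?thesis by (simp add: G'_def[abs_def])
  qed
  have G_sym: "transpose (G y) = G y" for y
    unfolding G_def by (rule transpose_taylor2[OF G0_sym G1_sym H'(2)])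
  then have G'_sym: "transpose (G' y) = G' y" for y
    using \<alpha> unfolding G'_def transpose_eq_iff by simp
  have t0: "t y0 = 0" by (simp add: t_def)
  have D: "(F has_derivative frechet_derivative F (at y)) (at y)" if "Cinf UNIV F"
    for F :: "real^'n \<Rightarrow> 'b::real_normed_vector" and y
    by (rule Cinf_has_derivative[OF that open_UNIV UNIV_I])
  have pd1: "pd k G' = (\<lambda>y. pd k G y + ((t y)\<^sup>2 / 2 * l $ k) *\<^sub>R \<alpha>)" for k
  proof
    fix y
    have "(G' has_derivative (\<lambda>v. frechet_derivative G (at y) v + ((t y)\<^sup>2 / 2 * (l \<bullet> v)) *\<^sub>R \<alpha>)) (at y)"
      unfolding G'_def[abs_def]
      by (rule derivative_eq_intros D[OF G_inf] t' refl | simp add: fun_eq_iff power2_eq_square)+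
    from pd_eq[OF this] show "pd k G' y = pd k G y + ((t y)\<^sup>2 / 2 * l $ k) *\<^sub>R \<alpha>"
      by (simp add: pd_def inner_axis)
  qed
  have pd2: "pd m (pd k G') = (\<lambda>y. pd m (pd k G) y + (t y * l $ m * l $ k) *\<^sub>R \<alpha>)" for m k
  proof
    fix y
    have "((\<lambda>y. pd k G y + ((t y)\<^sup>2 / 2 * l $ k) *\<^sub>R \<alpha>) has_derivative
        (\<lambda>v. frechet_derivative (pd k G) (at y) v + (t y * (l \<bullet> v) * l $ k) *\<^sub>R \<alpha>)) (at y)"
      by (rule derivative_eq_intros D[OF Cinf_pd[OF G_inf]] t' refl | simp add: fun_eq_iff)+
    from pd_eq[OF this] show "pd m (pd k G') y = pd m (pd k G) y + (t y * l $ m * l $ k) *\<^sub>R \<alpha>"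
      unfolding pd1 by (simp add: pd_def inner_axis)
  qed
  define j where "j y = (y, G y, (\<chi> k. pd k G y), (\<chi> k l. pd k (pd l G) y))" for y
  \<comment> \<open>The difference of the two curves of jet coordinates. Only its last component has
    a nonzero derivative at \<open>y0\<close>.\<close>
  define E where "E y = (0 :: real^'n, ((t y)^3 / 6) *\<^sub>R \<alpha>, ((t y)\<^sup>2 / 2) *\<^sub>R \<beta>, t y *\<^sub>R \<theta>)" for y
  have j'_eq: "(y, G' y, (\<chi> k. pd k G' y), (\<chi> k l. pd k (pd l G') y)) = j y + E y" for y
    unfolding pd2 unfolding pd1
    by (simp add: j_def E_def G'_def vec_eq_iff \<beta>_def \<theta>_def algebra_simps)
  obtain Dj where Dj: "(j has_derivative Dj) (at y0)"
  proof -
    have C1: "Cinf UNIV (\<lambda>y. (\<chi> k. pd k G y))"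
      by (rule Cinf_vecI[OF open_UNIV]) (simp add: Cinf_pd[OF G_inf])
    have "Cinf UNIV (\<lambda>y. (\<chi> l. pd k (pd l G) y))" for k
      by (rule Cinf_vecI[OF open_UNIV]) (simp add: Cinf_pd[OF Cinf_pd[OF G_inf]])
    then have C2: "Cinf UNIV (\<lambda>y. (\<chi> k l. pd k (pd l G) y))"
      by (intro Cinf_vecI[of _ "\<lambda>y. (\<chi> k l. pd k (pd l G) y)"] open_UNIV) simp
    from has_derivative_Pair[OF has_derivative_ident has_derivative_Pair[OF D[OF G_inf]
        has_derivative_Pair[OF D[OF C1] D[OF C2]]]]
    show ?thesis using that unfolding j_def[abs_def] by blast
  qed
  have DE: "(E has_derivative (\<lambda>v. (0, 0, 0, (l \<bullet> v) *\<^sub>R \<theta>))) (at y0)"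
  proof -
    have "((\<lambda>y. ((t y)^3 / 6) *\<^sub>R \<alpha>) has_derivative (\<lambda>v. 0)) (at y0)"
      "((\<lambda>y. ((t y)\<^sup>2 / 2) *\<^sub>R \<beta>) has_derivative (\<lambda>v. 0)) (at y0)"
      "((\<lambda>y. t y *\<^sub>R \<theta>) has_derivative (\<lambda>v. (l \<bullet> v) *\<^sub>R \<theta>)) (at y0)"
      by (rule derivative_eq_intros t' refl | simp add: t0 fun_eq_iff)+
    from has_derivative_Pair[OF has_derivative_const has_derivative_Pair[OF this(1)
        has_derivative_Pair[OF this(2,3)]]]
    show ?thesis unfolding E_def[abs_def] .
  qed
  have Dj': "((\<lambda>y. j y + E y) has_derivative (\<lambda>v. Dj v + (0, 0, 0, (l \<bullet> v) *\<^sub>R \<theta>))) (at y0)"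
    by (rule has_derivative_add[OF Dj DE])
  have j0: "j y0 = emb H"
    unfolding j_def emb_def G_def pd_pd_taylor2[OF H'(1)] H
    by (simp add: pd_taylor2[OF H'(1)] vec_eq_iff)
  have j0': "j y0 + E y0 = emb H" using j0 by (simp add: E_def t0 zero_prod_def[symmetric])
  have G_at: "G y0 = G0" and G'_at: "G' y0 = G0" by (simp_all add: G'_def G_def t0)
  let ?g = "chart_metric c G" and ?g' = "chart_metric c G'"
  obtain W where W: "open W" "y0 \<in> W" "W \<subseteq> UNIV" "W \<subseteq> snd c ` fst c" "metric_on A q r (cinv c ` W) ?g"
    and Wg: "\<forall>y\<in>W. ?g \<in> metrics_near A q r (cinv c y)" "\<forall>y\<in>W. jet2_coords ?g c (cinv c y)
       = (y, G y, (\<chi> k. pd k G y), (\<chi> k l. pd k (pd l G) y))"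
    by (rule chart_metric_facts[where G = G, OF open_UNIV UNIV_I G_inf G_sym G_at])
  obtain W' where W': "open W'" "y0 \<in> W'" "W' \<subseteq> UNIV" "W' \<subseteq> snd c ` fst c" "metric_on A q r (cinv c ` W') ?g'"
    and Wg': "\<forall>y\<in>W'. ?g' \<in> metrics_near A q r (cinv c y)" "\<forall>y\<in>W'. jet2_coords ?g' c (cinv c y)
       = (y, G' y, (\<chi> k. pd k G' y), (\<chi> k l. pd k (pd l G') y))"
    by (rule chart_metric_facts[where G = G', OF open_UNIV UNIV_I G'_inf G'_sym G'_at])
  have jW: "\<forall>y\<in>W. jet2_coords ?g c (cinv c y) = j y" using Wg(2) by (simp add: j_def)
  have jW': "\<forall>y\<in>W'. jet2_coords ?g' c (cinv c y) = j y + E y" using Wg'(2) unfolding j'_eq .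
  have diff: "pd k (\<lambda>y. T (jet A q r 2 (cinv c y) ?g') c K) y0 - pd k (\<lambda>y. T (jet A q r 2 (cinv c y) ?g) c K) y0
      = l $ k * frechet_derivative (fT K) (at H) \<theta>" for k K
  proof -
    obtain U h where h: "open U" "emb H \<in> U" "Cinf U h" "\<forall>z\<in>JS \<inter> U. h z = F K z"
      by (rule local_extension)
    have lin: "linear (frechet_derivative h (at (emb H)))"
      by (rule has_derivative_linear[OF Cinf_has_derivative[OF h(3,1,2)]])
    have e: "(0, 0, 0, (l \<bullet> axis k 1) *\<^sub>R \<theta>) = (l $ k) *\<^sub>R (0 :: real^'n, 0 :: real^'n^'n, 0 :: real^'n^'n^'n, sym4 \<theta>)"
      by (simp add: inner_axis \<theta>_sym)
    have s: "frechet_derivative h (at (emb H)) (0, 0, 0, (l \<bullet> axis k 1) *\<^sub>R \<theta>)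
        = l $ k * frechet_derivative h (at (emb H)) (0, 0, 0, sym4 \<theta>)"
      unfolding e linear_scale[OF lin] by simp
    show ?thesis
      unfolding pd_tensor[OF h W(1,2,4) Wg(1) jW Dj j0] pd_tensor[OF h W'(1,2,4) Wg'(1) jW' Dj' j0']
        fT_derivative[OF h] linear_add[OF lin] s by simp
  qed
  \<comment> \<open>Apart from first derivatives of \<open>T\<close>, the divergence involves only
    values of \<open>T\<close> and Christoffel symbols, which are determined by the common 2-jet and
    cancel.\<close>
  have coords: "jet2_coords ?g' c x = jet2_coords ?g c x"
    using bspec[OF jW W(2)] bspec[OF jW' W'(2)] j0 j0' by simp
  have near: "?g \<in> metrics_near A q r x" "?g' \<in> metrics_near A q r x"
    using bspec[OF Wg(1) W(2)] bspec[OF Wg'(1) W'(2)] by simp_all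
  have T0: "T (jet A q r 2 (cinv c y0) ?g') c K = T (jet A q r 2 (cinv c y0) ?g) c K" for K
    using T_eq[OF x_dom near(1)] T_eq[OF x_dom near(2)] coords by simp
  have chr: "christoffel (local_rep ?g' c) y0 i k m = christoffel (local_rep ?g c) y0 i k m" for i k m
  proof -
    have "local_rep ?g' c y0 = local_rep ?g c y0" "\<And>k. pd k (local_rep ?g' c) y0 = pd k (local_rep ?g c) y0"
      using coords by (auto simp: jet2_coords_def local_rep_def vec_eq_iff y0_def[symmetric])
    then show ?thesis by (simp add: christoffel_def)
  qed
  have "div_comp A q r T ?g c J x = 0" "div_comp A q r T ?g' c J x = 0"
    using div W(5) W'(5) W(2) W'(2) c_at J(1) unfolding divergence_free_def by (metis cinv_y0 image_eqI)+
  then have "0 = div_comp A q r T ?g' c J x - div_comp A q r T ?g c J x" by simp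
  also have "\<dots> = (\<Sum>k\<in>UNIV. pd k (\<lambda>y. T (jet A q r 2 (cinv c y) ?g') c (J @ [k])) y0
      - pd k (\<lambda>y. T (jet A q r 2 (cinv c y) ?g) c (J @ [k])) y0)"
    unfolding div_comp_def cov_deriv_def y0_def[symmetric] chr T0 sum_subtractf[symmetric] by simp
  finally show ?thesis unfolding diff \<theta>_def by simp
qed

text \<open>Integrates the infinitesimal statement along a line. The base point is first replaced by
  \<open>sym4 H\<close>, because \<open>fT_divergence\<close> needs a symmetric one.\<close>

lemma fT_div_invariant:
  assumes "divergence_free A q r p T" "length J = p - 1" "p \<ge> 1" "transpose \<alpha> = \<alpha>"
  shows "l \<bullet> (\<chi> k. fT (J @ [k]) (H + s *\<^sub>R quad (outer l l) \<alpha>)) = l \<bullet> (\<chi> k. fT (J @ [k]) H)"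
proof -
  let ?\<theta> = "quad (outer l l) \<alpha>"
  let ?\<phi> = "\<lambda>s. \<Sum>k\<in>UNIV. l $ k * fT (J @ [k]) (sym4 H + s *\<^sub>R ?\<theta>)"
  have \<theta>_sym: "sym4 ?\<theta> = ?\<theta>"
    using assms(4) unfolding transpose_eq_iff sym4_eq_iff by (simp add: vec_eq_iff mult.commute)
  have add: "sym4 (X + s *\<^sub>R ?\<theta>) = sym4 X + s *\<^sub>R ?\<theta>" for X s
    by (simp only: sym4_add sym4_scaleR \<theta>_sym)
  have "(?\<phi> has_real_derivative 0) (at s)" for s
  proof -
    let ?H = "sym4 H + s *\<^sub>R ?\<theta>"
    have "((\<lambda>s. fT K (sym4 H + s *\<^sub>R ?\<theta>)) has_derivative
        (\<lambda>h. frechet_derivative (fT K) (at ?H) (h *\<^sub>R ?\<theta>))) (at s)" for K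
      by (rule has_derivative_compose[OF _ Cinf_has_derivative[OF Cinf_fT open_UNIV UNIV_I]])
        (auto intro!: derivative_eq_intros)
    then have "(?\<phi> has_derivative (\<lambda>h. \<Sum>k\<in>UNIV. l $ k * frechet_derivative (fT (J @ [k])) (at ?H) (h *\<^sub>R ?\<theta>))) (at s)"
      by (intro has_derivative_sum has_derivative_mult_right)
    moreover have "(\<Sum>k\<in>UNIV. l $ k * frechet_derivative (fT (J @ [k])) (at ?H) (h *\<^sub>R ?\<theta>)) = 0" for h
    proof -
      have "frechet_derivative (fT K) (at ?H) (h *\<^sub>R ?\<theta>) = h * frechet_derivative (fT K) (at ?H) ?\<theta>" for K
        using linear_scale[OF has_derivative_linear[OF Cinf_has_derivative[OF Cinf_fT open_UNIV UNIV_I]]] by simp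
      then have "(\<Sum>k\<in>UNIV. l $ k * frechet_derivative (fT (J @ [k])) (at ?H) (h *\<^sub>R ?\<theta>))
        = h * (\<Sum>k\<in>UNIV. l $ k * frechet_derivative (fT (J @ [k])) (at ?H) ?\<theta>)"
        by (simp add: sum_distrib_left mult.left_commute)
      then show ?thesis using fT_divergence[OF assms(1-3) _ assms(4), of ?H l] add[of "sym4 H" s] by simp
    qed
    ultimately show ?thesis unfolding has_field_derivative_def lambda_zero[symmetric] by simp
  qed
  then have "?\<phi> s = ?\<phi> 0" using DERIV_isconst_all by blast
  moreover have "fT K (H + s *\<^sub>R ?\<theta>) = fT K (sym4 H + s *\<^sub>R ?\<theta>)" for K
    using fT_sym4[of K "H + s *\<^sub>R ?\<theta>"] by (simp add: add)
  ultimately show ?thesis by (simp add: inner_vec_def)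
qed

end

section \<open>Diffeomorphisms with trivial 2-jet\<close>

declare van.simps(2) [simp del]

text \<open>If \<open>t' = t * isr \<beta> t\<close>, then
  \<open>1 / t'\<^sup>2 = 1 / t\<^sup>2 + \<beta>\<close> for nonzero \<open>t\<close>. These maps
  thus form a local one-parameter group in \<open>\<beta>\<close>, and changing the sign of
  \<open>\<beta>\<close> inverts them.\<close>

definition isr :: "real \<Rightarrow> real \<Rightarrow> real" where
  "isr \<beta> t = 1 / sqrt (1 + \<beta> * t\<^sup>2)"

lemma isr_0 [simp]: "isr \<beta> 0 = 1"
  by (simp add: isr_def)

lemma isr_pos: "1 + \<beta> * t\<^sup>2 > 0 \<Longrightarrow> isr \<beta> t > 0"
  by (simp add: isr_def)

lemma isr_square: "1 + \<beta> * t\<^sup>2 > 0 \<Longrightarrow> (isr \<beta> t)\<^sup>2 * (1 + \<beta> * t\<^sup>2) = 1"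
  by (simp add: isr_def power_divide)

lemma isr_has_derivative:
  assumes "1 + \<beta> * t\<^sup>2 > 0"
  shows "(isr \<beta> has_derivative (\<lambda>v. (- \<beta> * t * (isr \<beta> t)^3) * v)) (at t)"
proof -
  have s: "sqrt (1 + \<beta> * t\<^sup>2) > 0" "(sqrt (1 + \<beta> * t\<^sup>2))\<^sup>2 = 1 + \<beta> * t\<^sup>2" using assms by auto
  have "(isr \<beta> has_real_derivative
      - (inverse (sqrt (1 + \<beta> * t\<^sup>2)) / 2 * (\<beta> * (2 * t))) / (sqrt (1 + \<beta> * t\<^sup>2))\<^sup>2) (at t)"
    unfolding isr_def[abs_def] using assms
    by (auto intro!: derivative_eq_intros simp: power2_eq_square)
  moreover have "- (inverse (sqrt (1 + \<beta> * t\<^sup>2)) / 2 * (\<beta> * (2 * t))) / (sqrt (1 + \<beta> * t\<^sup>2))\<^sup>2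
      = - \<beta> * t * (isr \<beta> t)^3"
    using s(1) by (simp add: isr_def power3_eq_cube power2_eq_square field_simps)
  ultimately show ?thesis by (simp only: has_field_derivative_def)
qed

lemma open_isr_domain: "open {t. 1 + \<beta> * t\<^sup>2 > (0::real)}"
  by (intro open_Collect_less continuous_intros)

lemma Cinf_isr: "Cinf {t. 1 + \<beta> * t\<^sup>2 > 0} (isr \<beta>)"
proof -
  let ?S = "{t. 1 + \<beta> * t\<^sup>2 > (0::real)}"
  note mult = Ck_on_bounded_bilinear[OF bounded_bilinear_mult open_isr_domain]
  have "Ck_on k ?S (isr \<beta>)" for k
  proof (induction k)
    case 0
    show ?case
      unfolding Ck_on.simps(1) continuous_on_eq_continuous_at[OF open_isr_domain]
      using has_derivative_continuous[OF isr_has_derivative] by blast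
  next
    case (Suc k)
    show ?case
    proof (rule Ck_on_SucI[OF open_isr_domain])
      show "(isr \<beta> has_derivative (\<lambda>v. (- \<beta> * t * (isr \<beta> t * (isr \<beta> t * isr \<beta> t))) * v)) (at t)" if "t \<in> ?S" for t
        using isr_has_derivative[of \<beta> t] that by (simp add: power3_eq_cube mult.assoc)
      have "Ck_on k ?S (\<lambda>t. t)"
        using Cinf_id[OF open_isr_domain] unfolding Cinf_def by blast
      then show "Ck_on k ?S (\<lambda>t. (- \<beta> * t * (isr \<beta> t * (isr \<beta> t * isr \<beta> t))) * v)" for v
        using Suc by (intro mult Ck_on_const)
    qed
  qed
  then show ?thesis by (simp add: Cinf_def)
qed

lemma isr_inverse:
  assumes "1 + \<beta> * t\<^sup>2 > 0"
  shows "1 + (- \<beta>) * (t * isr \<beta> t)\<^sup>2 > 0" "(t * isr \<beta> t) * isr (- \<beta>) (t * isr \<beta> t) = t"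
proof -
  have e: "1 + (- \<beta>) * (t * isr \<beta> t)\<^sup>2 = (isr \<beta> t)\<^sup>2"
    using isr_square[OF assms] by (simp add: power_mult_distrib algebra_simps)
  then show "1 + (- \<beta>) * (t * isr \<beta> t)\<^sup>2 > 0" using isr_pos[OF assms] by simp
  have "isr (- \<beta>) (t * isr \<beta> t) = 1 / isr \<beta> t"
    unfolding isr_def[of "- \<beta>"] e using isr_pos[OF assms] by simp
  then show "(t * isr \<beta> t) * isr (- \<beta>) (t * isr \<beta> t) = t" using isr_pos[OF assms] by simp
qed

text \<open>With \<open>s = l \<bullet> (y - y0)\<close>, the map moves \<open>y\<close> along \<open>w\<close> so that \<open>s\<close> becomes
  \<open>s / sqrt (1 + \<beta> s\<^sup>2)\<close>; the inverse map is obtained by changing the sign of \<open>\<beta>\<close>.\<close>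

locale shear =
  fixes y0 l w :: "real^'n::finite"
  assumes lw: "l \<bullet> w \<noteq> 0"
begin

definition s where "s y = l \<bullet> (y - y0)"

definition sdom :: "real \<Rightarrow> (real^'n) set" where "sdom \<beta> = {y. 1 + \<beta> * (s y)\<^sup>2 > 0}"

definition sh :: "real \<Rightarrow> real^'n \<Rightarrow> real^'n" where
  "sh \<beta> y = y + (s y * (isr \<beta> (s y) - 1) / (l \<bullet> w)) *\<^sub>R w"

lemma s_y0 [simp]: "s y0 = 0" and sh_y0 [simp]: "sh \<beta> y0 = y0" and y0_sdom [simp]: "y0 \<in> sdom \<beta>"
  by (simp_all add: s_def sh_def sdom_def)

lemma s_has_derivative: "(s has_derivative (\<lambda>v. l \<bullet> v)) (at y)"
  unfolding s_def[abs_def] by (auto intro!: derivative_eq_intros)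

lemma Cinf_s: "open S \<Longrightarrow> Cinf S s"
  unfolding s_def[abs_def]
  by (intro Cinf_bounded_linear_compose[OF bounded_linear_inner_right] Cinf_diff Cinf_id Cinf_const)

lemma open_sdom: "open (sdom \<beta>)"
  unfolding sdom_def s_def by (intro open_Collect_less continuous_intros)

lemma s_sh: "s (sh \<beta> y) = s y * isr \<beta> (s y)"
proof -
  have "s (sh \<beta> y) = s y + s y * (isr \<beta> (s y) - 1) / (l \<bullet> w) * (l \<bullet> w)"
    unfolding s_def[of "sh \<beta> y"] s_def[of y] sh_def by (simp add: inner_add_right inner_diff_right s_def)
  then show ?thesis using lw by (simp add: field_simps)
qed

lemma sh_inverse:
  assumes "y \<in> sdom \<beta>"
  shows "sh \<beta> y \<in> sdom (- \<beta>)" "sh (- \<beta>) (sh \<beta> y) = y"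
proof -
  note i = isr_inverse[of \<beta> "s y"]
  have y: "1 + \<beta> * (s y)\<^sup>2 > 0" using assms by (simp add: sdom_def)
  show "sh \<beta> y \<in> sdom (- \<beta>)" using i(1)[OF y] by (simp add: sdom_def s_sh)
  have "s (sh \<beta> y) * (isr (- \<beta>) (s (sh \<beta> y)) - 1) = s y - s y * isr \<beta> (s y)"
    unfolding s_sh right_diff_distrib i(2)[OF y] by simp
  then have "sh (- \<beta>) (sh \<beta> y) = sh \<beta> y + ((s y - s y * isr \<beta> (s y)) / (l \<bullet> w)) *\<^sub>R w"
    unfolding sh_def[of "- \<beta>"] by simp
  also have "\<dots> = y" unfolding sh_def[of \<beta>] by (simp add: scaleR_add_left[symmetric] add_divide_distrib[symmetric] algebra_simps)
  finally show "sh (- \<beta>) (sh \<beta> y) = y" .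
qed

lemma Cinf_isr_s: "Cinf (sdom \<beta>) (\<lambda>y. isr \<beta> (s y))"
  by (rule Cinf_compose[OF open_sdom open_isr_domain _ Cinf_isr Cinf_s[OF open_sdom]]) (auto simp: sdom_def)

lemma isr_s_has_derivative:
  assumes "y \<in> sdom \<beta>"
  shows "((\<lambda>y. isr \<beta> (s y)) has_derivative (\<lambda>v. (- \<beta> * s y * (isr \<beta> (s y))^3) * (l \<bullet> v))) (at y)"
  using has_derivative_compose[OF s_has_derivative isr_has_derivative] assms by (simp add: sdom_def)

lemma Cinf_sh: "Cinf (sdom \<beta>) (sh \<beta>)"
proof -
  have "Cinf (sdom \<beta>) (\<lambda>y. y + (s y * (isr \<beta> (s y) - 1) * (1 / (l \<bullet> w))) *\<^sub>R w)"
    by (intro Cinf_add Cinf_scaleR Cinf_mult Cinf_diff Cinf_const Cinf_id Cinf_s Cinf_isr_s open_sdom)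
  then show ?thesis by (simp add: sh_def[abs_def])
qed

text \<open>The derivative of \<open>t * isr \<beta> t\<close> is \<open>(isr \<beta> t)^3\<close>,
  because \<open>(isr \<beta> t)\<^sup>2 * (1 + \<beta> * t\<^sup>2) = 1\<close>. As the shear moves
  points along \<open>w\<close> by a function of \<open>s\<close> alone, its Jacobian is a rank-one
  change of the identity.\<close>

lemma jacobian_sh:
  assumes "y \<in> sdom \<beta>"
  shows "jacobian (sh \<beta>) (at y) = mat 1 + (((isr \<beta> (s y))^3 - 1) / (l \<bullet> w)) *\<^sub>R outer w l"
proof (rule jacobian_eqI)
  let ?\<phi> = "isr \<beta> (s y)"
  have e: "?\<phi>^3 = ?\<phi> - \<beta> * (s y)\<^sup>2 * ?\<phi>^3"
  proof -
    have y: "1 + \<beta> * (s y)\<^sup>2 > 0" using assms by (simp add: sdom_def)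
    have "?\<phi>^3 * (1 + \<beta> * (s y)\<^sup>2) = ?\<phi> * (?\<phi>\<^sup>2 * (1 + \<beta> * (s y)\<^sup>2))"
      by (simp add: power3_eq_cube power2_eq_square)
    also have "\<dots> = ?\<phi>" by (simp only: isr_square[OF y] mult_1_right)
    finally show ?thesis by (simp add: algebra_simps)
  qed
  have "(sh \<beta> has_derivative (\<lambda>v. v + ((s y * ((- \<beta> * s y * ?\<phi>^3) * (l \<bullet> v)) + (l \<bullet> v) * (?\<phi> - 1)) / (l \<bullet> w)) *\<^sub>R w)) (at y)"
    unfolding sh_def[abs_def]
    by (rule derivative_eq_intros s_has_derivative isr_s_has_derivative[OF assms] refl | use lw in \<open>simp add: fun_eq_iff\<close>)+
  moreover have "v + ((s y * ((- \<beta> * s y * ?\<phi>^3) * (l \<bullet> v)) + (l \<bullet> v) * (?\<phi> - 1)) / (l \<bullet> w)) *\<^sub>R w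
      = (mat 1 + ((?\<phi>^3 - 1) / (l \<bullet> w)) *\<^sub>R outer w l) *v v" for v
  proof -
    have o: "outer w l *v v = (l \<bullet> v) *\<^sub>R w"
      by (simp add: vec_eq_iff matrix_vector_mult_def inner_vec_def sum_distrib_left mult.left_commute mult.commute)
    have "s y * ((- \<beta> * s y * ?\<phi>^3) * (l \<bullet> v)) + (l \<bullet> v) * (?\<phi> - 1) = (?\<phi>^3 - 1) * (l \<bullet> v)"
      by (subst (2) e) (simp add: algebra_simps power2_eq_square)
    then show ?thesis
      by (simp add: matrix_vector_mult_add_rdistrib o flip: scaleR_matrix_vector_assoc)
  qed
  ultimately show "(sh \<beta> has_derivative (\<lambda>h. (mat 1 + ((?\<phi>^3 - 1) / (l \<bullet> w)) *\<^sub>R outer w l) *v h)) (at y)"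
    by simp
qed

lemma van_1: "f y0 = 0 \<Longrightarrow> van 1 y0 f"
  by (simp add: van.simps)

lemma van_s: "van 1 y0 s"
  by (rule van_1) simp

lemma van_Suc_if_pd:
  assumes "open S" "y0 \<in> S" "Cinf S f" "f y0 = 0"
    and "\<And>i y. y \<in> S \<Longrightarrow> pd i f y = g i y" "\<And>i. Cinf S (g i)" "\<And>i. van k y0 (g i)"
  shows "van (Suc k) y0 f"
  using van_cong[OF assms(1,2,6) assms(5)[symmetric] assms(7)] assms(4) by (simp add: van.simps)

lemma van_isr_s: "van 2 y0 (\<lambda>y. isr \<beta> (s y) - 1)"
proof -
  have "van (Suc 1) y0 (\<lambda>y. isr \<beta> (s y) - 1)"
  proof (rule van_Suc_if_pd[OF open_sdom[of \<beta>] y0_sdom])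
    show "pd i (\<lambda>y. isr \<beta> (s y) - 1) y = - \<beta> * s y * (isr \<beta> (s y))^3 * l $ i" if "y \<in> sdom \<beta>" for i y
      using pd_eq[OF has_derivative_diff[OF isr_s_has_derivative[OF that] has_derivative_const[of 1]], of i]
      by (simp add: inner_axis)
    show "Cinf (sdom \<beta>) (\<lambda>y. - \<beta> * s y * (isr \<beta> (s y))^3 * l $ i)" for i
      by (intro Cinf_mult Cinf_power Cinf_const Cinf_s Cinf_isr_s open_sdom)
    show "van 1 y0 (\<lambda>y. - \<beta> * s y * (isr \<beta> (s y))^3 * l $ i)" for i by (rule van_1) simp
  qed (simp_all add: Cinf_diff Cinf_const Cinf_isr_s open_sdom)
  then show ?thesis by (simp add: numeral_2_eq_2)
qed

text \<open>The displacement is a product of \<open>s\<close>, of order 1, and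
  \<open>isr \<beta> (s y) - 1\<close>, of order 2: the shear has the 2-jet of the identity.\<close>

lemma van_sh: "van 3 y0 (\<lambda>y. sh \<beta> y - y)"
proof -
  have "van (1 + 2) y0 (\<lambda>y. s y * (isr \<beta> (s y) - 1))"
    by (rule van_bilinear[OF bounded_bilinear_mult open_sdom[of \<beta>] y0_sdom _ _ van_s van_isr_s])
      (intro Cinf_diff Cinf_const Cinf_s Cinf_isr_s open_sdom)+
  then have v: "van 3 y0 (\<lambda>y. s y * (isr \<beta> (s y) - 1))" by (simp add: numeral_3_eq_3)
  have "bounded_linear (\<lambda>t. (t / (l \<bullet> w)) *\<^sub>R w)"
    by (intro bounded_linear_scaleR_const bounded_linear_divide)
  from van_linear[OF this open_sdom[of \<beta>] y0_sdom _ v]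
  show ?thesis
    unfolding sh_def using Cinf_mult Cinf_diff Cinf_const Cinf_s Cinf_isr_s open_sdom
    by (simp add: Cinf_mult Cinf_diff Cinf_const Cinf_s Cinf_isr_s open_sdom)
qed

text \<open>For this value of \<open>\<beta>\<close> the Jacobian of the shear is \<open>mat 1 + (s\<^sup>2 / 2) *\<^sub>R outer w l\<close> up to third order.\<close>

abbreviation "\<chi>s \<equiv> \<lambda>y. ((isr (- (l \<bullet> w) / 3) (s y))^3 - 1) / (l \<bullet> w)"
abbreviation "shdom \<equiv> sdom (- (l \<bullet> w) / 3)"

lemma Cinf_\<chi>s: "Cinf shdom \<chi>s"
proof -
  have "Cinf shdom (\<lambda>y. ((isr (- (l \<bullet> w) / 3) (s y))^3 - 1) * (1 / (l \<bullet> w)))"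
    by (intro Cinf_mult Cinf_power Cinf_diff Cinf_const Cinf_isr_s open_sdom)
  then show ?thesis by simp
qed

text \<open>To second order the cube of \<open>isr \<beta> (s y)\<close> is
  \<open>1 - 3/2 * \<beta> * (s y)\<^sup>2\<close>; the chosen \<open>\<beta>\<close> turns the
  quotient by \<open>l \<bullet> w\<close> into \<open>(s y)\<^sup>2 / 2\<close>.\<close>

lemma van_\<chi>s: "van 3 y0 (\<lambda>y. \<chi>s y - (s y)\<^sup>2 / 2)" "van 2 y0 \<chi>s"
proof -
  let ?\<beta> = "- (l \<bullet> w) / 3"
  let ?\<phi> = "\<lambda>y. isr ?\<beta> (s y)"
  have "van (Suc 2) y0 (\<lambda>y. \<chi>s y - (s y)\<^sup>2 / 2)"
  proof (rule van_Suc_if_pd[OF open_sdom[of ?\<beta>] y0_sdom])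
    show "pd i (\<lambda>y. \<chi>s y - (s y)\<^sup>2 / 2) y = l $ i * (s y * ((?\<phi> y)^5 - 1))" if y: "y \<in> shdom" for i y
    proof -
      have "((\<lambda>y. \<chi>s y - (s y)\<^sup>2 / 2) has_derivative
          (\<lambda>v. (3 * (?\<phi> y)\<^sup>2 * ((- ?\<beta> * s y * (?\<phi> y)^3) * (l \<bullet> v))) / (l \<bullet> w) - s y * (l \<bullet> v))) (at y)"
        by (rule derivative_eq_intros s_has_derivative isr_s_has_derivative[OF y] refl
            | use lw in \<open>simp add: fun_eq_iff power2_eq_square\<close>)+
      from pd_eq[OF this, of i] show ?thesis
        using lw by (simp add: inner_axis field_simps eval_nat_numeral)
    qed
    have C: "Cinf shdom (\<lambda>y. (?\<phi> y)^5 - 1)" "Cinf shdom s"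
      by (intro Cinf_power Cinf_diff Cinf_const Cinf_s Cinf_isr_s open_sdom)+
    then show "Cinf shdom (\<lambda>y. l $ i * (s y * ((?\<phi> y)^5 - 1)))" for i
      by (intro Cinf_mult Cinf_const open_sdom)
    have "van (1 + 1) y0 (\<lambda>y. s y * ((?\<phi> y)^5 - 1))"
      by (rule van_bilinear[OF bounded_bilinear_mult open_sdom[of ?\<beta>] y0_sdom C(2,1) van_s van_1]) simp
    then have "van 2 y0 (\<lambda>y. s y * ((?\<phi> y)^5 - 1))" by (simp add: numeral_2_eq_2)
    then show "van 2 y0 (\<lambda>y. l $ i * (s y * ((?\<phi> y)^5 - 1)))" for i
      by (rule van_linear[OF bounded_linear_mult_right open_sdom[of ?\<beta>] y0_sdom Cinf_mult[OF open_sdom C(2,1)]])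
    show "Cinf shdom (\<lambda>y. \<chi>s y - (s y)\<^sup>2 / 2)"
    proof -
      have "Cinf shdom (\<lambda>y. \<chi>s y - (s y)\<^sup>2 * (1 / 2))"
        by (intro Cinf_diff Cinf_mult Cinf_power Cinf_const Cinf_s Cinf_\<chi>s open_sdom)
      then show ?thesis by simp
    qed
  qed simp
  then show v3: "van 3 y0 (\<lambda>y. \<chi>s y - (s y)\<^sup>2 / 2)" by (simp add: numeral_3_eq_3 numeral_2_eq_2)
  have "van (1 + 1) y0 (\<lambda>y. s y * s y)"
    by (rule van_bilinear[OF bounded_bilinear_mult open_UNIV UNIV_I Cinf_s Cinf_s van_s van_s]) auto
  then have "van 2 y0 (\<lambda>y. s y * s y)" by (simp add: numeral_2_eq_2)
  then have "van 2 y0 (\<lambda>y. s y * s y * (1/2))"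
    by (rule van_linear[OF bounded_linear_mult_left open_UNIV UNIV_I
          Cinf_mult[OF open_UNIV Cinf_s[OF open_UNIV] Cinf_s[OF open_UNIV]]])
  then have s2: "van 2 y0 (\<lambda>y. (s y)\<^sup>2 * (1/2))" by (simp only: power2_eq_square)
  have C2: "Cinf shdom (\<lambda>y. (s y)\<^sup>2 * (1/2))"
    by (intro Cinf_mult Cinf_power Cinf_const Cinf_s open_sdom)
  have "van 2 y0 (\<lambda>y. (\<chi>s y - (s y)\<^sup>2 * (1/2)) + (s y)\<^sup>2 * (1/2))"
    by (rule van_add[OF open_sdom[of ?\<beta>] y0_sdom Cinf_diff[OF open_sdom Cinf_\<chi>s C2] C2 _ s2])
      (use van_mono[OF v3, of 2] in simp)
  then show "van 2 y0 \<chi>s" by simp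
qed

end

lemma matrix_congruence_expand:
  fixes P X Y :: "real^'n::finite^'n"
  shows "(mat 1 + a *\<^sub>R X) ** P ** (mat 1 + a *\<^sub>R Y)
    = P + a *\<^sub>R (X ** P + P ** Y) + (a * a) *\<^sub>R (X ** P ** Y)"
proof -
  interpret bounded_bilinear "(**) :: real^'n^'n \<Rightarrow> real^'n^'n \<Rightarrow> real^'n^'n"
    by (rule bounded_bilinear_matrix_mult)
  show ?thesis by (simp add: add_left add_right scaleR_left scaleR_right algebra_simps)
qed

context shear
begin

abbreviation "\<beta>0 \<equiv> - (l \<bullet> w) / 3"

text \<open>Expanding the congruence gives
  \<open>P + \<chi>s (X P + P Y) + \<chi>s\<^sup>2 X P Y\<close>. Up to order 3, \<open>P\<close> is
  \<open>Q\<close>, the factor \<open>\<chi>s\<close> is half of \<open>s\<^sup>2\<close>, the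
  quadratic term disappears, and in the middle term \<open>P\<close> may be frozen at
  \<open>Q y0\<close>. What remains is a change of the second derivatives of the metric
  alone.\<close>

lemma van_pullback:
  assumes Q: "Cinf UNIV Q" "transpose (Q y0) = Q y0"
  shows "van 3 y0 (\<lambda>y. transpose (jacobian (sh \<beta>0) (at y)) ** Q (sh \<beta>0 y) ** jacobian (sh \<beta>0) (at y)
    - (Q y + ((s y)\<^sup>2 * (1/2)) *\<^sub>R (outer (Q y0 *v w) l + outer l (Q y0 *v w))))"
proof -
  define X Y where "X = outer l w" and "Y = outer w l"
  define P where "P y = Q (sh \<beta>0 y)" for y
  define B where "B M = X ** M + M ** Y" for M
  define C where "C M = X ** M ** Y" for M
  note mm = bounded_bilinear_matrix_mult
  have BL: "bounded_linear B" unfolding B_def[abs_def]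
    by (intro bounded_linear_add bounded_bilinear.bounded_linear_right[OF mm] bounded_bilinear.bounded_linear_left[OF mm])
  have CL: "bounded_linear C" unfolding C_def[abs_def]
    by (rule bounded_linear_compose[OF bounded_bilinear.bounded_linear_left[OF mm] bounded_bilinear.bounded_linear_right[OF mm]])
  have B0: "B (Q y0) = outer (Q y0 *v w) l + outer l (Q y0 *v w)"
  proof -
    have sym: "Q y0 $ i $ j = Q y0 $ j $ i" for i j using Q(2) unfolding transpose_eq_iff by blast
    have "(Q y0 ** Y) $ i $ j = outer (Q y0 *v w) l $ i $ j" for i j
      by (simp add: Y_def matrix_matrix_mult_def matrix_vector_mult_def sum_distrib_right mult.assoc)
    moreover have "(X ** Q y0) $ i $ j = outer l (Q y0 *v w) $ i $ j" for i j
      unfolding X_def matrix_matrix_mult_def matrix_vector_mult_def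
      by (simp add: sum_distrib_left sym[of _ j] mult.commute mult.left_commute)
    ultimately show ?thesis unfolding B_def by (simp add: vec_eq_iff)
  qed
  note o = open_sdom[of \<beta>0] y0_sdom[of \<beta>0]
  have QU: "Cinf shdom Q" by (rule Cinf_subset[OF Q(1)]) simp
  have PU: "Cinf shdom P" unfolding P_def[abs_def]
    by (rule Cinf_compose[OF o(1) open_UNIV _ Q(1) Cinf_sh]) simp
  have BP: "Cinf shdom (\<lambda>y. B (P y))" "Cinf shdom (\<lambda>y. C (P y))"
    by (rule Cinf_bounded_linear_compose[OF BL o(1) PU], rule Cinf_bounded_linear_compose[OF CL o(1) PU])
  have PQ: "Cinf shdom (\<lambda>y. P y - Q y0)" by (intro Cinf_diff Cinf_const PU o(1))
  have s2: "Cinf shdom (\<lambda>y. (s y)\<^sup>2 * (1/2))"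
    by (intro Cinf_mult Cinf_power Cinf_const Cinf_s o(1))
  have c1: "Cinf shdom (\<lambda>y. \<chi>s y - (s y)\<^sup>2 * (1/2))" by (intro Cinf_diff Cinf_\<chi>s s2 o(1))
  have c2: "Cinf shdom (\<lambda>y. \<chi>s y * \<chi>s y)" by (intro Cinf_mult Cinf_\<chi>s o(1))
  have v1: "van 3 y0 (\<lambda>y. P y - Q y)"
    unfolding P_def
    by (rule van_compose_near_id[OF o open_UNIV _ _ Cinf_sh Q(1) van_sh]) simp_all
  have v2: "van 3 y0 (\<lambda>y. (\<chi>s y - (s y)\<^sup>2 * (1/2)) *\<^sub>R B (P y))"
    using van_bilinear[OF bounded_bilinear_scaleR o c1 BP(1), of 3 0] van_\<chi>s(1) by simp
  have vs: "van 2 y0 (\<lambda>y. (s y)\<^sup>2 * (1/2))"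
    using van_diff[OF o Cinf_\<chi>s c1 van_\<chi>s(2), OF van_mono[of 3]] van_\<chi>s(1) by simp
  have "van 1 y0 (\<lambda>y. P y - Q y0)" by (rule van_1) (simp add: P_def)
  then have "van 1 y0 (\<lambda>y. B (P y - Q y0))" by (rule van_linear[OF BL o PQ])
  from van_bilinear[OF bounded_bilinear_scaleR o s2 Cinf_bounded_linear_compose[OF BL o(1) PQ] vs this]
  have v3: "van 3 y0 (\<lambda>y. ((s y)\<^sup>2 * (1/2)) *\<^sub>R B (P y - Q y0))" by (simp add: numeral_3_eq_3 numeral_2_eq_2)
  have "van (2 + 2) y0 (\<lambda>y. \<chi>s y * \<chi>s y)"
    by (rule van_bilinear[OF bounded_bilinear_mult o Cinf_\<chi>s Cinf_\<chi>s van_\<chi>s(2) van_\<chi>s(2)])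
  then have "van 3 y0 (\<lambda>y. \<chi>s y * \<chi>s y)" by (rule van_mono) simp
  from van_bilinear[OF bounded_bilinear_scaleR o c2 BP(2) this, of 0]
  have v4: "van 3 y0 (\<lambda>y. (\<chi>s y * \<chi>s y) *\<^sub>R C (P y))" by (simp add: van.simps)
  \<comment> \<open>The four summands are the errors of these four replacements.\<close>
  define R where "R y = (P y - Q y) + (\<chi>s y - (s y)\<^sup>2 * (1/2)) *\<^sub>R B (P y)
     + ((s y)\<^sup>2 * (1/2)) *\<^sub>R B (P y - Q y0) + (\<chi>s y * \<chi>s y) *\<^sub>R C (P y)" for y
  have d: "Cinf shdom (\<lambda>y. P y - Q y)" by (intro Cinf_diff PU QU o(1))
  have d2: "Cinf shdom (\<lambda>y. (\<chi>s y - (s y)\<^sup>2 * (1/2)) *\<^sub>R B (P y))" by (rule Cinf_scaleR[OF o(1) c1 BP(1)])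
  have d3: "Cinf shdom (\<lambda>y. ((s y)\<^sup>2 * (1/2)) *\<^sub>R B (P y - Q y0))"
    by (rule Cinf_scaleR[OF o(1) s2 Cinf_bounded_linear_compose[OF BL o(1) PQ]])
  have d4: "Cinf shdom (\<lambda>y. (\<chi>s y * \<chi>s y) *\<^sub>R C (P y))" by (rule Cinf_scaleR[OF o(1) c2 BP(2)])
  have R: "Cinf shdom R" unfolding R_def[abs_def] by (intro Cinf_add d d2 d3 d4 o(1))
  have vR: "van 3 y0 R" unfolding R_def[abs_def]
    by (intro van_add[OF o] Cinf_add d d2 d3 d4 v1 v2 v3 v4 o(1))
  show ?thesis
  proof (rule van_cong[OF o R _ vR])
    fix y assume y: "y \<in> shdom"
    have t: "transpose (mat 1 + a *\<^sub>R outer w l) = mat 1 + a *\<^sub>R outer l w" for a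
      by (simp add: vec_eq_iff transpose_def mat_def mult.commute)
    show "R y = transpose (jacobian (sh \<beta>0) (at y)) ** Q (sh \<beta>0 y) ** jacobian (sh \<beta>0) (at y)
      - (Q y + ((s y)\<^sup>2 * (1/2)) *\<^sub>R (outer (Q y0 *v w) l + outer l (Q y0 *v w)))"
      unfolding jacobian_sh[OF y] t matrix_congruence_expand B0[symmetric]
      unfolding R_def P_def[symmetric] X_def[symmetric] Y_def[symmetric] B_def[symmetric] C_def[symmetric]
        linear_diff[OF bounded_linear.linear[OF BL]]
      by (simp add: scaleR_diff_left scaleR_diff_right)
  qed
qed

end

section \<open>Diffeomorphisms in a chart\<close>

context atlas
begin

lemma smooth_map_on_overlap:
  assumes f: "smooth_map_on A U f" "open U" and cd: "c \<in> A" "d \<in> A"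
  shows "open (snd c ` {x \<in> U \<inter> fst c. f x \<in> fst d})"
    and "Cinf (snd c ` {x \<in> U \<inter> fst c. f x \<in> fst d}) (\<lambda>y. snd d (f (cinv c y)))"
proof -
  have "open (U \<inter> f -` fst d)"
    using continuous_open_preimage[OF _ f(2) open_dom[OF cd(2)]] f(1) unfolding smooth_map_on_def by blast
  moreover have "{x \<in> U \<inter> fst c. f x \<in> fst d} = (U \<inter> f -` fst d) \<inter> fst c" by auto
  ultimately show o: "open (snd c ` {x \<in> U \<inter> fst c. f x \<in> fst d})"
    using open_chart_image[OF cd(1)] by simp
  have "smooth_on (snd c ` {x \<in> U \<inter> fst c. f x \<in> fst d}) (snd d \<circ> f \<circ> cinv c)"
    using f(1) cd unfolding smooth_map_on_def by blast
  then show "Cinf (snd c ` {x \<in> U \<inter> fst c. f x \<in> fst d}) (\<lambda>y. snd d (f (cinv c y)))"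
    by (simp only: smooth_on_open[OF o] comp_def)
qed

lemma jac_compose_source:
  assumes f: "smooth_map_on A U f" "open U" and cde: "c \<in> A" "d \<in> A" "e \<in> A"
    and y: "y \<in> U" "y \<in> fst c" "y \<in> fst d" "f y \<in> fst e"
  shows "jac d e f y = jac c e f y ** jac d c id y"
proof -
  have "jac d e (f \<circ> id) y = jac c e f (id y) ** jac d c id y"
  proof (rule jac_compose[OF cde(2,1) y(3) open_overlap[OF cde(2,1)]])
    show "id (cinv d u) \<in> fst c" if "u \<in> snd d ` (fst d \<inter> fst c)" for u
      using cinv_image[OF cde(2) _ that] by simp
    have "snd c y \<in> snd c ` {x \<in> U \<inter> fst c. f x \<in> fst e}" using y by blast
    then show "(\<lambda>y. snd e (f (cinv c y))) differentiable (at (snd c (id y)))"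
      using Cinf_differentiable[OF smooth_map_on_overlap(2)[OF f cde(1,3)] smooth_map_on_overlap(1)[OF f cde(1,3)]]
      by simp
  qed (use y transition_differentiable[OF cde(2,1)] in auto)
  then show ?thesis by simp
qed

lemma jac_compose_target:
  assumes f: "smooth_map_on A U f" "open U" and cde: "c \<in> A" "d \<in> A" "e \<in> A"
    and y: "y \<in> U" "y \<in> fst d" "f y \<in> fst c" "f y \<in> fst e"
  shows "jac d e f y = jac c e id (f y) ** jac d c f y"
proof -
  have "jac d e (id \<circ> f) y = jac c e id (f y) ** jac d c f y"
  proof (rule jac_compose[OF cde(2,1) y(2) smooth_map_on_overlap(1)[OF f cde(2,1)]])
    show in_S: "snd d y \<in> snd d ` {x \<in> U \<inter> fst d. f x \<in> fst c}" using y by blast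
    show "f (cinv d u) \<in> fst c" if "u \<in> snd d ` {x \<in> U \<inter> fst d. f x \<in> fst c}" for u
      using cinv_image[OF cde(2) _ that] by blast
    show "(\<lambda>y. snd c (f (cinv d y))) differentiable (at (snd d y))"
      by (rule Cinf_differentiable[OF smooth_map_on_overlap(2)[OF f cde(2,1)]
            smooth_map_on_overlap(1)[OF f cde(2,1)] in_S])
  qed (use transition_differentiable[OF cde(1,3) y(3,4)] in simp)
  then show ?thesis by simp
qed

lemma jac_chart_map:
  assumes "c \<in> A" "open Y" "Y \<subseteq> snd c ` fst c" "Cinf Y \<Phi>" "\<Phi> ` Y \<subseteq> snd c ` fst c" "z \<in> Y"
    and f: "\<And>x. x \<in> cinv c ` Y \<Longrightarrow> f x = cinv c (\<Phi> (snd c x))"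
  shows "jac c c f (cinv c z) = jacobian \<Phi> (at z)"
proof -
  have "jacobian \<Phi> (at z) = jacobian (\<lambda>y. snd c (f (cinv c y))) (at z)"
  proof (rule jacobian_cong[OF Cinf_differentiable[OF assms(4,2,6)] assms(2,6)])
    fix u assume u: "u \<in> Y"
    then have im: "u \<in> snd c ` fst c" "\<Phi> u \<in> snd c ` fst c" using assms(3,5) by blast+
    show "\<Phi> u = snd c (f (cinv c u))"
      using f[of "cinv c u"] u chart_cinv[OF im(1)] chart_cinv[OF im(2)] by simp
  qed
  moreover have "snd c (cinv c z) = z" using assms(3,6) by (intro chart_cinv) blast
  ultimately show ?thesis by (simp add: jac_eq)
qed

lemma smooth_map_on_chart:
  assumes c: "c \<in> A" and Y: "open Y" "Y \<subseteq> snd c ` fst c" and \<Phi>: "Cinf Y \<Phi>" "\<Phi> ` Y \<subseteq> snd c ` fst c"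
    and f: "\<And>x. x \<in> cinv c ` Y \<Longrightarrow> f x = cinv c (\<Phi> (snd c x))"
  shows "smooth_map_on A (cinv c ` Y) f"
proof -
  let ?U = "cinv c ` Y"
  have U: "x \<in> fst c" "snd c x \<in> Y" if xU: "x \<in> ?U" for x
  proof -
    obtain y where "y \<in> Y" "x = cinv c y" using xU by blast
    then show "x \<in> fst c" "snd c x \<in> Y" using Y(2) chart_cinv[of y c] cinv_in[of y c] by auto
  qed
  have oU: "open ?U" by (rule open_cinv_image[OF c Y])
  have "continuous_on ?U (\<lambda>x. cinv c (\<Phi> (snd c x)))"
  proof (rule continuous_on_compose2[OF continuous_cinv[OF c]])
    show "continuous_on ?U (\<lambda>x. \<Phi> (snd c x))"
      by (rule continuous_on_compose2[OF Cinf_continuous_on[OF \<Phi>(1)] continuous_on_subset[OF continuous_chart[OF c]]])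
        (use U in auto)
    show "(\<lambda>x. \<Phi> (snd c x)) ` ?U \<subseteq> snd c ` fst c" using U(2) \<Phi>(2) by blast
  qed
  then have cont: "continuous_on ?U f" by (rule continuous_on_eq) (simp add: f)
  have "smooth_on (snd d ` {x \<in> ?U \<inter> fst d. f x \<in> fst e}) (snd e \<circ> f \<circ> cinv d)" if de: "d \<in> A" "e \<in> A" for d e
  proof -
    let ?V = "snd d ` {x \<in> ?U \<inter> fst d. f x \<in> fst e}"
    have "open (?U \<inter> f -` fst e)" by (rule continuous_open_preimage[OF cont oU open_dom[OF de(2)]])
    moreover have "{x \<in> ?U \<inter> fst d. f x \<in> fst e} = (?U \<inter> f -` fst e) \<inter> fst d" by auto
    ultimately have V: "open ?V" using open_chart_image[OF de(1)] by simp
    let ?t = "\<lambda>y. snd c (cinv d y)"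
    have pts: "?t y \<in> Y" "\<Phi> (?t y) \<in> snd c ` (fst c \<inter> fst e)" "snd e (f (cinv d y)) = snd e (cinv c (\<Phi> (?t y)))"
      "y \<in> snd d ` (fst d \<inter> fst c)" if yV: "y \<in> ?V" for y
    proof -
      obtain z where z: "z \<in> ?U" "z \<in> fst d" "f z \<in> fst e" "y = snd d z" using yV by auto
      have cz: "cinv d y = z" using z cinv_chart[OF de(1)] by simp
      show tY: "?t y \<in> Y" using U(2)[OF z(1)] cz by simp
      have fz: "f z = cinv c (\<Phi> (?t y))" using f[OF z(1)] cz by simp
      have im: "\<Phi> (?t y) \<in> snd c ` fst c" using \<Phi>(2) tY by blast
      have "\<Phi> (?t y) = snd c (f z)" using chart_cinv[OF im] fz by simp
      moreover have "f z \<in> fst c" using fz cinv_in[OF im] by simp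
      ultimately show "\<Phi> (?t y) \<in> snd c ` (fst c \<inter> fst e)" using z(3) by blast
      show "snd e (f (cinv d y)) = snd e (cinv c (\<Phi> (?t y)))" using cz fz by simp
      show "y \<in> snd d ` (fst d \<inter> fst c)" using z U(1)[OF z(1)] by blast
    qed
    have t: "Cinf ?V ?t" by (rule Cinf_subset[OF Cinf_transition[OF de(1) c]]) (use pts(4) in blast)
    have "Cinf ?V (\<lambda>y. \<Phi> (?t y))" by (rule Cinf_compose[OF V Y(1) _ \<Phi>(1) t]) (use pts(1) in blast)
    from Cinf_compose[OF V open_overlap[OF c de(2)] _ Cinf_transition[OF c de(2)] this]
    have "Cinf ?V (\<lambda>y. snd e (cinv c (\<Phi> (?t y))))" using pts(2) by blast
    then have "Cinf ?V (snd e \<circ> f \<circ> cinv d)"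
      by (rule Cinf_cong[OF V, rotated]) (simp add: pts(3))
    then show ?thesis using smooth_on_open[OF V] by blast
  qed
  then show ?thesis unfolding smooth_map_on_def using cont by blast
qed

lemma chart_diffeo:
  assumes c: "c \<in> A" and Y: "open Y" "Y \<subseteq> snd c ` fst c" and Y': "open Y'" "Y' \<subseteq> snd c ` fst c"
    and \<Phi>: "Cinf Y \<Phi>" "\<Phi> ` Y \<subseteq> Y'" and \<Psi>: "Cinf Y' \<Psi>" "\<Psi> ` Y' \<subseteq> Y"
    and inv: "\<forall>y\<in>Y. \<Psi> (\<Phi> y) = y" "\<forall>y\<in>Y'. \<Phi> (\<Psi> y) = y"
    and \<tau>: "\<tau> = (\<lambda>x. cinv c (\<Phi> (snd c x)))"
  shows "diffeo A (cinv c ` Y) (cinv c ` Y') \<tau>"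
    and "\<And>x. x \<in> cinv c ` Y' \<Longrightarrow> inv_into (cinv c ` Y) \<tau> x = cinv c (\<Psi> (snd c x))"
proof -
  let ?U = "cinv c ` Y" and ?V = "cinv c ` Y'"
  have sc: "snd c (cinv c y) = y" if "y \<in> Y \<union> Y'" for y
    using that Y(2) Y'(2) by (intro chart_cinv) blast
  have \<tau>Y: "\<tau> (cinv c y) = cinv c (\<Phi> y)" if "y \<in> Y" for y using that by (simp add: \<tau> sc)
  have inj: "inj_on \<tau> ?U"
  proof (rule inj_on_inverseI[of _ "\<lambda>x. cinv c (\<Psi> (snd c x))"])
    fix x assume "x \<in> ?U"
    then obtain y where y: "y \<in> Y" "x = cinv c y" by blast
    then have "\<Phi> y \<in> Y'" using \<Phi>(2) by blast
    then show "cinv c (\<Psi> (snd c (\<tau> x))) = x" using y by (simp add: \<tau>Y sc inv(1))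
  qed
  have im: "\<tau> ` ?U = ?V"
  proof
    show "\<tau> ` ?U \<subseteq> ?V" using \<tau>Y \<Phi>(2) by auto
    show "?V \<subseteq> \<tau> ` ?U"
    proof
      fix x assume "x \<in> ?V"
      then obtain y where y: "y \<in> Y'" "x = cinv c y" by blast
      then have "\<Psi> y \<in> Y" using \<Psi>(2) by blast
      then have "\<tau> (cinv c (\<Psi> y)) = x" using y by (simp add: \<tau>Y inv(2))
      then show "x \<in> \<tau> ` ?U" using \<open>\<Psi> y \<in> Y\<close> by blast
    qed
  qed
  show i: "inv_into ?U \<tau> x = cinv c (\<Psi> (snd c x))" if xV: "x \<in> ?V" for x
  proof -
    obtain y where y: "y \<in> Y'" "x = cinv c y" using xV by blast
    then have \<Psi>y: "\<Psi> y \<in> Y" using \<Psi>(2) by blast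
    show ?thesis
      by (rule inv_into_f_eq[OF inj]) (use y \<Psi>y in \<open>auto simp: sc \<tau>Y inv(2)\<close>)
  qed
  have "smooth_map_on A ?U \<tau>"
    by (rule smooth_map_on_chart[OF c Y \<Phi>(1)]) (use \<Phi>(2) Y'(2) \<tau> in auto)
  moreover have "smooth_map_on A ?V (inv_into ?U \<tau>)"
    by (rule smooth_map_on_chart[OF c Y' \<Psi>(1) _ i]) (use \<Psi>(2) Y(2) in auto)
  ultimately show "diffeo A ?U ?V \<tau>"
    unfolding diffeo_def bij_betw_def using inj im open_cinv_image[OF c Y] open_cinv_image[OF c Y'] by blast
qed

end

section \<open>Naturality along a fibre\<close>

context atlas
begin

text \<open>In the chart \<open>c\<close>, pushing forward amounts to pulling the matrix function
  back along the inverse \<open>\<Psi>\<close>.\<close>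

lemma push_chart_metric:
  assumes c: "c \<in> A" and Y: "open Y" "Y \<subseteq> snd c ` fst c" and Y': "open Y'" "Y' \<subseteq> snd c ` fst c"
    and \<Phi>: "Cinf Y \<Phi>" "\<Phi> ` Y \<subseteq> Y'" and \<Psi>: "Cinf Y' \<Psi>" "\<Psi> ` Y' \<subseteq> Y"
    and inv: "\<forall>y\<in>Y. \<Psi> (\<Phi> y) = y" "\<forall>y\<in>Y'. \<Phi> (\<Psi> y) = y"
    and \<tau>: "\<tau> = (\<lambda>x. cinv c (\<Phi> (snd c x)))"
    and y: "y \<in> cinv c ` Y'" "d \<in> charts_at A y"
  shows "push_metric A \<tau> (cinv c ` Y) (chart_metric c G) y d
    = chart_metric c (\<lambda>z. transpose (jacobian \<Psi> (at z)) ** G (\<Psi> z) ** jacobian \<Psi> (at z)) y d"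
proof -
  let ?U = "cinv c ` Y" and ?V = "cinv c ` Y'"
  define \<sigma> where "\<sigma> = inv_into ?U \<tau>"
  note df = chart_diffeo[OF c Y Y' \<Phi> \<Psi> inv \<tau>]
  have \<sigma>_eq: "\<sigma> x = cinv c (\<Psi> (snd c x))" if "x \<in> ?V" for x
    unfolding \<sigma>_def by (rule df(2)[OF that])
  have \<sigma>: "smooth_map_on A ?V \<sigma>" "open ?V" using df(1) unfolding diffeo_def \<sigma>_def by blast+
  note d = charts_atD[OF y(2)]
  obtain z where z: "z \<in> Y'" "y = cinv c z" using y(1) by blast
  have z_im: "z \<in> snd c ` fst c" and \<Psi>z: "\<Psi> z \<in> Y" "\<Psi> z \<in> snd c ` fst c"
    using z(1) Y'(2) \<Psi>(2) Y(2) by blast+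
  have yc: "y \<in> fst c" "snd c y = z" using z z_im cinv_in[OF z_im] chart_cinv[OF z_im] by simp_all
  define c0 where "c0 = some_chart A (\<sigma> y)"
  note c0 = charts_atD[OF some_chart[of "\<sigma> y"], folded c0_def]
  have \<sigma>y: "snd c (\<sigma> y) = \<Psi> z" "\<sigma> y \<in> fst c"
    unfolding \<sigma>_eq[OF y(1)] yc(2) using chart_cinv[OF \<Psi>z(2)] cinv_in[OF \<Psi>z(2)] by simp_all
  have "jac c c \<sigma> y = jacobian \<Psi> (at z)"
    unfolding z(2) by (rule jac_chart_map[OF c Y' \<Psi>(1) _ z(1) \<sigma>_eq]) (use \<Psi>(2) Y(2) in blast)
  \<comment> \<open>Both sides are the Jacobian of \<open>\<sigma>\<close> from \<open>d\<close> to
    \<open>c\<close>: one factors through the chart \<open>c0\<close> picked by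
    \<open>push_metric\<close>, the other through \<open>c\<close> at the source. The arbitrary
    choice of \<open>c0\<close> thus drops out.\<close>
  then have J: "jac c0 c id (\<sigma> y) ** jac d c0 \<sigma> y = jacobian \<Psi> (at z) ** jac d c id y"
    using jac_compose_target[OF \<sigma> c0(1) d(1) c y(1) d(2) c0(2) \<sigma>y(2)]
      jac_compose_source[OF \<sigma> c d(1) c y(1) yc(1) d(2) \<sigma>y(2)] by simp
  have "push_metric A \<tau> ?U (chart_metric c G) y d
    = transpose (jac c0 c id (\<sigma> y) ** jac d c0 \<sigma> y) ** G (\<Psi> z) ** (jac c0 c id (\<sigma> y) ** jac d c0 \<sigma> y)"
    unfolding push_metric_def Let_def \<sigma>_def[symmetric] c0_def[symmetric] chart_metric_def \<sigma>y(1)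
    by (simp add: matrix_transpose_mul matrix_mul_assoc)
  also have "\<dots> = chart_metric c (\<lambda>z. transpose (jacobian \<Psi> (at z)) ** G (\<Psi> z) ** jacobian \<Psi> (at z)) y d"
    unfolding J chart_metric_def yc(2) by (simp add: matrix_transpose_mul matrix_mul_assoc)
  finally show ?thesis .
qed

end

context fibre_tensor
begin

lemma taylor2_add_quad:
  "taylor2 y0 G0 G1 (H + quad (outer l l) \<alpha>) y = taylor2 y0 G0 G1 H y + ((l \<bullet> (y - y0))\<^sup>2 * (1/2)) *\<^sub>R \<alpha>"
proof -
  let ?z = "y - y0"
  have "(\<Sum>k\<in>UNIV. \<Sum>m\<in>UNIV. (?z $ k * ?z $ m) *\<^sub>R quad (outer l l) \<alpha> $ k $ m) = ((l \<bullet> ?z)\<^sup>2) *\<^sub>R \<alpha>"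
  proof -
    have "quad (outer l l) \<alpha> $ k $ m = (l $ k * l $ m) *\<^sub>R \<alpha>" for k m
      by (simp add: vec_eq_iff)
    then have "(\<Sum>k\<in>UNIV. \<Sum>m\<in>UNIV. (?z $ k * ?z $ m) *\<^sub>R quad (outer l l) \<alpha> $ k $ m)
      = (\<Sum>k\<in>UNIV. \<Sum>m\<in>UNIV. (l $ k * ?z $ k) * (l $ m * ?z $ m)) *\<^sub>R \<alpha>"
      by (simp only: scaleR_sum_left scaleR_scaleR mult.left_commute mult.commute mult.assoc)
    also have "(\<Sum>k\<in>UNIV. \<Sum>m\<in>UNIV. (l $ k * ?z $ k) * (l $ m * ?z $ m)) = (l \<bullet> ?z)\<^sup>2"
      unfolding inner_vec_def power2_eq_square sum_product by simp
    finally show ?thesis .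
  qed
  then show ?thesis unfolding taylor2_def by (simp add: scaleR_add_right sum.distrib)
qed

text \<open>A shear carries \<open>quadm H\<close> to a metric with the 2-jet of
  \<open>quadm\<close> at the translated array, while it acts trivially on tensors at
  \<open>x\<close>; naturality equates the two values.\<close>

lemma fT_natural_aux:
  assumes nat: "natural_tensor A q r T" and tens: "T (jet A q r 2 x (quadm H)) \<in> tensors_at A p x"
    and lw: "l \<bullet> w \<noteq> 0" and H: "sym4 H = H"
  shows "fT J (H + quad (outer l l) (outer (G0 *v w) l + outer l (G0 *v w))) = fT J H"
proof -
  interpret sh: shear y0 l w by unfold_locales (rule lw)
  define \<alpha> where "\<alpha> = outer (G0 *v w) l + outer l (G0 *v w)"
  define \<theta> where "\<theta> = quad (outer l l) \<alpha>"
  define Q where "Q = taylor2 y0 G0 G1 H"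
  define Q2 where "Q2 = taylor2 y0 G0 G1 (H + \<theta>)"
  define \<beta> where "\<beta> = - (l \<bullet> w) / 3"
  \<comment> \<open>Pushing forward along \<open>\<Phi>\<close> pulls back along
    \<open>\<Psi>\<close>, so the signs are chosen to make \<open>\<Psi>\<close> the shear of
    \<open>van_pullback\<close>.\<close>
  define \<Phi> where "\<Phi> = sh.sh (- \<beta>)"
  define \<Psi> where "\<Psi> = sh.sh \<beta>"
  let ?O = "snd c ` fst c"
  \<comment> \<open>Shrunk so that \<open>\<Phi>\<close> and \<open>\<Psi>\<close> are mutually
    inverse maps between two open subsets of the chart image.\<close>
  define Y where "Y = ?O \<inter> (sh.sdom (- \<beta>) \<inter> \<Phi> -` ?O)"
  define Y' where "Y' = ?O \<inter> (sh.sdom \<beta> \<inter> \<Psi> -` ?O)"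
  have oO: "open ?O" by (rule open_img[OF cA])
  have Cs: "Cinf (sh.sdom (- \<beta>)) \<Phi>" "Cinf (sh.sdom \<beta>) \<Psi>"
    unfolding \<Phi>_def \<Psi>_def by (rule sh.Cinf_sh)+
  have Y: "open Y" "Y \<subseteq> ?O" and Y': "open Y'" "Y' \<subseteq> ?O"
    unfolding Y_def Y'_def
    using open_Int[OF oO continuous_open_preimage[OF Cinf_continuous_on[OF Cs(1)] sh.open_sdom oO]]
      open_Int[OF oO continuous_open_preimage[OF Cinf_continuous_on[OF Cs(2)] sh.open_sdom oO]]
    by auto
  have y0Y: "y0 \<in> Y" "y0 \<in> Y'" using y0_in unfolding Y_def Y'_def \<Phi>_def \<Psi>_def by simp_all
  have inv: "\<Psi> (\<Phi> y) = y" "\<Phi> y \<in> sh.sdom \<beta>" if "y \<in> sh.sdom (- \<beta>)" for y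
    using sh.sh_inverse[OF that] unfolding \<Phi>_def \<Psi>_def by simp_all
  have inv': "\<Phi> (\<Psi> y) = y" "\<Psi> y \<in> sh.sdom (- \<beta>)" if "y \<in> sh.sdom \<beta>" for y
    using sh.sh_inverse[OF that] unfolding \<Phi>_def \<Psi>_def by simp_all
  have \<Phi>: "Cinf Y \<Phi>" "\<Phi> ` Y \<subseteq> Y'" and \<Psi>: "Cinf Y' \<Psi>" "\<Psi> ` Y' \<subseteq> Y"
    using inv inv' by (auto intro!: Cinf_subset[OF Cs(1)] Cinf_subset[OF Cs(2)] simp: Y_def Y'_def)
  have invY: "\<forall>y\<in>Y. \<Psi> (\<Phi> y) = y" "\<forall>y\<in>Y'. \<Phi> (\<Psi> y) = y"
    using inv inv' by (auto simp: Y_def Y'_def)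
  define \<tau> where "\<tau> = (\<lambda>x. cinv c (\<Phi> (snd c x)))"
  let ?U = "cinv c ` Y" and ?V = "cinv c ` Y'"
  note df = chart_diffeo[OF cA Y Y' \<Phi> \<Psi> invY \<tau>_def]
  have \<Phi>0: "\<Phi> y0 = y0" "\<Psi> y0 = y0" unfolding \<Phi>_def \<Psi>_def by simp_all
  have \<tau>x: "\<tau> x = x" unfolding \<tau>_def y0_def[symmetric] \<Phi>0 by simp
  have xU: "x \<in> ?U" "x \<in> ?V" using imageI[OF y0Y(1), of "cinv c"] imageI[OF y0Y(2), of "cinv c"] by simp_all
  define G' where "G' z = transpose (jacobian \<Psi> (at z)) ** Q (\<Psi> z) ** jacobian \<Psi> (at z)" for z
  have H': "\<And>k l. H $ k $ l = H $ l $ k" "\<And>k l. transpose (H $ k $ l) = H $ k $ l"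
    using H unfolding sym4_eq_iff by auto
  have Q_inf: "Cinf UNIV Q" "Cinf UNIV Q2" unfolding Q_def Q2_def by (rule Cinf_taylor2)+
  have Q0: "Q y0 = G0" unfolding Q_def by simp
  have Q_sym: "transpose (Q z) = Q z" for z
    unfolding Q_def by (rule transpose_taylor2[OF G0_sym G1_sym H'(2)])
  have G'_inf: "Cinf Y' G'"
  proof -
    have "Cinf Y' (\<lambda>z. Q (\<Psi> z))" by (rule Cinf_compose[OF Y'(1) open_UNIV _ Q_inf(1) \<Psi>(1)]) simp
    then show ?thesis unfolding G'_def[abs_def]
      by (intro Cinf_matrix_mult Cinf_transpose Cinf_jacobian \<Psi>(1) Y'(1))
  qed
  have G'_sym: "transpose (G' z) = G' z" for z
    unfolding G'_def by (simp add: matrix_transpose_mul Q_sym matrix_mul_assoc)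
  have "jacobian \<Psi> (at y0) = mat 1" "jacobian \<Phi> (at y0) = mat 1"
    unfolding \<Psi>_def \<Phi>_def by (simp_all add: sh.jacobian_sh)
  note jac0 = this
  have G'0: "G' y0 = G0" unfolding G'_def jac0 \<Phi>0 Q0 by (simp add: transpose_mat)
  let ?h = "chart_metric c G'"
  obtain W where "open W" and W: "y0 \<in> W" and "W \<subseteq> Y'" "W \<subseteq> ?O" "metric_on A q r (cinv c ` W) ?h"
    and Wn: "\<forall>y\<in>W. ?h \<in> metrics_near A q r (cinv c y)" and "\<forall>y\<in>W. jet2_coords ?h c (cinv c y)
       = (y, G' y, (\<chi> k. pd k G' y), (\<chi> k l. pd k (pd l G') y))"
    by (rule chart_metric_facts[where G = G', OF Y'(1) y0Y(2) G'_inf G'_sym G'0])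
  have h_near: "?h \<in> metrics_near A q r x" using bspec[OF Wn W] by simp
  have \<theta>_sym: "sym4 \<theta> = \<theta>"
    unfolding \<theta>_def \<alpha>_def sym4_eq_iff transpose_eq_iff by (simp add: vec_eq_iff mult.commute add.commute)
  have H\<theta>: "sym4 (H + \<theta>) = H + \<theta>"
    by (simp only: sym4_add H \<theta>_sym)
  have v: "van 3 y0 (\<lambda>y. G' y - Q2 y)"
  proof -
    have "transpose (Q y0) = Q y0" by (rule Q_sym)
    from sh.van_pullback[OF Q_inf(1) this]
    show ?thesis
      unfolding G'_def \<Psi>_def \<beta>_def Q2_def \<theta>_def taylor2_add_quad
      unfolding \<alpha>_def Q_def[symmetric] Q0 sh.s_def .
  qed
  have "jet A q r 2 x ?h = jet A q r 2 x (quadm (H + \<theta>))"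
  proof (rule jet_eqI[OF h_near quadm_near(1)[OF H\<theta>] c_at])
    have "van 3 y0 (\<lambda>y. local_rep ?h c y - local_rep (quadm (H + \<theta>)) c y)"
    proof (rule van_cong[OF Y'(1) y0Y(2) _ _ v])
      show "Cinf Y' (\<lambda>y. G' y - Q2 y)"
        by (rule Cinf_diff[OF Y'(1) G'_inf Cinf_subset[OF Q_inf(2)]]) simp
      show "G' y - Q2 y = local_rep ?h c y - local_rep (quadm (H + \<theta>)) c y" if "y \<in> Y'" for y
      proof -
        have "y \<in> ?O" using that Y'(2) by blast
        from local_rep_chart_metric[OF cA this] show ?thesis by (simp add: Q2_def)
      qed
    qed
    then show "van (Suc 2) (snd c x) (\<lambda>y. local_rep ?h c y - local_rep (quadm (H + \<theta>)) c y)"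
      by (simp add: y0_def numeral_3_eq_3 numeral_2_eq_2)
  qed
  moreover have "jet A q r 2 x (push_metric A \<tau> ?U (quadm H)) = jet A q r 2 x ?h"
  proof (rule jet_cong[OF h_near open_cinv_image[OF cA Y'] xU(2)])
    show "push_metric A \<tau> ?U (quadm H) y d = ?h y d" if "y \<in> ?V" "d \<in> charts_at A y" for y d
      using push_chart_metric[OF cA Y Y' \<Phi> \<Psi> invY \<tau>_def that, of "taylor2 y0 G0 G1 H"]
      unfolding G'_def[abs_def] Q_def .
  qed
  moreover have "T (jet A q r 2 (\<tau> x) (push_metric A \<tau> ?U (quadm H)))
      = push_tensor A \<tau> x (T (jet A q r 2 x (quadm H)))"
    using nat df(1) xU(1) quadm_near(1)[OF H] unfolding natural_tensor_def by blast
  ultimately have "T (jet A q r 2 x (quadm (H + \<theta>))) c J = push_tensor A \<tau> x (T (jet A q r 2 x (quadm H))) c J"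
    by (simp add: \<tau>x)
  \<comment> \<open>Since \<open>\<tau>\<close> fixes \<open>x\<close> with identity Jacobian,
    \<open>push_tensor\<close> is here only a change of charts.\<close>
  also have "\<dots> = T (jet A q r 2 x (quadm H)) c J"
  proof -
    define c1 where "c1 = some_chart A x"
    have c1_at: "c1 \<in> charts_at A x" unfolding c1_def by (rule some_chart)
    note c1 = charts_atD[OF c1_at]
    have sm: "smooth_map_on A ?U \<tau>" "open ?U" using df(1) unfolding diffeo_def by blast+
    have "jac c1 c \<tau> x = jac c c \<tau> x ** jac c1 c id x"
      by (rule jac_compose_source[OF sm cA c1(1) cA xU(1) x_dom c1(2)]) (simp add: \<tau>x x_dom)
    moreover have "jac c c \<tau> (cinv c y0) = jacobian \<Phi> (at y0)"
      by (rule jac_chart_map[OF cA Y \<Phi>(1) _ y0Y(1)]) (use \<Phi>(2) Y'(2) in \<open>auto simp: \<tau>_def\<close>)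
    ultimately have "jac c1 c \<tau> x = jac c1 c id x" by (simp add: jac0)
    moreover have "T (jet A q r 2 x (quadm H)) c = transform (jac c1 c id x) (T (jet A q r 2 x (quadm H)) c1)"
      using tens c1_at c_at unfolding tensors_at_def by blast
    ultimately show ?thesis
      unfolding push_tensor_def \<tau>x c1_def[symmetric] using c_at by simp
  qed
  finally show ?thesis
    unfolding T_quadm[OF H\<theta>] T_quadm[OF H] unfolding \<theta>_def \<alpha>_def .
qed

text \<open>Nondegeneracy of \<open>G0\<close> writes \<open>v\<close> as \<open>G0 *v w\<close>.
  The shear requires \<open>l \<bullet> w \<noteq> 0\<close>; otherwise too, \<open>w\<close> is a
  sum of two vectors with this property, and the translation splits accordingly.\<close>

lemma fT_natural:
  assumes nat: "natural_tensor A q r T"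
    and tens: "\<And>g. g \<in> metrics_near A q r x \<Longrightarrow> T (jet A q r 2 x g) \<in> tensors_at A p x"
  shows "fT J (H + quad (outer l l) (outer v l + outer l v)) = fT J H"
proof (cases "l = 0")
  case True
  then have "quad (outer l l) (outer v l + outer l v) = 0" by (simp add: vec_eq_iff)
  then show ?thesis by simp
next
  case False
  let ?\<theta> = "\<lambda>v. quad (outer l l) (outer v l + outer l v)"
  have \<theta>_sym: "sym4 (?\<theta> v) = ?\<theta> v" for v
    unfolding sym4_eq_iff transpose_eq_iff by (simp add: vec_eq_iff mult.commute add.commute)
  have step: "fT J (H + ?\<theta> (G0 *v w)) = fT J H" if "l \<bullet> w \<noteq> 0" for w H
  proof -
    have "fT J (H + ?\<theta> (G0 *v w)) = fT J (sym4 H + ?\<theta> (G0 *v w))"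
      using fT_sym4[of J "H + ?\<theta> (G0 *v w)"] by (simp only: sym4_add \<theta>_sym)
    also have "\<dots> = fT J (sym4 H)"
      by (rule fT_natural_aux[OF nat tens[OF quadm_near(1)] that]) simp_all
    finally show ?thesis by simp
  qed
  obtain w where w: "G0 *v w = v" by (rule has_signature_surj[OF G0_signature])
  \<comment> \<open>The two cases keep \<open>l \<bullet> w - a * (l \<bullet> l)\<close> away from
    0, while \<open>a\<close> itself is nonzero.\<close>
  define a where "a = (if l \<bullet> w = l \<bullet> l then 2 else 1 :: real)"
  have "l \<bullet> l \<noteq> 0" using False by simp
  then have n: "l \<bullet> (w - a *\<^sub>R l) \<noteq> 0" "l \<bullet> (a *\<^sub>R l) \<noteq> 0"
    by (auto simp: a_def inner_diff_right)
  have split: "H + ?\<theta> v = (H + ?\<theta> (G0 *v (w - a *\<^sub>R l))) + ?\<theta> (G0 *v (a *\<^sub>R l))"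
  proof -
    have "v = G0 *v (w - a *\<^sub>R l) + G0 *v (a *\<^sub>R l)"
      by (simp add: w flip: matrix_vector_right_distrib)
    then show ?thesis by (simp add: vec_eq_iff algebra_simps)
  qed
  show ?thesis unfolding split step[OF n(2)] step[OF n(1)] ..
qed

end

theorem theorem3p5:
  fixes A :: "('x::{t2_space, second_countable_topology}, 'n::finite) chart set"
    and p q r :: nat
  assumes "smooth_atlas A"
    and "p \<ge> 1"
    and "q + r = CARD('n)"
  shows "(\<forall>x m. m \<ge> 1 \<and> real m \<ge> real CARD('n) / 2 \<longrightarrow> Div A p m x = {\<lambda>_ _. 0}) \<and>
         (\<forall>T. second_order_tensor A q r p T \<and> natural_tensor A q r T \<and> divergence_free A q r p T \<longrightarrow>
            polynomial_tensor_deg_less A q r (Suc ((CARD('n) - 1) div 2)) T)"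
proof (intro conjI allI impI)
  fix x m assume "m \<ge> 1 \<and> real m \<ge> real CARD('n) / 2"
  then show "Div A p m x = {\<lambda>_ _. 0}" by (intro Div_eq_zero assms(2)) auto
next
  fix T :: "('x, 'n) jet \<Rightarrow> ('x, 'n) tensor"
  assume T: "second_order_tensor A q r p T \<and> natural_tensor A q r T \<and> divergence_free A q r p T"
  \<comment> \<open>The least \<open>m\<close> with \<open>CARD('n) \<le> 2 * m\<close>; degree less
    than \<open>?m\<close> means degree at most \<open>(CARD('n) - 1) / 2\<close>.\<close>
  let ?m = "Suc ((CARD('n) - 1) div 2)"
  show "polynomial_tensor_deg_less A q r ?m T"
    unfolding polynomial_tensor_deg_less_def
  proof (intro allI ballI)
    fix x g c and J :: "'n list"
    assume g: "g \<in> metrics_near A q r x" and c: "c \<in> charts_at A x"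
    interpret atlas A by unfold_locales (rule assms(1))
    have tens: "T (jet A q r 2 x h) \<in> tensors_at A p x" if "h \<in> metrics_near A q r x" for h
      using T that unfolding second_order_tensor_def by blast
    show "\<exists>P. poly_deg_less ?m P \<and> (\<forall>h\<in>metrics_near A q r x. jet A q r 1 x h = jet A q r 1 x g \<longrightarrow>
           T (jet A q r 2 x h) c J = P (\<lambda>(a, b, k, l). second_derivs h c x $ k $ l $ a $ b))"
    proof (cases "length J = p")
      \<comment> \<open>Components for index lists of the wrong length are 0 by convention.\<close>
      case False
      then show ?thesis
        using tensors_at_eq_zero[OF tens] by (intro exI[of _ "\<lambda>_. 0"]) (simp add: poly_deg_less_zero)
    next
      case True
      define J' where "J' = butlast J"
      define k where "k = last J"
      have "J \<noteq> []" using True assms(2) by auto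
      then have J: "J = J' @ [k]" by (simp add: J'_def k_def)
      have J': "length J' = p - 1" using True by (simp add: J'_def)
      have "\<forall>J. \<exists>F :: _ \<Rightarrow> real.
          smooth_on {jet2_coords g c x | x g. x \<in> fst c \<and> g \<in> metrics_near A q r x} F \<and>
          (\<forall>x\<in>fst c. \<forall>g\<in>metrics_near A q r x. T (jet A q r 2 x g) c J = F (jet2_coords g c x))"
        using T charts_atD(1)[OF c] unfolding second_order_tensor_def by blast
      then obtain F :: "'n list \<Rightarrow> (real^'n) \<times> (real^'n^'n) \<times> (real^'n^'n^'n) \<times> (real^'n^'n^'n^'n) \<Rightarrow> real"
        where F: "\<forall>J. smooth_on {jet2_coords g c x | x g. x \<in> fst c \<and> g \<in> metrics_near A q r x} (F J) \<and>
          (\<forall>x\<in>fst c. \<forall>g\<in>metrics_near A q r x. T (jet A q r 2 x g) c J = F J (jet2_coords g c x))"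
        unfolding choice_iff by (elim exE)
      interpret fibre A q r c x g by unfold_locales (rule c, rule g)
      interpret fibre_tensor A q r c x g T p F
        by unfold_locales (use F in \<open>simp_all add: JS_def\<close>)
      \<comment> \<open>The last index is left free because the divergence contracts it; it is the
        one paired with the vectors \<open>l\<close> and \<open>u\<close>.\<close>
      let ?f = "\<lambda>H. \<chi> j. fT (J' @ [j]) H"
      have "\<exists>P. poly_deg_less ?m P \<and> (\<forall>H. ?f H $ k = P (\<lambda>(a, b, k, l). H $ k $ l $ a $ b))"
      proof (rule polynomial_if_derivative_symmetries)
        show "Cinf UNIV ?f" by (rule Cinf_vecI[OF open_UNIV]) (simp add: Cinf_fT)
        show "l \<bullet> ?f (H + s *\<^sub>R quad (outer l l) (outer u u)) = l \<bullet> ?f H" for H l u s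
          by (rule fT_div_invariant[OF _ J' assms(2)])
            (use T in \<open>simp_all add: transpose_eq_iff mult.commute\<close>)
        show "?f (H + quad (outer l l) (outer v l + outer l v)) = ?f H" for H l v
          using fT_natural[OF _ tens] T by simp
        show "CARD('n) \<le> 2 * ?m" by (simp; presburger)
      qed simp
      then show ?thesis using T_fibre unfolding J by fastforce
    qed
  qed
qed

end
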